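(* Let $G$ be a full DAG with a fixed ample framing, and let $\mathcal{R}(G)$ denote the set of non-exceptional routes in $G$. There is a bijection between $\mathcal{R}(G)$ and $\mathcal{T}(\Lambda(G))$.
   Context: A DAG is a finite directed acyclic graph, possibly with multiple edges; sources have no incoming edges, sinks no outgoing edges, other vertices are inner; $\mathrm{in}(v),\mathrm{out}(v)$ are incoming/outgoing edges. $G$ is full if every inner vertex $v$ has $|\mathrm{in}(v)|=|\mathrm{out}(v)|=2$. A route is a maximal directed path (source to sink). A framing assigns to each inner vertex $v$ linear orders $\prec$ on $\mathrm{in}(v)$ and $\mathrm{out}(v)$. For inner $v$, paths in $\mathrm{Out}(v)$ (from $v$ to a sink) are compared by $P\prec Q$ iff at the last vertex $w$ of their common initial segment the edge of $P$ leaving $w$ precedes that of $Q$ in $\mathrm{out}(w)$; analogously for $\mathrm{In}(v)$ (paths from a source to $v$) at the first vertex of their common final segment using $\mathrm{in}(w)$. For a route $R$ through $v$, $Rv$, $vR$ are its parts before/after $v$. Routes $P,Q$ through a common inner vertex $v$ conflict at $v$ if, after possibly swapping them, $Pv\prec Qv$ and $vQ\prec vP$; coherent if no conflict at any common inner vertex. A route is exceptional if coherent with all routes. A framing is ample if the indicator vectors of exceptional routes lie in no facet of the cone of nonnegative flows on $G$ (equivalently, every non-idle edge lies on an exceptional route). For an ample framing of a full DAG, each edge $e$ with an inner endpoint occupies the same position (first or second) in the order at each of its inner endpoints; put $\omega(e)=1$ if first and $\omega(e)=2$ if second. The quiver $Q$ has vertex set the inner vertices of $G$ and, for each edge $e=(v_1,v_2)$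 of $G$ with both endpoints inner, an arrow $v_1\to v_2$ if $\omega(e)=1$ and $v_2\to v_1$ if $\omega(e)=2$. Let $K$ be an algebraically closed field, $I\subset KQ$ the ideal generated by all length-two paths $e_1e_2$ in $Q$ (composable arrows) with $\omega(e_1)\ne\omega(e_2)$, and $\Lambda(G)=KQ/I$ (a gentle algebra). $\mathcal{T}(\Lambda(G))$ is the union of the set of isomorphism classes of indecomposable finite-dimensional $\Lambda(G)$-modules and the set of formal shifted projectives $\{P_i[1]: i \text{ a vertex of } Q\}$, where $P_i$ is the indecomposable projective at $i$. *)

theory Defs
  imports
    "HOL-Analysis.Polytope"
    "HOL-Algebra.QuotRing"
    "HOL-Algebra.Module"
    "HOL-Computational_Algebra.Polynomial"
    "Graph_Theory.Arc_Walk"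
begin

section \<open>DAGs, framings and routes\<close>

definition is_source :: "('v,'e) pre_digraph \<Rightarrow> 'v \<Rightarrow> bool" where
  "is_source G v \<longleftrightarrow> v \<in> verts G \<and> in_arcs G v = {}"

definition is_sink :: "('v,'e) pre_digraph \<Rightarrow> 'v \<Rightarrow> bool" where
  "is_sink G v \<longleftrightarrow> v \<in> verts G \<and> out_arcs G v = {}"

definition inner_verts :: "('v,'e) pre_digraph \<Rightarrow> 'v set" where
  "inner_verts G = {v \<in> verts G. \<not> is_source G v \<and> \<not> is_sink G v}"

locale dag = fin_digraph G for G :: "('v,'e) pre_digraph" +
  assumes acyclic: "acyclic (arcs_ends G)"

locale full_dag = dag G for G :: "('v,'e) pre_digraph" +
  assumes full: "v \<in> inner_verts G \<Longrightarrow> in_degree G v = 2 \<and> out_degree G v = 2"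

text \<open>The orders are reflexive relations in the style of \<^const>\<open>linear_order_on\<close>;
  the strict order of the text is their irreflexive part.\<close>

record ('v,'e) framing =
  in_ord :: "'v \<Rightarrow> ('e \<times> 'e) set"
  out_ord :: "'v \<Rightarrow> ('e \<times> 'e) set"

definition is_framing :: "('v,'e) pre_digraph \<Rightarrow> ('v,'e) framing \<Rightarrow> bool" where
  "is_framing G F \<longleftrightarrow> (\<forall>v \<in> inner_verts G.
     linear_order_on (in_arcs G v) (in_ord F v) \<and> linear_order_on (out_arcs G v) (out_ord F v))"

text \<open>A route is given by its list of edges. All trivial routes (at isolated vertices) are
  therefore represented by the empty list; they meet no inner vertex, hence are exceptional and
  have zero indicator vector.\<close>

definition routes :: "('v,'e) pre_digraph \<Rightarrow> 'e list set" where
  "routes G = {R. \<exists>u w. is_source G u \<and> is_sink G w \<and> pre_digraph.awalk G u R w}"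

text \<open>The inner vertices on a route are exactly the inner vertices that are the tail of one of
  its edges.\<close>

definition passes :: "('v,'e) pre_digraph \<Rightarrow> 'e list \<Rightarrow> 'v \<Rightarrow> bool" where
  "passes G R v \<longleftrightarrow> v \<in> inner_verts G \<and> v \<in> tail G ` set R"

text \<open>The parts \<open>Rv\<close> and \<open>vR\<close>.\<close>

definition part_before :: "('v,'e) pre_digraph \<Rightarrow> 'v \<Rightarrow> 'e list \<Rightarrow> 'e list" where
  "part_before G v R = takeWhile (\<lambda>e. tail G e \<noteq> v) R"

definition part_after :: "('v,'e) pre_digraph \<Rightarrow> 'v \<Rightarrow> 'e list \<Rightarrow> 'e list" where
  "part_after G v R = dropWhile (\<lambda>e. tail G e \<noteq> v) R"

definition out_less :: "('v,'e) pre_digraph \<Rightarrow> ('v,'e) framing \<Rightarrow> 'e list \<Rightarrow> 'e list \<Rightarrow> bool" where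
  "out_less G F P Q \<longleftrightarrow> (\<exists>s a b p q. P = s @ a # p \<and> Q = s @ b # q \<and> a \<noteq> b \<and>
     (a, b) \<in> out_ord F (tail G a))"

definition in_less :: "('v,'e) pre_digraph \<Rightarrow> ('v,'e) framing \<Rightarrow> 'e list \<Rightarrow> 'e list \<Rightarrow> bool" where
  "in_less G F P Q \<longleftrightarrow> (\<exists>s a b p q. P = p @ a # s \<and> Q = q @ b # s \<and> a \<noteq> b \<and>
     (a, b) \<in> in_ord F (head G a))"

definition conflict_at :: "('v,'e) pre_digraph \<Rightarrow> ('v,'e) framing \<Rightarrow> 'v \<Rightarrow> 'e list \<Rightarrow> 'e list \<Rightarrow> bool"
  where "conflict_at G F v P Q \<longleftrightarrow>
    in_less G F (part_before G v P) (part_before G v Q) \<and>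
      out_less G F (part_after G v Q) (part_after G v P) \<or>
    in_less G F (part_before G v Q) (part_before G v P) \<and>
      out_less G F (part_after G v P) (part_after G v Q)"

definition coherent :: "('v,'e) pre_digraph \<Rightarrow> ('v,'e) framing \<Rightarrow> 'e list \<Rightarrow> 'e list \<Rightarrow> bool" where
  "coherent G F P Q \<longleftrightarrow> (\<forall>v. passes G P v \<and> passes G Q v \<longrightarrow> \<not> conflict_at G F v P Q)"

definition exceptional_routes :: "('v,'e) pre_digraph \<Rightarrow> ('v,'e) framing \<Rightarrow> 'e list set" where
  "exceptional_routes G F = {R \<in> routes G. \<forall>Q \<in> routes G. coherent G F R Q}"

definition nonexceptional_routes :: "('v,'e) pre_digraph \<Rightarrow> ('v,'e) framing \<Rightarrow> 'e list set" where
  "nonexceptional_routes G F = routes G - exceptional_routes G F"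

definition flow_cone :: "('v,'e::finite) pre_digraph \<Rightarrow> (real ^ 'e) set" where
  "flow_cone G = {x. (\<forall>e. 0 \<le> x $ e) \<and> (\<forall>e. e \<notin> arcs G \<longrightarrow> x $ e = 0) \<and>
     (\<forall>v \<in> inner_verts G. (\<Sum>e \<in> in_arcs G v. x $ e) = (\<Sum>e \<in> out_arcs G v. x $ e))}"

definition route_vec :: "'e::finite list \<Rightarrow> real ^ 'e" where
  "route_vec R = (\<chi> e. if e \<in> set R then 1 else 0)"

definition ample :: "('v,'e::finite) pre_digraph \<Rightarrow> ('v,'e) framing \<Rightarrow> bool" where
  "ample G F \<longleftrightarrow> \<not> (\<exists>S. S facet_of flow_cone G \<and> route_vec ` exceptional_routes G F \<subseteq> S)"


section \<open>The quiver\<close>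

text \<open>Position, counted from 1, of \<open>e\<close> in the linear order \<open>r\<close>.\<close>

definition position :: "('e \<times> 'e) set \<Rightarrow> 'e \<Rightarrow> nat" where
  "position r e = card {f. (f, e) \<in> r}"

text \<open>The common position of \<open>e\<close> at its inner endpoints (unspecified, and irrelevant, for an edge
  from a source to a sink).\<close>

definition omega :: "('v,'e) pre_digraph \<Rightarrow> ('v,'e) framing \<Rightarrow> 'e \<Rightarrow> nat" where
  "omega G F e = (THE k.
     (tail G e \<in> inner_verts G \<longrightarrow> position (out_ord F (tail G e)) e = k) \<and>
     (head G e \<in> inner_verts G \<longrightarrow> position (in_ord F (head G e)) e = k))"

definition quiver :: "('v,'e) pre_digraph \<Rightarrow> ('v,'e) framing \<Rightarrow> ('v,'e) pre_digraph" where
  "quiver G F =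
    \<lparr> verts = inner_verts G,
      arcs = {e \<in> arcs G. tail G e \<in> inner_verts G \<and> head G e \<in> inner_verts G},
      tail = (\<lambda>e. if omega G F e = 1 then tail G e else head G e),
      head = (\<lambda>e. if omega G F e = 1 then head G e else tail G e) \<rparr>"


section \<open>The path algebra and the algebra of a framed DAG\<close>

text \<open>A path is its starting vertex together with its list of arrows, read from left to right.\<close>

type_synonym ('v,'e) qpath = "'v \<times> 'e list"

definition qpaths :: "('v,'e) pre_digraph \<Rightarrow> ('v,'e) qpath set" where
  "qpaths Q = {(u, p). \<exists>v. pre_digraph.awalk Q u p v}"

definition path_elem :: "('v,'e) qpath \<Rightarrow> ('v,'e) qpath \<Rightarrow> 'k::field" where
  "path_elem x = (\<lambda>y. if y = x then 1 else 0)"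

text \<open>The product is the bilinear extension of concatenation of paths (first the left factor, then
  the right one; zero if not composable): the ways of writing a path \<open>r\<close> as a product of two paths
  correspond to the places at which \<open>r\<close> can be cut.\<close>

definition path_algebra :: "('v,'e) pre_digraph \<Rightarrow> (('v,'e) qpath \<Rightarrow> 'k::field) ring" where
  "path_algebra Q =
    \<lparr> carrier = {f. finite {x. f x \<noteq> 0} \<and> {x. f x \<noteq> 0} \<subseteq> qpaths Q},
      mult = (\<lambda>f g (u, r). \<Sum>i\<le>length r.
                f (u, take i r) * g (pre_digraph.awlast Q u (take i r), drop i r)),
      one = (\<lambda>(u, r). if u \<in> verts Q \<and> r = [] then 1 else 0),
      zero = (\<lambda>_. 0),
      add = (\<lambda>f g x. f x + g x) \<rparr>"

lemma awlast_awlast: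
  "pre_digraph.awlast Q (pre_digraph.awlast Q u p) q = pre_digraph.awlast Q u (p @ q)"
  by (simp add: pre_digraph.awalk_verts_conv)

lemma qpaths_append:
  assumes "(u, p) \<in> qpaths Q" "(pre_digraph.awlast Q u p, q) \<in> qpaths Q"
  shows "(u, p @ q) \<in> qpaths Q"
proof -
  have *: "pre_digraph.cas Q u p v \<Longrightarrow> pre_digraph.awlast Q u p = v" for u v p
    by (induction p arbitrary: u)
      (auto simp: pre_digraph.cas.simps pre_digraph.awalk_verts.simps pre_digraph.awalk_verts_non_Nil)
  have **: "pre_digraph.cas Q u p v \<Longrightarrow> pre_digraph.cas Q v q w \<Longrightarrow> pre_digraph.cas Q u (p @ q) w"
    for u v w p q
    by (induction p arbitrary: u) (auto simp: pre_digraph.cas.simps)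
  from assms show ?thesis
    unfolding qpaths_def pre_digraph.awalk_def by (fastforce dest: * intro: **)
qed

lemma path_algebra_mult_closed:
  assumes f: "f \<in> carrier (path_algebra Q)" and g: "g \<in> carrier (path_algebra Q)"
  shows "f \<otimes>\<^bsub>path_algebra Q\<^esub> g \<in> carrier (path_algebra Q)"
proof -
  let ?h = "f \<otimes>\<^bsub>path_algebra Q\<^esub> g"
  let ?S = "(\<lambda>((u, p), (w, q)). (u, p @ q)) ` ({x. f x \<noteq> 0} \<times> {x. g x \<noteq> 0})"
  have *: "\<exists>p q. r = p @ q \<and> f (u, p) \<noteq> 0 \<and> g (pre_digraph.awlast Q u p, q) \<noteq> 0"
    if "?h (u, r) \<noteq> 0" for u r
  proof -
    from that have "(\<Sum>i\<le>length r. f (u, take i r) * g (pre_digraph.awlast Q u (take i r), drop i r)) \<noteq> 0"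
      by (simp add: path_algebra_def)
    then obtain i where "f (u, take i r) * g (pre_digraph.awlast Q u (take i r), drop i r) \<noteq> 0"
      by (meson sum.neutral)
    then show ?thesis
      by (intro exI[of _ "take i r"] exI[of _ "drop i r"]) auto
  qed
  have "{x. ?h x \<noteq> 0} \<subseteq> ?S"
    using * by (fastforce simp: image_iff)
  moreover have "finite ?S"
    using f g by (auto simp: path_algebra_def)
  ultimately have "finite {x. ?h x \<noteq> 0}"
    by (rule finite_subset)
  moreover have "{x. ?h x \<noteq> 0} \<subseteq> qpaths Q"
  proof
    fix x assume "x \<in> {x. ?h x \<noteq> 0}"
    moreover obtain u r where "x = (u, r)" by force
    ultimately obtain p q where "x = (u, p @ q)" "f (u, p) \<noteq> 0" "g (pre_digraph.awlast Q u p, q) \<noteq> 0"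
      using * by blast
    then show "x \<in> qpaths Q"
      using f g qpaths_append[of u p Q q] by (auto simp: path_algebra_def)
  qed
  ultimately show ?thesis
    by (simp add: path_algebra_def)
qed

lemma path_algebra_mult_assoc:
  "(f \<otimes>\<^bsub>path_algebra Q\<^esub> g) \<otimes>\<^bsub>path_algebra Q\<^esub> h = f \<otimes>\<^bsub>path_algebra Q\<^esub> (g \<otimes>\<^bsub>path_algebra Q\<^esub> h)"
proof
  fix x :: "('a, 'b) qpath"
  obtain u r where x: "x = (u, r)" by force
  let ?n = "length r"
  let ?w = "\<lambda>i. pre_digraph.awlast Q u (take i r)"
  let ?t = "\<lambda>i j. f (u, take j r) * g (?w j, drop j (take i r)) * h (?w i, drop i r)"
  have "((f \<otimes>\<^bsub>path_algebra Q\<^esub> g) \<otimes>\<^bsub>path_algebra Q\<^esub> h) x = (\<Sum>i\<le>?n. \<Sum>j\<le>i. ?t i j)"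
    unfolding x by (auto simp: path_algebra_def sum_distrib_right min_def intro!: sum.cong)
  also have "\<dots> = (\<Sum>j\<le>?n. \<Sum>k\<le>?n - j. ?t (j + k) j)"
    unfolding sum.Sigma[OF finite_atMost ballI[OF finite_atMost]]
    by (rule sum.reindex_bij_witness[where j = "\<lambda>(i, j). (j, i - j)" and i = "\<lambda>(j, k). (j + k, j)"]) auto
  also have "\<dots> = (f \<otimes>\<^bsub>path_algebra Q\<^esub> (g \<otimes>\<^bsub>path_algebra Q\<^esub> h)) x"
    unfolding x
    by (auto simp: path_algebra_def sum_distrib_left awlast_awlast take_add drop_take
          add.commute mult.assoc intro!: sum.cong)
  finally show "((f \<otimes>\<^bsub>path_algebra Q\<^esub> g) \<otimes>\<^bsub>path_algebra Q\<^esub> h) x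
      = (f \<otimes>\<^bsub>path_algebra Q\<^esub> (g \<otimes>\<^bsub>path_algebra Q\<^esub> h)) x" .
qed


lemma path_algebra_one_closed:
  assumes "finite (verts Q)"
  shows "\<one>\<^bsub>path_algebra Q\<^esub> \<in> carrier (path_algebra Q :: (('v,'e) qpath \<Rightarrow> 'k::field) ring)"
proof -
  let ?A = "path_algebra Q :: (('v,'e) qpath \<Rightarrow> 'k) ring"
  have "{x. \<one>\<^bsub>?A\<^esub> x \<noteq> 0} = verts Q \<times> {[]}"
    by (auto simp: path_algebra_def split: if_splits)
  moreover have "verts Q \<times> {[]} \<subseteq> qpaths Q"
    by (auto simp: qpaths_def pre_digraph.awalk_def pre_digraph.cas.simps)
  ultimately have "finite {x. \<one>\<^bsub>?A\<^esub> x \<noteq> 0} \<and> {x. \<one>\<^bsub>?A\<^esub> x \<noteq> 0} \<subseteq> qpaths Q"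
    using assms by simp
  moreover have "f \<in> carrier ?A \<longleftrightarrow> finite {x. f x \<noteq> 0} \<and> {x. f x \<noteq> 0} \<subseteq> qpaths Q" for f
    by (simp add: path_algebra_def)
  ultimately show ?thesis by blast
qed

lemma path_algebra_ring:
  assumes "wf_digraph Q" "finite (verts Q)"
  shows "ring (path_algebra Q :: (('v,'e) qpath \<Rightarrow> 'k::field) ring)"
proof (rule ringI)
  let ?A = "path_algebra Q :: (('v,'e) qpath \<Rightarrow> 'k) ring"
  show "abelian_group ?A"
  proof (rule abelian_groupI)
    fix f g assume f: "f \<in> carrier ?A" and g: "g \<in> carrier ?A"
    have "{x. f x + g x \<noteq> 0} \<subseteq> {x. f x \<noteq> 0} \<union> {x. g x \<noteq> 0}" by auto
    with f g show "f \<oplus>\<^bsub>?A\<^esub> g \<in> carrier ?A"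
      by (auto simp: path_algebra_def intro: finite_subset)
  next
    fix f assume "f \<in> carrier ?A"
    then show "\<exists>g\<in>carrier ?A. g \<oplus>\<^bsub>?A\<^esub> f = \<zero>\<^bsub>?A\<^esub>"
      by (intro bexI[of _ "\<lambda>x. - f x"]) (auto simp: path_algebra_def)
  qed (auto simp: path_algebra_def add.assoc add.commute)
  show "Group.monoid ?A"
  proof (rule monoidI)
    fix f assume f: "f \<in> carrier ?A"
    have src: "u \<in> verts Q" "pre_digraph.awlast Q u p \<in> verts Q" if "f (u, p) \<noteq> 0" for u p
    proof -
      have "\<exists>v. pre_digraph.awalk Q u p v"
        using f that by (auto simp: path_algebra_def qpaths_def)
      then show "u \<in> verts Q" "pre_digraph.awlast Q u p \<in> verts Q"
        using assms(1) by (auto simp: wf_digraph.awalk_conv pre_digraph.awalk_def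
            intro: wf_digraph.awlast_in_verts)
    qed
    show "\<one>\<^bsub>?A\<^esub> \<otimes>\<^bsub>?A\<^esub> f = f"
    proof
      fix x :: "('v,'e) qpath"
      obtain u r where x: "x = (u, r)" by force
      have "(\<one>\<^bsub>?A\<^esub> \<otimes>\<^bsub>?A\<^esub> f) x =
          (\<Sum>i\<le>length r. if i = 0 then (if u \<in> verts Q then f (u, r) else 0) else 0)"
        unfolding x path_algebra_def monoid.simps prod.case
        by (rule sum.cong) (auto simp: pre_digraph.awalk_verts.simps)
      also have "\<dots> = f x"
        using src(1)[of u r] by (auto simp: x)
      finally show "(\<one>\<^bsub>?A\<^esub> \<otimes>\<^bsub>?A\<^esub> f) x = f x" .
    qed
    show "f \<otimes>\<^bsub>?A\<^esub> \<one>\<^bsub>?A\<^esub> = f"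
    proof
      fix x :: "('v,'e) qpath"
      obtain u r where x: "x = (u, r)" by force
      have "(f \<otimes>\<^bsub>?A\<^esub> \<one>\<^bsub>?A\<^esub>) x =
          (\<Sum>i\<le>length r. if i = length r then
             (if pre_digraph.awlast Q u r \<in> verts Q then f (u, r) else 0) else 0)"
        unfolding x path_algebra_def monoid.simps prod.case
        by (rule sum.cong) auto
      also have "\<dots> = f x"
        using src(2)[of u r] by (auto simp: x)
      finally show "(f \<otimes>\<^bsub>?A\<^esub> \<one>\<^bsub>?A\<^esub>) x = f x" .
    qed
  next
    show "\<one>\<^bsub>?A\<^esub> \<in> carrier ?A"
      using assms(2) by (rule path_algebra_one_closed)
  next
    fix f g assume "f \<in> carrier ?A" "g \<in> carrier ?A"
    then show "f \<otimes>\<^bsub>?A\<^esub> g \<in> carrier ?A"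
      by (rule path_algebra_mult_closed)
  next
    fix f g h
    show "(f \<otimes>\<^bsub>?A\<^esub> g) \<otimes>\<^bsub>?A\<^esub> h = f \<otimes>\<^bsub>?A\<^esub> (g \<otimes>\<^bsub>?A\<^esub> h)"
      by (rule path_algebra_mult_assoc)
  qed
next
  let ?A = "path_algebra Q :: (('v,'e) qpath \<Rightarrow> 'k) ring"
  fix f g h
  show "(f \<oplus>\<^bsub>?A\<^esub> g) \<otimes>\<^bsub>?A\<^esub> h = f \<otimes>\<^bsub>?A\<^esub> h \<oplus>\<^bsub>?A\<^esub> g \<otimes>\<^bsub>?A\<^esub> h"
    and "h \<otimes>\<^bsub>?A\<^esub> (f \<oplus>\<^bsub>?A\<^esub> g) = h \<otimes>\<^bsub>?A\<^esub> f \<oplus>\<^bsub>?A\<^esub> h \<otimes>\<^bsub>?A\<^esub> g"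
    by (simp_all add: path_algebra_def fun_eq_iff sum.distrib distrib_left distrib_right)
qed

definition relation_ideal ::
    "('v,'e) pre_digraph \<Rightarrow> ('v,'e) framing \<Rightarrow> (('v,'e) qpath \<Rightarrow> 'k::field) set" where
  "relation_ideal G F = (let Q = quiver G F in
     Idl\<^bsub>path_algebra Q\<^esub> {path_elem (tail Q a, [a, b]) | a b.
       a \<in> arcs Q \<and> b \<in> arcs Q \<and> head Q a = tail Q b \<and> omega G F a \<noteq> omega G F b})"

definition framed_algebra ::
    "('v,'e) pre_digraph \<Rightarrow> ('v,'e) framing \<Rightarrow> (('v,'e) qpath \<Rightarrow> 'k::field) set ring" where
  "framed_algebra G F = path_algebra (quiver G F) Quot relation_ideal G F"

lemma path_elem_closed:
  assumes "x \<in> qpaths Q"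
  shows "path_elem x \<in> carrier (path_algebra Q :: (('v,'e) qpath \<Rightarrow> 'k::field) ring)"
proof -
  have "{y. path_elem x y \<noteq> (0::'k)} \<subseteq> {x}"
    by (auto simp: path_elem_def)
  with assms show ?thesis
    by (auto simp: path_algebra_def intro: finite_subset)
qed

lemma quiver_fin_digraph:
  assumes "fin_digraph G"
  shows "fin_digraph (quiver G F)"
proof -
  interpret fin_digraph G by fact
  show ?thesis
    by unfold_locales (auto simp: quiver_def inner_verts_def)
qed

lemma relation_ideal_ideal:
  assumes "fin_digraph G"
  shows "ideal (relation_ideal G F) (path_algebra (quiver G F) :: (('v,'e) qpath \<Rightarrow> 'k::field) ring)"
proof -
  let ?Q = "quiver G F"
  let ?A = "path_algebra ?Q :: (('v,'e) qpath \<Rightarrow> 'k) ring"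
  interpret Q: fin_digraph ?Q
    using assms by (rule quiver_fin_digraph)
  interpret A: ring ?A
    by (rule path_algebra_ring) (simp_all add: Q.wf_digraph_axioms)
  have *: "path_elem (tail ?Q a, [a, b]) \<in> carrier ?A"
    if "a \<in> arcs ?Q" "b \<in> arcs ?Q" "head ?Q a = tail ?Q b" for a b
  proof (rule path_elem_closed)
    have "Q.awalk (tail ?Q a) [a, b] (head ?Q b)"
      using that by (simp add: Q.awalk_def)
    then show "(tail ?Q a, [a, b]) \<in> qpaths ?Q"
      unfolding qpaths_def by blast
  qed
  show ?thesis
    unfolding relation_ideal_def Let_def
  proof (rule A.genideal_ideal, rule subsetI, elim CollectE exE conjE)
    fix x :: "('v,'e) qpath \<Rightarrow> 'k" and a b assume "x = path_elem (tail ?Q a, [a, b])"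
      "a \<in> arcs ?Q" "b \<in> arcs ?Q" "head ?Q a = tail ?Q b"
    then show "x \<in> carrier ?A" using * by metis
  qed
qed

lemma framed_algebra_ring: "fin_digraph G \<Longrightarrow> ring (framed_algebra G F)"
  unfolding framed_algebra_def by (intro ideal.quotient_is_ring relation_ideal_ideal)

text \<open>The structure map from the field into the algebra, and the idempotent at a vertex.\<close>

definition algebra_scalar ::
    "('v,'e) pre_digraph \<Rightarrow> ('v,'e) framing \<Rightarrow> 'k::field \<Rightarrow> (('v,'e) qpath \<Rightarrow> 'k) set" where
  "algebra_scalar G F c =
     relation_ideal G F +>\<^bsub>path_algebra (quiver G F)\<^esub> (\<lambda>x. c * \<one>\<^bsub>path_algebra (quiver G F)\<^esub> x)"

definition vertex_idem ::
    "('v,'e) pre_digraph \<Rightarrow> ('v,'e) framing \<Rightarrow> 'v \<Rightarrow> (('v,'e) qpath \<Rightarrow> 'k::field) set" where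
  "vertex_idem G F i = relation_ideal G F +>\<^bsub>path_algebra (quiver G F)\<^esub> path_elem (i, [])"

lemma algebra_scalar_closed:
  assumes "fin_digraph G"
  shows "algebra_scalar G F c \<in> carrier (framed_algebra G F :: (('v,'e) qpath \<Rightarrow> 'k::field) set ring)"
proof -
  let ?A = "path_algebra (quiver G F) :: (('v,'e) qpath \<Rightarrow> 'k) ring"
  interpret Q: fin_digraph "quiver G F"
    using assms by (rule quiver_fin_digraph)
  have "\<one>\<^bsub>?A\<^esub> \<in> carrier ?A"
    by (rule path_algebra_one_closed) simp
  then have "(\<lambda>x. c * \<one>\<^bsub>?A\<^esub> x) \<in> carrier ?A"
    by (auto simp: path_algebra_def elim!: finite_subset[rotated])
  then show ?thesis
    unfolding algebra_scalar_def framed_algebra_def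
    by (rule ring_hom_closed[OF ideal.rcos_ring_hom[OF relation_ideal_ideal[OF assms]]])
qed


section \<open>Modules\<close>

text \<open>Modules are right modules: since paths are multiplied from left to right, these are the
  representations of the bound quiver. The record \<open>module\<close> of the library is reused, and
  \<open>r \<odot> x\<close> stands for \<open>x\<cdot>r\<close>. The fields \<open>mult\<close> and \<open>one\<close> of that record play no role.\<close>

locale right_module = R?: ring R + M?: abelian_group M
  for R :: "'r ring" (structure) and M :: "('r,'m) module" (structure) +
  assumes smult_closed:
      "\<lbrakk>a \<in> carrier R; x \<in> carrier M\<rbrakk> \<Longrightarrow> a \<odot>\<^bsub>M\<^esub> x \<in> carrier M"
    and smult_l_distr:
      "\<lbrakk>a \<in> carrier R; b \<in> carrier R; x \<in> carrier M\<rbrakk> \<Longrightarrow>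
        (a \<oplus>\<^bsub>R\<^esub> b) \<odot>\<^bsub>M\<^esub> x = a \<odot>\<^bsub>M\<^esub> x \<oplus>\<^bsub>M\<^esub> b \<odot>\<^bsub>M\<^esub> x"
    and smult_r_distr:
      "\<lbrakk>a \<in> carrier R; x \<in> carrier M; y \<in> carrier M\<rbrakk> \<Longrightarrow>
        a \<odot>\<^bsub>M\<^esub> (x \<oplus>\<^bsub>M\<^esub> y) = a \<odot>\<^bsub>M\<^esub> x \<oplus>\<^bsub>M\<^esub> a \<odot>\<^bsub>M\<^esub> y"
    and smult_assoc:
      "\<lbrakk>a \<in> carrier R; b \<in> carrier R; x \<in> carrier M\<rbrakk> \<Longrightarrow>
        (a \<otimes>\<^bsub>R\<^esub> b) \<odot>\<^bsub>M\<^esub> x = b \<odot>\<^bsub>M\<^esub> (a \<odot>\<^bsub>M\<^esub> x)"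
    and smult_one:
      "x \<in> carrier M \<Longrightarrow> \<one>\<^bsub>R\<^esub> \<odot>\<^bsub>M\<^esub> x = x"

definition module_iso :: "'r ring \<Rightarrow> ('r,'m) module \<Rightarrow> ('r,'n) module \<Rightarrow> bool" where
  "module_iso R M N \<longleftrightarrow> (\<exists>f. bij_betw f (carrier M) (carrier N) \<and>
     (\<forall>x \<in> carrier M. \<forall>y \<in> carrier M. f (x \<oplus>\<^bsub>M\<^esub> y) = f x \<oplus>\<^bsub>N\<^esub> f y) \<and>
     (\<forall>r \<in> carrier R. \<forall>x \<in> carrier M. f (r \<odot>\<^bsub>M\<^esub> x) = r \<odot>\<^bsub>N\<^esub> f x))"

text \<open>A module over a \<open>K\<close>-algebra with structure map \<open>\<iota> : K \<rightarrow> R\<close> is finite-dimensional if it is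
  spanned over \<open>K\<close> by a finite set.\<close>

definition finite_dim_module :: "('k \<Rightarrow> 'r) \<Rightarrow> ('r,'m) module \<Rightarrow> bool" where
  "finite_dim_module \<iota> M \<longleftrightarrow> (\<exists>B. finite B \<and> B \<subseteq> carrier M \<and>
     (\<forall>x \<in> carrier M. \<exists>c. x = (\<Oplus>\<^bsub>M\<^esub>b \<in> B. \<iota> (c b) \<odot>\<^bsub>M\<^esub> b)))"

definition indecomposable :: "'r ring \<Rightarrow> ('r,'m) module \<Rightarrow> bool" where
  "indecomposable R M \<longleftrightarrow> carrier M \<noteq> {\<zero>\<^bsub>M\<^esub>} \<and>
     (\<forall>A B. submodule A R M \<and> submodule B R M \<and> A \<inter> B = {\<zero>\<^bsub>M\<^esub>} \<and> A <+>\<^bsub>M\<^esub> B = carrier M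
        \<longrightarrow> A = {\<zero>\<^bsub>M\<^esub>} \<or> B = {\<zero>\<^bsub>M\<^esub>})"

text \<open>The right module \<open>eR\<close>.\<close>

definition right_ideal_module :: "'r ring \<Rightarrow> 'r \<Rightarrow> ('r,'r) module" where
  "right_ideal_module R e =
    \<lparr> carrier = {e \<otimes>\<^bsub>R\<^esub> x | x. x \<in> carrier R}, mult = mult R, one = one R,
      zero = \<zero>\<^bsub>R\<^esub>, add = add R, module.smult = (\<lambda>r x. x \<otimes>\<^bsub>R\<^esub> r) \<rparr>"

text \<open>Isomorphism classes are taken among the modules whose carrier is a set of sequences
  over \<open>K\<close>. By the next lemma, every finite-dimensional module is isomorphic to one of those.\<close>

lemma finite_dim_module_realizable:
  fixes M :: "('r,'m) module" and \<iota> :: "'k::zero \<Rightarrow> 'r"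
  assumes "right_module R M" "finite_dim_module \<iota> M" and \<iota>: "\<And>c. \<iota> c \<in> carrier R"
  shows "\<exists>N :: ('r, nat \<Rightarrow> 'k) module. right_module R N \<and> module_iso R M N"
proof -
  interpret M: right_module R M by fact
  obtain B where "finite B" "\<forall>x \<in> carrier M. \<exists>c. x = (\<Oplus>\<^bsub>M\<^esub>b \<in> B. \<iota> (c b) \<odot>\<^bsub>M\<^esub> b)"
    and BM: "B \<subseteq> carrier M"
    using assms(2) by (auto simp: finite_dim_module_def)
  then obtain C where C: "x = (\<Oplus>\<^bsub>M\<^esub>b \<in> B. \<iota> (C x b) \<odot>\<^bsub>M\<^esub> b)" if "x \<in> carrier M" for x
    by metis
  obtain s :: "'m \<Rightarrow> nat" where s: "inj_on s B"
    using \<open>finite B\<close> finite_imp_inj_to_nat_seg by blast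
  define h :: "'m \<Rightarrow> nat \<Rightarrow> 'k" where
    "h x = (\<lambda>n. if n \<in> s ` B then C x (the_inv_into B s n) else 0)" for x
  have inj: "inj_on h (carrier M)"
  proof (rule inj_onI)
    fix x y assume xy: "x \<in> carrier M" "y \<in> carrier M" and eq: "h x = h y"
    have "C x b = C y b" if "b \<in> B" for b
      using fun_cong[OF eq, of "s b"] that s by (simp add: h_def the_inv_into_f_f)
    then have "(\<Oplus>\<^bsub>M\<^esub>b \<in> B. \<iota> (C x b) \<odot>\<^bsub>M\<^esub> b) = (\<Oplus>\<^bsub>M\<^esub>b \<in> B. \<iota> (C y b) \<odot>\<^bsub>M\<^esub> b)"
      using BM \<iota> by (intro M.finsum_cong') (auto intro: M.smult_closed)
    then show "x = y"
      using C xy by metis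
  qed
  define k where "k = the_inv_into (carrier M) h"
  have k: "k (h x) = x" if "x \<in> carrier M" for x
    using that inj by (simp add: k_def the_inv_into_f_f)
  define N :: "('r, nat \<Rightarrow> 'k) module" where
    "N = \<lparr> carrier = h ` carrier M, mult = (\<lambda>_ _. undefined), one = undefined,
      zero = h \<zero>\<^bsub>M\<^esub>, add = (\<lambda>x y. h (k x \<oplus>\<^bsub>M\<^esub> k y)), module.smult = (\<lambda>r x. h (r \<odot>\<^bsub>M\<^esub> k x)) \<rparr>"
  have "abelian_group N"
    by (rule abelian_groupI)
      (auto simp: N_def k M.a_ac M.r_neg intro!: bexI[of _ "\<ominus>\<^bsub>M\<^esub> _"])
  then have "right_module R N"
    unfolding right_module_def right_module_axioms_def
    by (auto simp: N_def k M.R.ring_axioms M.smult_closed M.smult_l_distr M.smult_r_distr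
        M.smult_assoc M.smult_one)
  moreover have "module_iso R M N"
    unfolding module_iso_def
    by (rule exI[of _ h]) (auto simp: N_def k M.smult_closed bij_betw_def inj)
  ultimately show ?thesis by blast
qed

type_synonym ('r,'k) module_class = "('r, nat \<Rightarrow> 'k) module set"

definition iso_class :: "'r ring \<Rightarrow> ('r,'m) module \<Rightarrow> ('r,'k) module_class" where
  "iso_class R M = {N. right_module R N \<and> module_iso R M N}"

text \<open>\<open>Shifted X\<close> is the formal shift \<open>X[1]\<close>.\<close>

datatype 'c shifted_or_not = Unshifted 'c | Shifted 'c

definition indec_classes ::
    "('v,'e) pre_digraph \<Rightarrow> ('v,'e) framing \<Rightarrow> ((('v,'e) qpath \<Rightarrow> 'k::field) set, 'k) module_class set"
  where "indec_classes G F = {iso_class (framed_algebra G F) M | M :: (_, nat \<Rightarrow> 'k) module.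
    right_module (framed_algebra G F) M \<and>
    finite_dim_module (algebra_scalar G F :: 'k \<Rightarrow> _) M \<and>
    indecomposable (framed_algebra G F) M}"

definition projective_class ::
    "('v,'e) pre_digraph \<Rightarrow> ('v,'e) framing \<Rightarrow> 'v \<Rightarrow>
      ((('v,'e) qpath \<Rightarrow> 'k::field) set, 'k) module_class" where
  "projective_class G F i =
     iso_class (framed_algebra G F) (right_ideal_module (framed_algebra G F) (vertex_idem G F i))"

definition tau_objects ::
    "('v,'e) pre_digraph \<Rightarrow> ('v,'e) framing \<Rightarrow>
      ((('v,'e) qpath \<Rightarrow> 'k::field) set, 'k) module_class shifted_or_not set" where
  "tau_objects G F =
     Unshifted ` indec_classes G F \<union> Shifted ` projective_class G F ` verts (quiver G F)"

end

theory Submission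
  imports Defs
begin

text \<open>Each coordinate hyperplane meets the flow cone in a proper face, hence in a subset of a facet, so an
  ample framing puts every edge on an exceptional route. Exchanging the edges at the ends of a common
  segment yields conflicts, which shows that \<open>\<omega>\<close> is consistent and that the exceptional routes are
  those of constant \<open>\<omega>\<close>. Deleting the maximal \<open>\<omega>\<close>-constant prefix and suffix of any other
  route leaves a walk through inner vertices; a nontrivial walk arises from one route, a trivial walk from two.

  Walks through inner vertices are the strings of the gentle algebra, and there are no bands since \<open>G\<close>
  is acyclic. Every nonzero module has a string module as a direct summand: starting at a minimal vertex
  of its support, a pair of subspaces \<open>D \<subset> C\<close> is pushed along the edges as long as it stays strict, and
  the walk followed carries vectors and functionals that split the module. A string module is
  determined by the vertices and arrows acting nontrivially on it, so indecomposable modules correspond to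
  walks, and the second copy of the trivial walks to the shifted projectives.\<close>

text \<open>Why a pair of subspaces is propagated: a vector splits off a summand only together with
  functionals that are compatible with all arrows, so both have to be found at once.
  \<open>C\<close> confines the vector at the current vertex, and \<open>D\<close> is what the
  functional there must kill. An outgoing edge of \<open>G\<close> is an arrow that leaves the
  vertex or one that enters it, depending on its colour; the pair moves by images in the first case
  and by preimages in the second.

  The walk only moves upwards in \<open>G\<close>, so the edges that end at its start are not under
  control at first. When the walk is prolonged downwards by one edge, the zero relations settle
  them; at the very first vertex there is no such edge, and minimality has to do this instead.

  Strings are read in \<open>G\<close> and not in the quiver because a walk of \<open>G\<close>
  never returns to a vertex: its vertices can serve directly as basis vectors.\<close>

section \<open>Walks and routes in a DAG\<close>

context dag
begin

declare awalk_append_iff [simp del]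

text \<open>A topological height: it grows strictly along arcs and is bounded by the number of
  vertices, so inductions can run towards the sources as well as towards the sinks.\<close>

definition rank :: "'v \<Rightarrow> nat" where
  "rank v = card {u. u \<rightarrow>\<^sup>+\<^bsub>G\<^esub> v}"

lemma rank_arc:
  assumes "e \<in> arcs G"
  shows "rank (tail G e) < rank (head G e)"
  unfolding rank_def
proof (rule psubset_card_mono)
  have step: "tail G e \<rightarrow>\<^bsub>G\<^esub> head G e"
    using assms by (rule in_arcs_imp_in_arcs_ends)
  have "{u. u \<rightarrow>\<^sup>+\<^bsub>G\<^esub> head G e} \<subseteq> verts G"
    by (auto simp: arcs_ends_conv dest!: tranclD)
  then show "finite {u. u \<rightarrow>\<^sup>+\<^bsub>G\<^esub> head G e}"
    by (rule finite_subset) simp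
  have "(tail G e, tail G e) \<notin> (arcs_ends G)\<^sup>+"
    using acyclic by (auto simp: acyclic_def)
  then show "{u. u \<rightarrow>\<^sup>+\<^bsub>G\<^esub> tail G e} \<subset> {u. u \<rightarrow>\<^sup>+\<^bsub>G\<^esub> head G e}"
    using step by (auto intro: trancl_into_trancl)
qed

lemma rank_le: "rank v \<le> card (verts G)"
  unfolding rank_def
  by (rule card_mono) (auto simp: arcs_ends_conv dest!: tranclD)

lemma rank_walk:
  assumes "awalk u p v"
  shows "rank u \<le> rank v" "p \<noteq> [] \<Longrightarrow> rank u < rank v"
    "e \<in> set p \<Longrightarrow> rank u \<le> rank (tail G e) \<and> rank (head G e) \<le> rank v"
  using assms
proof (induction p arbitrary: u)
  case (Cons a p)
  { case 1 then show ?case using Cons.IH(1)[of "head G a"] rank_arc[of a] by (auto simp: awalk_Cons_iff) }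
  { case 2 then show ?case using Cons.IH(1)[of "head G a"] rank_arc[of a] by (auto simp: awalk_Cons_iff) }
  { case 3 then show ?case using Cons.IH(1,3)[of "head G a"] rank_arc[of a] by (auto simp: awalk_Cons_iff) }
qed (auto simp: awalk_Nil_iff)

lemma awalk_appendD:
  assumes "awalk u (p @ q) w"
  obtains v where "awalk u p v" "awalk v q w"
  using assms by (auto simp: awalk_append_iff)

lemma awalk_mid:
  "awalk u (p @ a # q) w \<longleftrightarrow> awalk u p (tail G a) \<and> a \<in> arcs G \<and> awalk (head G a) q w"
  by (auto simp: awalk_Cons_iff elim!: awalk_appendD intro: awalk_appendI)

text \<open>Tails have strictly increasing rank along a walk, so no edge before \<open>a\<close>
  starts at \<open>tail G a\<close> and \<open>takeWhile\<close> stops exactly at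
  \<open>a\<close>.\<close>

lemma parts_at:
  assumes "awalk u (p @ a # q) w"
  shows "part_before G (tail G a) (p @ a # q) = p" "part_after G (tail G a) (p @ a # q) = a # q"
proof -
  have "tail G e \<noteq> tail G a" if "e \<in> set p" for e
  proof -
    have "awalk u p (tail G a)" "e \<in> arcs G"
      using assms that by (auto simp: awalk_mid)
    then show ?thesis
      using rank_walk(3)[of u p "tail G a" e] that rank_arc[of e] by force
  qed
  then show "part_before G (tail G a) (p @ a # q) = p" "part_after G (tail G a) (p @ a # q) = a # q"
    by (auto simp: part_before_def part_after_def takeWhile_append2 dropWhile_append2)
qed

lemma inner_iff: "v \<in> inner_verts G \<longleftrightarrow> v \<in> verts G \<and> in_arcs G v \<noteq> {} \<and> out_arcs G v \<noteq> {}"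
  by (auto simp: inner_verts_def is_source_def is_sink_def)

text \<open>Greedy backward walk: a vertex that is neither source nor sink is inner and offers an
  edge satisfying \<open>P\<close>, whose tail is again no sink. The predicate is trivial when walks
  are extended to routes, and a colour when monochromatic ends are built.\<close>

lemma walk_from_source:
  assumes P: "\<And>v. v \<in> inner_verts G \<Longrightarrow> \<exists>e \<in> in_arcs G v. P e"
    and "v \<in> verts G" "\<not> is_sink G v"
  shows "\<exists>u p. is_source G u \<and> awalk u p v \<and> (\<forall>e \<in> set p. P e)"
  using assms(2,3)
proof (induction "rank v" arbitrary: v rule: less_induct)
  case less
  show ?case
  proof (cases "is_source G v")
    case True
    then show ?thesis
      using less.prems by (intro exI[of _ v] exI[of _ "[]"]) (auto simp: awalk_Nil_iff)
  next
    case False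
    then obtain e where e: "e \<in> arcs G" "head G e = v" "P e"
      using less.prems P[of v] by (auto simp: inner_verts_def)
    then have "rank (tail G e) < rank v" "tail G e \<in> verts G" "\<not> is_sink G (tail G e)"
      using rank_arc by (auto simp: is_sink_def)
    from less.hyps[OF this] obtain u p where "is_source G u" "awalk u p (tail G e)" "\<forall>e \<in> set p. P e"
      by blast
    moreover have "awalk u (p @ [e]) v"
      using calculation(2) e by (auto simp: awalk_mid awalk_Nil_iff)
    ultimately show ?thesis
      using e by (intro exI[of _ u] exI[of _ "p @ [e]"]) auto
  qed
qed

lemma walk_to_sink:
  assumes P: "\<And>v. v \<in> inner_verts G \<Longrightarrow> \<exists>e \<in> out_arcs G v. P e"
    and "v \<in> verts G" "\<not> is_source G v"
  shows "\<exists>w p. is_sink G w \<and> awalk v p w \<and> (\<forall>e \<in> set p. P e)"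
  using assms(2,3)
proof (induction "card (verts G) - rank v" arbitrary: v rule: less_induct)
  case less
  show ?case
  proof (cases "is_sink G v")
    case True
    then show ?thesis
      using less.prems by (intro exI[of _ v] exI[of _ "[]"]) (auto simp: awalk_Nil_iff)
  next
    case False
    then obtain e where e: "e \<in> arcs G" "tail G e = v" "P e"
      using less.prems P[of v] by (auto simp: inner_verts_def)
    then have "card (verts G) - rank (head G e) < card (verts G) - rank v"
      "head G e \<in> verts G" "\<not> is_source G (head G e)"
      using rank_arc[of e] rank_le[of "head G e"] by (auto simp: is_source_def)
    from less.hyps[OF this] obtain w p where "is_sink G w" "awalk (head G e) p w" "\<forall>e \<in> set p. P e"
      by blast
    moreover have "awalk v (e # p) w"
      using calculation(2) e by (auto simp: awalk_Cons_iff)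
    ultimately show ?thesis
      using e by (intro exI[of _ w] exI[of _ "e # p"]) auto
  qed
qed

text \<open>The edges of \<open>p\<close> ensure that \<open>u\<close> is no sink and
  \<open>v\<close> no source, which is what the two greedy walks start from.\<close>

lemma walk_extends_to_route:
  assumes "awalk u p v" "p \<noteq> []"
  obtains q r where "q @ p @ r \<in> routes G"
proof -
  have "\<not> is_sink G u"
    using assms by (cases p) (auto simp: is_sink_def awalk_Cons_iff)
  moreover have "\<not> is_source G v"
    using assms by (cases p rule: rev_cases) (auto simp: is_source_def awalk_mid awalk_Nil_iff)
  moreover have "u \<in> verts G" "v \<in> verts G"
    using assms(1) by (auto simp: awalk_hd_in_verts awalk_last_in_verts)
  ultimately obtain x q y r where "is_source G x" "awalk x q u" "is_sink G y" "awalk v r y"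
    using walk_from_source[of "\<lambda>_. True" u] walk_to_sink[of "\<lambda>_. True" v]
    by (metis inner_iff ex_in_conv)
  then have "q @ p @ r \<in> routes G"
    using assms(1) unfolding routes_def by (blast intro: awalk_appendI)
  then show ?thesis by (rule that)
qed

lemma routeE:
  assumes "R \<in> routes G"
  obtains u w where "is_source G u" "is_sink G w" "awalk u R w"
  using assms by (auto simp: routes_def)

text \<open>Only the ends of a route are a source and a sink; every other vertex on it has an edge
  of the route on either side.\<close>

lemma route_arc_inner:
  assumes "p @ a # q \<in> routes G"
  shows "a \<in> arcs G" "p \<noteq> [] \<longleftrightarrow> tail G a \<in> inner_verts G" "q \<noteq> [] \<longleftrightarrow> head G a \<in> inner_verts G"
proof -
  obtain u w where u: "is_source G u" and w: "is_sink G w" and R: "awalk u (p @ a # q) w"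
    using assms by (rule routeE)
  then show a: "a \<in> arcs G" by (auto simp: awalk_mid)
  show "p \<noteq> [] \<longleftrightarrow> tail G a \<in> inner_verts G"
  proof (cases p rule: rev_cases)
    case Nil
    then have "u = tail G a" using R by (auto simp: awalk_Cons_iff)
    then show ?thesis using u Nil by (auto simp: inner_verts_def)
  next
    case (snoc p' b)
    then have "b \<in> arcs G" "head G b = tail G a"
      using R by (auto simp: awalk_mid awalk_Nil_iff)
    then show ?thesis using a snoc by (auto simp: inner_iff)
  qed
  show "q \<noteq> [] \<longleftrightarrow> head G a \<in> inner_verts G"
  proof (cases q)
    case Nil
    then have "w = head G a" using R by (auto simp: awalk_mid awalk_Nil_iff)
    then show ?thesis using w Nil by (auto simp: inner_verts_def)
  next
    case (Cons b q')
    then have "b \<in> arcs G" "tail G b = head G a"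
      using R by (auto simp: awalk_mid awalk_Cons_iff)
    then show ?thesis using a Cons by (auto simp: inner_iff)
  qed
qed

lemma route_consecutive:
  assumes "p @ a # b # q \<in> routes G"
  shows "a \<in> arcs G" "b \<in> arcs G" "tail G b = head G a" "head G a \<in> inner_verts G"
  using route_arc_inner[of p a "b # q"] route_arc_inner[of "p @ [a]" b q] assms
  by (auto simp: routes_def awalk_mid awalk_Cons_iff)

end

section \<open>Positions and ample framings\<close>

text \<open>The orders are reflexive, so the set counted by \<open>position\<close> contains the
  element itself and positions start at 1.\<close>

lemma position_card_two:
  assumes "linear_order_on A r" "card A = 2" "a \<in> A" "b \<in> A" "a \<noteq> b"
  shows "(a, b) \<in> r \<and> (b, a) \<notin> r \<and> position r a = 1 \<and> position r b = 2 \<or>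
    (b, a) \<in> r \<and> (a, b) \<notin> r \<and> position r b = 1 \<and> position r a = 2"
proof -
  have A: "A = {a, b}"
    using assms by (auto simp: card_2_iff)
  have r: "r \<subseteq> A \<times> A" "(a, a) \<in> r" "(b, b) \<in> r" "(a, b) \<in> r \<or> (b, a) \<in> r"
    "\<not> ((a, b) \<in> r \<and> (b, a) \<in> r)"
    using assms unfolding linear_order_on_def partial_order_on_def preorder_on_def refl_on_def
      total_on_def antisym_def by auto
  show ?thesis
  proof (cases "(a, b) \<in> r")
    case True
    then have "{f. (f, a) \<in> r} = {a}" "{f. (f, b) \<in> r} = {a, b}"
      using r A by auto
    then show ?thesis
      using True r(5) assms(5) by (auto simp: position_def)
  next
    case False
    then have "{f. (f, b) \<in> r} = {b}" "{f. (f, a) \<in> r} = {a, b}"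
      using r A by auto
    then show ?thesis
      using False r(4) assms(5) by (auto simp: position_def)
  qed
qed

lemma other_element_card_two:
  assumes "card A = 2" "a \<in> A"
  obtains b where "b \<in> A" "b \<noteq> a"
  using assms by (auto simp: card_2_iff)

locale framed_full_dag = full_dag G for G :: "('v,'e) pre_digraph" +
  fixes F :: "('v,'e) framing"
  assumes framing: "is_framing G F"
begin

abbreviation in_pos :: "'e \<Rightarrow> nat" where
  "in_pos e \<equiv> position (in_ord F (head G e)) e"

abbreviation out_pos :: "'e \<Rightarrow> nat" where
  "out_pos e \<equiv> position (out_ord F (tail G e)) e"

lemma in_pair:
  assumes "v \<in> inner_verts G" "a \<in> in_arcs G v" "b \<in> in_arcs G v" "a \<noteq> b"
  shows "(a, b) \<in> in_ord F v \<and> (b, a) \<notin> in_ord F v \<and> in_pos a = 1 \<and> in_pos b = 2 \<or>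
    (b, a) \<in> in_ord F v \<and> (a, b) \<notin> in_ord F v \<and> in_pos b = 1 \<and> in_pos a = 2"
proof -
  have "linear_order_on (in_arcs G v) (in_ord F v)" "card (in_arcs G v) = 2"
    using assms(1) framing full by (auto simp: is_framing_def in_degree_def)
  from position_card_two[OF this assms(2-4)] assms show ?thesis by auto
qed

lemma out_pair:
  assumes "v \<in> inner_verts G" "a \<in> out_arcs G v" "b \<in> out_arcs G v" "a \<noteq> b"
  shows "(a, b) \<in> out_ord F v \<and> (b, a) \<notin> out_ord F v \<and> out_pos a = 1 \<and> out_pos b = 2 \<or>
    (b, a) \<in> out_ord F v \<and> (a, b) \<notin> out_ord F v \<and> out_pos b = 1 \<and> out_pos a = 2"
proof -
  have "linear_order_on (out_arcs G v) (out_ord F v)" "card (out_arcs G v) = 2"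
    using assms(1) framing full by (auto simp: is_framing_def out_degree_def)
  from position_card_two[OF this assms(2-4)] assms show ?thesis by auto
qed

lemma other_in:
  assumes "v \<in> inner_verts G" "a \<in> in_arcs G v"
  obtains b where "b \<in> in_arcs G v" "b \<noteq> a"
  using assms full[of v] other_element_card_two unfolding in_degree_def by metis

lemma other_out:
  assumes "v \<in> inner_verts G" "a \<in> out_arcs G v"
  obtains b where "b \<in> out_arcs G v" "b \<noteq> a"
  using assms full[of v] other_element_card_two unfolding out_degree_def by metis

lemma out_pos_cases:
  assumes "v \<in> inner_verts G" "a \<in> out_arcs G v"
  shows "out_pos a = 1 \<or> out_pos a = 2"
  using assms by (metis out_pair other_out)

text \<open>The competitor of \<open>R\<close> takes the other edge \<open>a'\<close> into the start
  of \<open>s\<close>, follows \<open>s\<close>, and leaves by the other edge \<open>b'\<close>. If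
  the positions of \<open>a\<close> and \<open>b\<close> differed, \<open>R\<close> would precede it
  at one end of \<open>s\<close> and follow it at the other, which is a conflict. An empty
  \<open>s\<close> is allowed.\<close>

lemma exceptional_positions:
  assumes R: "R \<in> exceptional_routes G F" "R = p @ a # s @ b # q"
  shows "in_pos a = out_pos b"
proof (rule ccontr)
  assume ne: "in_pos a \<noteq> out_pos b"
  have Rr: "p @ a # s @ b # q \<in> routes G"
    using R by (auto simp: exceptional_routes_def)
  then obtain u w where walk: "awalk u (p @ a # s @ b # q) w"
    by (rule routeE)
  define v where "v = head G a"
  have v: "v \<in> inner_verts G" "a \<in> in_arcs G v"
    using route_arc_inner[OF Rr] by (auto simp: v_def)
  have w: "tail G b \<in> inner_verts G" "b \<in> out_arcs G (tail G b)"
    using route_arc_inner[of "p @ a # s" b q] Rr by auto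
  have s: "awalk v s (tail G b)"
    using walk by (auto simp: awalk_mid v_def)
  obtain a' where a': "a' \<in> in_arcs G v" "a' \<noteq> a"
    using v by (rule other_in)
  obtain b' where b': "b' \<in> out_arcs G (tail G b)" "b' \<noteq> b"
    using w by (rule other_out)
  have "awalk (tail G a') (a' # s @ [b']) (head G b')"
    using s a' b' by (auto simp: awalk_Cons_iff awalk_Nil_iff v_def
        intro!: awalk_appendI)
  then obtain p' q' where Q: "p' @ a' # s @ b' # q' \<in> routes G" (is "?Q \<in> _")
    by (auto elim: walk_extends_to_route)
  then obtain u' w' where walk': "awalk u' ?Q w'"
    by (rule routeE)
  \<comment> \<open>The conflict is tested at \<open>v\<close>, so both routes are cut after their
    edge into \<open>v\<close>; the next edge is the first one of \<open>s\<close>, or the one after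
    \<open>s\<close> if that is empty.\<close>
  have parts: "part_before G v (p @ a # s @ b # q) = p @ [a]" "part_after G v (p @ a # s @ b # q) = s @ b # q"
    if "awalk u (p @ a # s @ b # q) w" "a \<in> in_arcs G v" for p a b q u w
  proof -
    obtain c r where cr: "s @ b # q = c # r" by (cases s) auto
    moreover have "tail G c = v"
      using that unfolding cr by (auto simp: awalk_mid awalk_Cons_iff)
    ultimately show "part_before G v (p @ a # s @ b # q) = p @ [a]" "part_after G v (p @ a # s @ b # q) = s @ b # q"
      using parts_at[of u "p @ [a]" c r w] that(1) by auto
  qed
  have a: "tail G a = tail G a \<and> head G a = v" "head G a' = v" "tail G b' = tail G b"
    using v a' b' by auto
  have R_parts: "part_before G v R = p @ [a]" "part_after G v R = s @ b # q"
    unfolding R(2) using parts[OF walk v(2)] by auto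
  have Q_parts: "part_before G v ?Q = p' @ [a']" "part_after G v ?Q = s @ b' # q'"
    using parts[OF walk' a'(1)] by auto
  have in_less: "in_less G F (x @ [c]) (y @ [d])" if "(c, d) \<in> in_ord F v" "c \<noteq> d" "head G c = v" for x y c d
    using that unfolding in_less_def by blast
  have out_less: "out_less G F (s @ c # x) (s @ d # y)"
    if "(c, d) \<in> out_ord F (tail G b)" "c \<noteq> d" "tail G c = tail G b" for x y c d
    using that unfolding out_less_def by metis
  have "conflict_at G F v R ?Q"
    unfolding conflict_at_def R_parts Q_parts
    using in_pair[OF v a'(1)] out_pair[OF w b'(1)] a' b' ne a in_less out_less by auto
  moreover have "passes G R v" "passes G ?Q v"
  proof -
    obtain c r where "s @ b # q = c # r" by (cases s) auto
    then have "v \<in> tail G ` set (s @ b # q)"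
      using walk by (auto simp: awalk_mid awalk_Cons_iff v_def)
    then show "passes G R v" using v by (auto simp: passes_def R(2))
    obtain c r where "s @ b' # q' = c # r" by (cases s) auto
    then have "v \<in> tail G ` set (s @ b' # q')"
      using walk' a' by (auto simp: awalk_mid awalk_Cons_iff)
    then show "passes G ?Q v" using v by (auto simp: passes_def)
  qed
  ultimately show False
    using R(1) Q by (auto simp: exceptional_routes_def coherent_def)
qed

end

section \<open>Flow cone, facets and ample framings\<close>

locale ample_full_dag = framed_full_dag G F for G :: "('v,'e::finite) pre_digraph" and F +
  assumes ample: "ample G F"
begin

text \<open>On 0/1 vectors conservation compares numbers of edges. By rank, a route meets an inner
  vertex at most once, so it uses one incoming and one outgoing edge there, or none.\<close>

lemma route_vec_in_flow_cone:
  assumes R: "R \<in> routes G"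
  shows "route_vec R \<in> flow_cone G"
proof -
  obtain u w where walk: "awalk u R w"
    using R by (rule routeE)
  have sum: "(\<Sum>e\<in>A. route_vec R $ e) = real (card (A \<inter> set R))" for A
    by (simp add: route_vec_def sum.If_cases)
  have "card (in_arcs G v \<inter> set R) = card (out_arcs G v \<inter> set R)" if v: "v \<in> inner_verts G" for v
  proof (cases "out_arcs G v \<inter> set R = {}")
    case True
    have "a \<notin> in_arcs G v" if "a \<in> set R" for a
    proof
      assume a: "a \<in> in_arcs G v"
      obtain p q where pq: "R = p @ a # q"
        using split_list[OF \<open>a \<in> set R\<close>] by blast
      with a v have "q \<noteq> []" using route_arc_inner(3)[of p a q] R by auto
      then obtain b r where "R = p @ a # b # r" using pq by (cases q) auto
      then show False using route_consecutive[of p a b r] R a True by auto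
    qed
    then show ?thesis using True by (metis disjoint_iff)
  next
    case False
    then obtain b where b: "b \<in> out_arcs G v" "b \<in> set R" by blast
    then obtain p' q where "R = p' @ b # q" by (meson split_list)
    moreover have "p' \<noteq> []" using calculation b v route_arc_inner(2)[of p' b q] R by auto
    ultimately obtain p a where pq: "R = p @ a # b # q" by (cases p' rule: rev_cases) auto
    have a: "a \<in> in_arcs G v" using route_consecutive[of p a b q] R pq b by auto
    have walks: "awalk u p (tail G a)" "awalk (head G b) q w"
      using walk unfolding pq by (auto simp: awalk_mid awalk_Cons_iff)
    have "tail G e \<noteq> v \<and> head G e \<noteq> v" if "e \<in> set p" for e
    proof -
      have "e \<in> arcs G" using walks(1) that by (auto simp: awalk_def)
      then show ?thesis
        using rank_walk(3)[OF walks(1) that] rank_arc[of a] rank_arc[of e] a by auto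
    qed
    moreover have "tail G e \<noteq> v \<and> head G e \<noteq> v" if "e \<in> set q" for e
    proof -
      have "e \<in> arcs G" using walks(2) that by (auto simp: awalk_def)
      then show ?thesis
        using rank_walk(3)[OF walks(2) that] rank_arc[of b] rank_arc[of e] b by auto
    qed
    moreover have "tail G a \<noteq> v" "head G b \<noteq> v"
      using rank_arc[of a] rank_arc[of b] a b by auto
    ultimately have "in_arcs G v \<inter> set R = {a}" "out_arcs G v \<inter> set R = {b}"
      using a b unfolding pq by auto
    then show ?thesis by simp
  qed
  moreover have "e \<notin> arcs G \<Longrightarrow> e \<notin> set R" for e
    using walk by (auto simp: awalk_def)
  ultimately show ?thesis
    unfolding flow_cone_def sum mem_Collect_eq by (auto simp: route_vec_def)
qed

text \<open>Polyhedrality is what provides a facet above a proper face.\<close>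

lemma polyhedron_flow_cone: "polyhedron (flow_cone G)"
proof -
  have ineq: "polyhedron {x :: real ^ 'e. 0 \<le> x $ e}" for e
    using polyhedron_halfspace_ge[of "0::real" "axis e (1::real)"] by (simp add: inner_axis' inner_real_def)
  have eq: "polyhedron {x :: real ^ 'e. x $ e = 0}" for e
    using polyhedron_hyperplane[of "axis e (1::real)" "0::real"] by (simp add: inner_axis' inner_real_def)
  have cons: "polyhedron {x :: real ^ 'e. (\<Sum>e \<in> in_arcs G v. x $ e) = (\<Sum>e \<in> out_arcs G v. x $ e)}" for v
    using polyhedron_hyperplane[of "(\<Sum>e \<in> in_arcs G v. axis e 1) - (\<Sum>e \<in> out_arcs G v. axis e (1::real))" "0::real"]
    by (simp add: inner_axis' inner_real_def inner_diff_left inner_sum_left)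
  have "flow_cone G = \<Inter> (range (\<lambda>e. {x. 0 \<le> x $ e}) \<union> (\<lambda>e. {x. x $ e = 0}) ` (- arcs G) \<union>
      (\<lambda>v. {x. (\<Sum>e \<in> in_arcs G v. x $ e) = (\<Sum>e \<in> out_arcs G v. x $ e)}) ` inner_verts G)"
    unfolding flow_cone_def by auto
  moreover have "finite (inner_verts G)"
    by (auto simp: inner_verts_def)
  ultimately show ?thesis
    using ineq eq cons by (auto intro!: polyhedron_Inter)
qed

lemma arc_on_exceptional_route:
  assumes e: "e \<in> arcs G"
  obtains p q where "p @ e # q \<in> exceptional_routes G F"
proof -
  define S where "S = flow_cone G \<inter> {x. axis e (1::real) \<bullet> x = 0}"
  have "S face_of flow_cone G"
    unfolding S_def
  proof (rule face_of_Int_supporting_hyperplane_ge)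
    show "convex (flow_cone G)"
      by (rule polyhedron_imp_convex[OF polyhedron_flow_cone])
  qed (auto simp: inner_axis' inner_real_def flow_cone_def)
  \<comment> \<open>A facet above \<open>S\<close> is available for a nonempty proper face; the zero
    flow and a route through \<open>e\<close> show that \<open>S\<close> is one.\<close>
  moreover have "0 \<in> S"
    by (simp add: S_def flow_cone_def)
  moreover have "S \<noteq> flow_cone G"
  proof -
    obtain p q where "p @ [e] @ q \<in> routes G"
      using walk_extends_to_route[OF arc_implies_awalk[OF e]] by auto
    then have "route_vec (p @ [e] @ q) \<in> flow_cone G"
      by (rule route_vec_in_flow_cone)
    moreover have "route_vec (p @ [e] @ q) \<notin> S"
      by (simp add: S_def inner_axis' inner_real_def route_vec_def)
    ultimately show ?thesis by blast
  qed
  ultimately obtain T where "T facet_of flow_cone G" "S \<subseteq> T"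
    using face_of_polyhedron_subset_facet[OF polyhedron_flow_cone, of S] by blast
  then obtain R where R: "R \<in> exceptional_routes G F" "route_vec R \<notin> S"
    using ample unfolding ample_def by blast
  then have "e \<in> set R"
    using route_vec_in_flow_cone[of R]
    by (auto simp: S_def inner_axis' inner_real_def route_vec_def exceptional_routes_def split: if_splits)
  then show ?thesis
    using R that by (auto dest: split_list)
qed

text \<open>Makes the description in \<open>omega\<close> consistent: an edge between inner vertices
  has a predecessor and a successor on an exceptional route, and its two positions are compared
  through those of these neighbours.\<close>

lemma omega_eq:
  assumes "e \<in> arcs G"
  shows "tail G e \<in> inner_verts G \<Longrightarrow> omega G F e = out_pos e"
    and "head G e \<in> inner_verts G \<Longrightarrow> omega G F e = in_pos e"
proof -
  obtain p q where R: "p @ e # q \<in> exceptional_routes G F"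
    using assms by (rule arc_on_exceptional_route)
  then have Rr: "p @ e # q \<in> routes G"
    by (auto simp: exceptional_routes_def)
  have eq: "in_pos e = out_pos e" if "tail G e \<in> inner_verts G" "head G e \<in> inner_verts G"
  proof -
    have "p \<noteq> []" "q \<noteq> []"
      using that route_arc_inner[OF Rr] by auto
    then obtain p' a b q' where "p = p' @ [a]" "q = b # q'"
      by (metis rev_exhaust list.exhaust)
    \<comment> \<open>Three choices of the common segment: empty before \<open>e\<close>, empty
      after \<open>e\<close>, and \<open>e\<close> itself. They give
      \<open>in_pos a = out_pos e\<close>, \<open>in_pos e = out_pos b\<close> and
      \<open>in_pos a = out_pos b\<close>.\<close>
    then have "p @ e # q = p' @ a # [] @ e # b # q'" "p @ e # q = (p' @ [a]) @ e # [] @ b # q'"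
      "p @ e # q = p' @ a # [e] @ b # q'"
      by auto
    then show ?thesis
      using exceptional_positions[OF R] by metis
  qed
  show "omega G F e = out_pos e" if "tail G e \<in> inner_verts G"
    unfolding omega_def using that eq by (intro the_equality) auto
  show "omega G F e = in_pos e" if "head G e \<in> inner_verts G"
    unfolding omega_def using that eq by (intro the_equality) auto
qed

end

section \<open>Monochromatic parts of routes\<close>

text \<open>The first element fixes the colour, and the colour change at the head of the rest is
  where \<open>takeWhile\<close> must stop.\<close>

lemma mono_prefix_unique:
  assumes "p @ r = p' @ r'" "p \<noteq> []" "p' \<noteq> []" "\<forall>x \<in> set p. f x = c" "\<forall>x \<in> set p'. f x = c'"
    "r \<noteq> []" "r' \<noteq> []" "f (hd r) \<noteq> c" "f (hd r') \<noteq> c'"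
  shows "p = p' \<and> r = r' \<and> c = c'"
proof -
  have prefix: "takeWhile (\<lambda>x. f x = c) (p @ r) = p"
    if "\<forall>x \<in> set p. f x = c" "f (hd r) \<noteq> c" "r \<noteq> []" for p r :: "'a list" and c
    using that by (cases r) (auto simp: takeWhile_append2)
  have "c = f (hd (p @ r))" "c' = f (hd (p' @ r'))"
    using assms(2-5) by (auto simp del: append_assoc)
  then have "c = c'" using assms(1) by metis
  moreover have "p = p'"
    using prefix[of p c r] prefix[of p' c' r'] assms \<open>c = c'\<close> by metis
  ultimately show ?thesis using assms(1) by auto
qed

lemma mono_suffix_unique:
  assumes "r @ p = r' @ p'" "p \<noteq> []" "p' \<noteq> []" "\<forall>x \<in> set p. f x = c" "\<forall>x \<in> set p'. f x = c'"
    "r \<noteq> []" "r' \<noteq> []" "f (last r) \<noteq> c" "f (last r') \<noteq> c'"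
  shows "p = p' \<and> r = r' \<and> c = c'"
proof -
  have "rev p @ rev r = rev p' @ rev r'"
    using assms(1) by (metis rev_append)
  from mono_prefix_unique[OF this, of f c c'] assms show ?thesis
    by (auto simp: hd_rev)
qed

lemma mono_prefix_split:
  fixes f :: "'a \<Rightarrow> 'b"
  assumes "\<not> (\<exists>c. \<forall>x \<in> set R. f x = c)"
  obtains p r where "R = p @ r" "p \<noteq> []" "\<forall>x \<in> set p. f x = f (hd R)" "r \<noteq> []" "f (hd r) \<noteq> f (hd R)"
proof
  let ?P = "\<lambda>x. f x = f (hd R)"
  show "R = takeWhile ?P R @ dropWhile ?P R" by simp
  have "R \<noteq> []" using assms by auto
  then show "takeWhile ?P R \<noteq> []" by (cases R) auto
  show "\<forall>x \<in> set (takeWhile ?P R). ?P x" by (auto dest: set_takeWhileD)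
  show "dropWhile ?P R \<noteq> []" using assms by (auto simp: dropWhile_eq_Nil_conv)
  then show "\<not> ?P (hd (dropWhile ?P R))" by (rule hd_dropWhile)
qed

lemma mono_suffix_split:
  fixes f :: "'a \<Rightarrow> 'b"
  assumes "R \<noteq> []"
  obtains p r where "R = r @ p" "p \<noteq> []" "\<forall>x \<in> set p. f x = f (last R)" "r \<noteq> [] \<longrightarrow> f (last r) \<noteq> f (last R)"
proof
  let ?P = "\<lambda>x. f x = f (last R)"
  show "R = rev (dropWhile ?P (rev R)) @ rev (takeWhile ?P (rev R))"
    by (metis rev_append rev_rev_ident takeWhile_dropWhile_id)
  show "rev (takeWhile ?P (rev R)) \<noteq> []" using assms by (cases R rule: rev_cases) auto
  show "\<forall>x \<in> set (rev (takeWhile ?P (rev R))). ?P x" by (auto dest: set_takeWhileD)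
  show "rev (dropWhile ?P (rev R)) \<noteq> [] \<longrightarrow> \<not> ?P (last (rev (dropWhile ?P (rev R))))"
    using hd_dropWhile[of ?P "rev R"] by (simp add: last_rev)
qed

lemma consecutive_change:
  assumes "\<not> (\<exists>c. \<forall>x \<in> set R. f x = c)"
  obtains p a b q where "R = p @ a # b # q" "f a \<noteq> f b"
proof -
  obtain p r where p: "R = p @ r" "p \<noteq> []" "\<forall>x \<in> set p. f x = f (hd R)" "r \<noteq> []" "f (hd r) \<noteq> f (hd R)"
    using assms by (rule mono_prefix_split)
  show ?thesis
  proof
    show "R = butlast p @ last p # hd r # tl r"
      using p(1,2,4) by simp
    show "f (last p) \<noteq> f (hd r)"
      using p by (metis last_in_set)
  qed
qed

text \<open>What the later combinatorics and representation theory retain of an ample framing. The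
  colour \<open>True\<close> will mean position 1; \<open>c\<close> is arbitrary, so an inner vertex
  has one edge of each colour on either side.\<close>

locale coloured_dag = dag G for G :: "('v,'e) pre_digraph" +
  fixes col :: "'e \<Rightarrow> bool"
  assumes in_ex1: "v \<in> inner_verts G \<Longrightarrow> \<exists>!e. e \<in> in_arcs G v \<and> col e = c"
    and out_ex1: "v \<in> inner_verts G \<Longrightarrow> \<exists>!e. e \<in> out_arcs G v \<and> col e = c"
begin

text \<open>At an inner vertex the nonzero compositions of arrows, the peaks and the deeps of the quiver are
  exactly the ways of passing from an incoming to an outgoing edge of \<open>G\<close>; hence strings, up to
  inversion, are the walks of \<open>G\<close> through inner vertices.\<close>

primrec iwalk :: "'v \<Rightarrow> 'e list \<Rightarrow> bool" where
  "iwalk u [] \<longleftrightarrow> u \<in> inner_verts G"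
| "iwalk u (e # es) \<longleftrightarrow> u \<in> inner_verts G \<and> e \<in> out_arcs G u \<and> iwalk (head G e) es"

lemma iwalk_iff: "iwalk u es \<longleftrightarrow> awalk u es (awlast u es) \<and> u \<in> inner_verts G \<and> head G ` set es \<subseteq> inner_verts G"
  by (induction es arbitrary: u) (auto simp: awalk_Nil_iff awalk_Cons_iff inner_iff)

section \<open>Monochromatic walks from a source and to a sink\<close>

definition mono_in :: "'v \<Rightarrow> bool \<Rightarrow> 'e list \<Rightarrow> bool" where
  "mono_in v c p \<longleftrightarrow> (\<exists>u. is_source G u \<and> awalk u p v) \<and> (\<forall>e \<in> set p. col e = c)"

definition mono_out :: "'v \<Rightarrow> bool \<Rightarrow> 'e list \<Rightarrow> bool" where
  "mono_out v c p \<longleftrightarrow> (\<exists>w. is_sink G w \<and> awalk v p w) \<and> (\<forall>e \<in> set p. col e = c)"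

lemma awalk_snoc: "awalk u (p @ [a]) w \<longleftrightarrow> awalk u p (tail G a) \<and> a \<in> in_arcs G w"
  by (auto simp: awalk_mid awalk_Nil_iff)

lemma mono_in_last: "mono_in v c p \<Longrightarrow> p \<noteq> [] \<Longrightarrow> v = head G (last p)"
  by (cases p rule: rev_cases) (auto simp: mono_in_def awalk_snoc)

text \<open>Traced backwards, the walk has no choice: an inner vertex has a single incoming edge of
  colour \<open>c\<close>. Since \<open>v\<close> is no sink, every vertex met before the source is
  inner.\<close>

lemma mono_in_unique:
  assumes "mono_in v c p" "mono_in v c q" "\<not> is_sink G v"
  shows "p = q"
  using assms
proof (induction p arbitrary: v q rule: rev_induct)
  case Nil
  then have "in_arcs G v = {}" by (auto simp: mono_in_def awalk_Nil_iff is_source_def)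
  then show ?case
    using Nil(2) by (cases q rule: rev_cases) (auto simp: mono_in_def awalk_snoc)
next
  case (snoc a p)
  have a: "a \<in> in_arcs G v" "col a = c" "mono_in (tail G a) c p"
    using snoc.prems(1) by (auto simp: mono_in_def awalk_snoc)
  then have "\<not> is_source G v" by (auto simp: is_source_def)
  then obtain b q' where q: "q = q' @ [b]"
    using snoc.prems(2) by (cases q rule: rev_cases) (auto simp: mono_in_def awalk_Nil_iff)
  then have b: "b \<in> in_arcs G v" "col b = c" "mono_in (tail G b) c q'"
    using snoc.prems(2) by (auto simp: mono_in_def awalk_snoc)
  have "v \<in> inner_verts G"
    using a snoc.prems(3) by (auto simp: inner_verts_def is_source_def)
  then have "a = b"
    using in_ex1[of v c] a b by blast
  moreover have "\<not> is_sink G (tail G a)"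
    using a(1) by (auto simp: is_sink_def)
  ultimately show ?case
    using snoc.IH[OF a(3), of q'] b q by simp
qed

lemma mono_out_unique:
  assumes "mono_out v c p" "mono_out v c q" "\<not> is_source G v"
  shows "p = q"
  using assms
proof (induction p arbitrary: v q)
  case Nil
  then have "out_arcs G v = {}" by (auto simp: mono_out_def awalk_Nil_iff is_sink_def)
  then show ?case
    using Nil(2) by (cases q) (auto simp: mono_out_def awalk_Cons_iff)
next
  case (Cons a p)
  have a: "a \<in> out_arcs G v" "col a = c" "mono_out (head G a) c p"
    using Cons.prems(1) by (auto simp: mono_out_def awalk_Cons_iff)
  then have "\<not> is_sink G v" by (auto simp: is_sink_def)
  then obtain b q' where q: "q = b # q'"
    using Cons.prems(2) by (cases q) (auto simp: mono_out_def awalk_Nil_iff)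
  then have b: "b \<in> out_arcs G v" "col b = c" "mono_out (head G b) c q'"
    using Cons.prems(2) by (auto simp: mono_out_def awalk_Cons_iff)
  have "v \<in> inner_verts G"
    using a Cons.prems(3) by (auto simp: inner_verts_def is_sink_def)
  then have "a = b"
    using out_ex1[of v c] a b by blast
  moreover have "\<not> is_source G (head G a)"
    using a(1) by (auto simp: is_source_def)
  ultimately show ?case
    using Cons.IH[OF a(3), of q'] b q by simp
qed

definition to_source :: "'v \<Rightarrow> bool \<Rightarrow> 'e list" where
  "to_source v c = (THE p. mono_in v c p)"

definition to_sink :: "'v \<Rightarrow> bool \<Rightarrow> 'e list" where
  "to_sink v c = (THE p. mono_out v c p)"

lemma to_source_eq: "v \<in> inner_verts G \<Longrightarrow> mono_in v c p \<Longrightarrow> to_source v c = p"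
  unfolding to_source_def by (rule the_equality) (auto intro: mono_in_unique simp: inner_verts_def)

lemma to_sink_eq: "v \<in> inner_verts G \<Longrightarrow> mono_out v c p \<Longrightarrow> to_sink v c = p"
  unfolding to_sink_def by (rule the_equality) (auto intro: mono_out_unique simp: inner_verts_def)

lemma mono_in_to_source:
  assumes "v \<in> inner_verts G"
  shows "mono_in v c (to_source v c)"
proof -
  have "\<exists>u p. is_source G u \<and> awalk u p v \<and> (\<forall>e \<in> set p. col e = c)"
  proof (rule walk_from_source)
    show "\<exists>e \<in> in_arcs G w. col e = c" if "w \<in> inner_verts G" for w
      using in_ex1[OF that] by blast
  qed (use assms in \<open>auto simp: inner_verts_def\<close>)
  then show ?thesis
    using to_source_eq[OF assms] by (metis mono_in_def)
qed

lemma mono_out_to_sink: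
  assumes "v \<in> inner_verts G"
  shows "mono_out v c (to_sink v c)"
proof -
  have "\<exists>w p. is_sink G w \<and> awalk v p w \<and> (\<forall>e \<in> set p. col e = c)"
  proof (rule walk_to_sink)
    show "\<exists>e \<in> out_arcs G w. col e = c" if "w \<in> inner_verts G" for w
      using out_ex1[OF that] by blast
  qed (use assms in \<open>auto simp: inner_verts_def\<close>)
  then show ?thesis
    using to_sink_eq[OF assms] by (metis mono_out_def)
qed

lemma to_source_not_Nil: "v \<in> inner_verts G \<Longrightarrow> to_source v c \<noteq> []"
  using mono_in_to_source[of v c] by (auto simp: mono_in_def awalk_Nil_iff inner_verts_def)

lemma to_sink_not_Nil: "v \<in> inner_verts G \<Longrightarrow> to_sink v c \<noteq> []"
  using mono_out_to_sink[of v c] by (auto simp: mono_out_def awalk_Nil_iff inner_verts_def)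

text \<open>The maximal monochromatic prefix and suffix of a route that is not monochromatic are determined
  by their colours \<open>c\<close>, \<open>d\<close> and by the walk \<open>es\<close> between them. If \<open>es\<close> is empty, the pairs \<open>c \<noteq> d\<close>
  account for two routes: the trivial walk and the shifted projective at \<open>u\<close>.\<close>

definition nonmono_routes :: "'e list set" where
  "nonmono_routes = {R \<in> routes G. \<not> (\<exists>c. \<forall>e \<in> set R. col e = c)}"

text \<open>The side conditions express maximality: the colour changes right after the prefix and
  right before the suffix. For an empty \<open>es\<close> the edge after the prefix already belongs
  to the suffix and has colour \<open>d\<close>.\<close>

definition walk_data :: "('v \<times> 'e list \<times> bool \<times> bool) set" where
  "walk_data = {(u, es, c, d). iwalk u es \<and>
     (if es = [] then c \<noteq> d else col (hd es) \<noteq> c \<and> col (last es) \<noteq> d)}"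

definition extend_walk :: "'v \<times> 'e list \<times> bool \<times> bool \<Rightarrow> 'e list" where
  "extend_walk = (\<lambda>(u, es, c, d). to_source u c @ es @ to_sink (awlast u es) d)"

lemma iwalk_end: "iwalk u es \<Longrightarrow> awlast u es \<in> inner_verts G"
  by (induction es arbitrary: u) auto

lemma extend_walkE:
  assumes "(u, es, c, d) \<in> walk_data"
  obtains p q where "p = to_source u c" "q = to_sink (awlast u es) d" "p \<noteq> []" "q \<noteq> []"
    "mono_in u c p" "mono_out (awlast u es) d q"
    "\<forall>x \<in> set p. col x = c" "\<forall>x \<in> set q. col x = d" "col (hd (es @ q)) \<noteq> c" "col (last (p @ es)) \<noteq> d"
    "extend_walk (u, es, c, d) = p @ es @ q" "awalk u es (awlast u es)"
proof -
  have u: "u \<in> inner_verts G" "awlast u es \<in> inner_verts G" "awalk u es (awlast u es)"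
    using assms iwalk_end by (auto simp: walk_data_def iwalk_iff)
  note p = mono_in_to_source[OF u(1), of c] to_source_not_Nil[OF u(1), of c]
  note q = mono_out_to_sink[OF u(2), of d] to_sink_not_Nil[OF u(2), of d]
  have p': "\<forall>x \<in> set (to_source u c). col x = c" and q': "\<forall>x \<in> set (to_sink (awlast u es) d). col x = d"
    using p q by (auto simp: mono_in_def mono_out_def)
  moreover from this have "col (last (to_source u c)) = c" "col (hd (to_sink (awlast u es) d)) = d"
    using p(2) q(2) by auto
  ultimately show ?thesis
    using that[OF refl refl p(2) q(2) p(1) q(1) p' q' _ _ _ u(3)] assms
    by (auto simp: walk_data_def extend_walk_def hd_append split: if_splits)
qed

text \<open>A route remembers its maximal monochromatic prefix and suffix, and these give back
  \<open>c\<close>, \<open>d\<close> and \<open>es\<close>. The vertex \<open>u\<close> is recovered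
  as the end of the prefix, which matters when \<open>es\<close> is empty.\<close>

lemma bij_extend_walk: "bij_betw extend_walk walk_data nonmono_routes"
proof (rule bij_betw_imageI)
  show "inj_on extend_walk walk_data"
  proof (rule inj_onI)
    fix t t' assume t: "t \<in> walk_data" "t' \<in> walk_data" "extend_walk t = extend_walk t'"
    obtain u es c d u' es' c' d' where tt: "t = (u, es, c, d)" "t' = (u', es', c', d')"
      by (metis prod_cases4)
    then have x: "(u, es, c, d) \<in> walk_data" and y: "(u', es', c', d') \<in> walk_data"
      and eq: "extend_walk (u, es, c, d) = extend_walk (u', es', c', d')"
      using t by auto
    obtain p q where p: "p \<noteq> []" "q \<noteq> []" "mono_in u c p"
      "\<forall>x \<in> set p. col x = c" "\<forall>x \<in> set q. col x = d" "col (hd (es @ q)) \<noteq> c" "col (last (p @ es)) \<noteq> d"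
      "extend_walk (u, es, c, d) = p @ es @ q"
      using x by (rule extend_walkE)
    obtain p' q' where p': "p' \<noteq> []" "q' \<noteq> []" "mono_in u' c' p'"
      "\<forall>x \<in> set p'. col x = c'" "\<forall>x \<in> set q'. col x = d'" "col (hd (es' @ q')) \<noteq> c'" "col (last (p' @ es')) \<noteq> d'"
      "extend_walk (u', es', c', d') = p' @ es' @ q'"
      using y by (rule extend_walkE)
    have e: "p @ es @ q = p' @ es' @ q'" using p p' eq by simp
    have "p = p' \<and> es @ q = es' @ q' \<and> c = c'"
      by (rule mono_prefix_unique[OF e p(1) p'(1) p(4) p'(4) _ _ p(6) p'(6)]) (use p(2) p'(2) in simp_all)
    moreover have "q = q' \<and> p @ es = p' @ es' \<and> d = d'"
      by (rule mono_suffix_unique[of "p @ es" q "p' @ es'" q' col, OF _ p(2) p'(2) p(5) p'(5) _ _ p(7) p'(7)])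
        (use e p(1) p'(1) in simp_all)
    moreover have "u = head G (last p)" "u' = head G (last p')"
      using mono_in_last[OF p(3,1)] mono_in_last[OF p'(3,1)] by simp_all
    ultimately show "t = t'" by (auto simp: tt)
  qed
next
  show "extend_walk ` walk_data = nonmono_routes"
  proof (intro equalityI subsetI)
    fix R assume "R \<in> extend_walk ` walk_data"
    then obtain u es c d where x: "(u, es, c, d) \<in> walk_data" and R: "R = extend_walk (u, es, c, d)"
      by auto
    obtain p q where p: "p \<noteq> []" "q \<noteq> []" "mono_in u c p" "mono_out (awlast u es) d q"
      "\<forall>x \<in> set p. col x = c" "col (hd (es @ q)) \<noteq> c"
      "extend_walk (u, es, c, d) = p @ es @ q" "awalk u es (awlast u es)"
      using x by (rule extend_walkE)
    have "R \<in> routes G"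
      using p unfolding R routes_def mono_in_def mono_out_def by (auto intro!: awalk_appendI)
    moreover have "hd (es @ q) \<in> set R" "hd p \<in> set R"
      using p unfolding R by (auto simp: hd_append)
    moreover have "col (hd p) \<noteq> col (hd (es @ q))"
      using p(1,5,6) by simp
    ultimately show "R \<in> nonmono_routes"
      unfolding nonmono_routes_def by blast
  next
    fix R assume R: "R \<in> nonmono_routes"
    then have "\<not> (\<exists>c. \<forall>x \<in> set R. col x = c)"
      by (simp add: nonmono_routes_def)
    then obtain p r where p: "R = p @ r" "p \<noteq> []" "\<forall>x \<in> set p. col x = col (hd R)" "r \<noteq> []" "col (hd r) \<noteq> col (hd R)"
      by (rule mono_prefix_split)
    \<comment> \<open>Splitting the suffix off \<open>r\<close>, not off \<open>R\<close>, keeps it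
      disjoint from the prefix. It may use up all of \<open>r\<close>, and then the walk is
      trivial.\<close>
    obtain es q where q: "r = es @ q" "q \<noteq> []" "\<forall>x \<in> set q. col x = col (last r)"
      "es \<noteq> [] \<longrightarrow> col (last es) \<noteq> col (last r)"
      using p(4) by (rule mono_suffix_split[where f = col])
    obtain x y where walk: "is_source G x" "is_sink G y" "awalk x (p @ es @ q) y"
      using R unfolding nonmono_routes_def p(1) q(1) by (auto elim: routeE)
    define u where "u = head G (last p)"
    have w: "awalk x p u" "awalk u (es @ q) y"
    proof -
      obtain v where v: "awalk x p v" "awalk v (es @ q) y"
        using walk(3) by (rule awalk_appendD)
      moreover have "v = u"
        using v(1) p(2) unfolding u_def by (cases p rule: rev_cases) (auto simp: awalk_snoc)
      ultimately show "awalk x p u" "awalk u (es @ q) y" by auto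
    qed
    then have w': "awalk u es (awlast u es)" "awalk (awlast u es) q y"
      by (auto simp: awalk_append_iff)
    have inner: "u \<in> inner_verts G" "head G ` set es \<subseteq> inner_verts G"
    proof -
      have Rr: "p @ es @ q \<in> routes G" using walk by (auto simp: routes_def)
      show "u \<in> inner_verts G"
        using route_arc_inner(3)[of "butlast p" "last p" "es @ q"] Rr p(2) q(2)
        by (cases p rule: rev_cases) (simp_all add: u_def)
      show "head G ` set es \<subseteq> inner_verts G"
      proof
        fix v assume "v \<in> head G ` set es"
        then obtain a where "v = head G a" "a \<in> set es" by auto
        moreover from this obtain s t where "es = s @ a # t" by (meson split_list)
        ultimately show "v \<in> inner_verts G"
          using route_arc_inner(3)[of "p @ s" a "t @ q"] Rr q(2) by simp
      qed
    qed
    then have iw: "iwalk u es" using w' by (simp add: iwalk_iff)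
    have "to_source u (col (hd R)) = p"
      using inner p(3) w(1) walk by (intro to_source_eq) (auto simp: mono_in_def)
    moreover have "to_sink (awlast u es) (col (last r)) = q"
      using iwalk_end[OF iw] q(3) w'(2) walk by (intro to_sink_eq) (auto simp: mono_out_def)
    ultimately have "R = extend_walk (u, es, col (hd R), col (last r))"
      by (simp add: extend_walk_def p(1) q(1))
    moreover have "(u, es, col (hd R), col (last r)) \<in> walk_data"
    proof (cases "es = []")
      case True
      then have "hd r \<in> set q" using q(1,2) by simp
      then have "col (hd r) = col (last r)" using q(3) by blast
      then show ?thesis using iw p(5) True by (simp add: walk_data_def)
    next
      case False
      then have "col (hd es) \<noteq> col (hd R)" "col (last es) \<noteq> col (last r)"
        using p(5) q(1,4) by (simp_all add: hd_append)
      then show ?thesis using iw False by (simp add: walk_data_def)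
    qed
    ultimately show "R \<in> extend_walk ` walk_data" by blast
  qed
qed

text \<open>There are only two colours, so a nonempty \<open>es\<close> forces \<open>c\<close> and
  \<open>d\<close> to be the opposites of its end colours. For an empty \<open>es\<close> only
  \<open>d = (\<not> c)\<close> is imposed, and the free bit \<open>c\<close> selects the
  summand.\<close>

lemma bij_walk_data:
  "bij_betw (\<lambda>(u, es, c, d). if es = [] \<and> c then Inr u else Inl (u, es)) walk_data
     ({(u, es). iwalk u es} <+> inner_verts G)"
  (is "bij_betw ?f _ _")
proof (rule bij_betw_imageI)
  show "inj_on ?f walk_data"
    by (rule inj_onI) (auto simp: walk_data_def split: if_splits)
  show "?f ` walk_data = {(u, es). iwalk u es} <+> inner_verts G"
  proof (intro equalityI subsetI)
    fix x assume "x \<in> ?f ` walk_data"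
    then show "x \<in> {(u, es). iwalk u es} <+> inner_verts G"
      by (auto simp: walk_data_def split: if_splits)
  next
    fix x assume "x \<in> {(u, es). iwalk u es} <+> inner_verts G"
    then show "x \<in> ?f ` walk_data"
    proof (elim PlusE)
      fix y assume "y \<in> {(u, es). iwalk u es}" and x: "x = Inl y"
      then obtain u es where y: "y = (u, es)" "iwalk u es" by auto
      show ?thesis
      proof (cases "es = []")
        case True
        then have "(u, [], False, True) \<in> walk_data" using y by (auto simp: walk_data_def)
        then show ?thesis using x y True by (force intro: rev_image_eqI)
      next
        case False
        then have "(u, es, \<not> col (hd es), \<not> col (last es)) \<in> walk_data" using y by (auto simp: walk_data_def)
        then show ?thesis using x y False by (force intro: rev_image_eqI)
      qed
    next
      fix u assume "u \<in> inner_verts G" and x: "x = Inr u"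
      then have "(u, [], True, False) \<in> walk_data" by (auto simp: walk_data_def)
      then show ?thesis using x by (force intro: rev_image_eqI)
    qed
  qed
qed

end

section \<open>Exceptional routes\<close>

context ample_full_dag
begin

definition col :: "'e \<Rightarrow> bool" where
  "col e \<longleftrightarrow> omega G F e = 1"

lemma omega_in: "v \<in> inner_verts G \<Longrightarrow> e \<in> in_arcs G v \<Longrightarrow> omega G F e = in_pos e"
  using omega_eq(2)[of e] by auto

lemma omega_out: "v \<in> inner_verts G \<Longrightarrow> e \<in> out_arcs G v \<Longrightarrow> omega G F e = out_pos e"
  using omega_eq(1)[of e] by auto

lemma omega_cases_out: "v \<in> inner_verts G \<Longrightarrow> e \<in> out_arcs G v \<Longrightarrow> omega G F e = 1 \<or> omega G F e = 2"
  using omega_out out_pos_cases by metis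

text \<open>Of the two edges into an inner vertex, one has position 1 and the other position
  2.\<close>

lemma in_col_ex1:
  assumes v: "v \<in> inner_verts G"
  shows "\<exists>!e. e \<in> in_arcs G v \<and> col e = c"
proof -
  have pair: "col a \<noteq> col b" if "a \<in> in_arcs G v" "b \<in> in_arcs G v" "a \<noteq> b" for a b
    using in_pair[OF v that] omega_in[OF v] that by (auto simp: col_def)
  obtain a where a: "a \<in> in_arcs G v"
    using v unfolding inner_iff by blast
  then obtain b where "b \<in> in_arcs G v" "b \<noteq> a"
    by (rule other_in[OF v])
  with a pair[of a b] have "\<exists>e \<in> in_arcs G v. col e = c"
    by (cases "col a = c") auto
  then show ?thesis using pair by metis
qed

lemma out_col_ex1:
  assumes v: "v \<in> inner_verts G"
  shows "\<exists>!e. e \<in> out_arcs G v \<and> col e = c"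
proof -
  have pair: "col a \<noteq> col b" if "a \<in> out_arcs G v" "b \<in> out_arcs G v" "a \<noteq> b" for a b
    using out_pair[OF v that] omega_out[OF v] that by (auto simp: col_def)
  obtain a where a: "a \<in> out_arcs G v"
    using v unfolding inner_iff by blast
  then obtain b where "b \<in> out_arcs G v" "b \<noteq> a"
    by (rule other_out[OF v])
  with a pair[of a b] have "\<exists>e \<in> out_arcs G v. col e = c"
    by (cases "col a = c") auto
  then show ?thesis using pair by metis
qed

sublocale coloured_dag G col
  by unfold_locales (auto simp only: in_col_ex1 out_col_ex1)

text \<open>Wherever another route joins or leaves \<open>R\<close> at an inner vertex, the edge of
  \<open>R\<close> has colour \<open>c\<close>: it comes first if \<open>c\<close> holds and second
  otherwise. So \<open>R\<close> has the same outcome before and after \<open>v\<close>, while a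
  conflict needs opposite ones.\<close>

lemma mono_coherent:
  assumes R: "R \<in> routes G" "\<forall>e \<in> set R. col e = c" and Q: "Q \<in> routes G"
  shows "coherent G F R Q"
  unfolding coherent_def
proof (intro allI impI notI, elim conjE)
  fix v assume v: "passes G R v" "passes G Q v" and conflict: "conflict_at G F v R Q"
  have split: "\<exists>p a q. P = p @ a # q \<and> tail G a = v" if "passes G P v" for P
    using that unfolding passes_def by (metis imageE split_list)
  obtain p a q where R': "R = p @ a # q" "tail G a = v"
    using split[OF v(1)] by blast
  obtain p' a' q' where Q': "Q = p' @ a' # q'" "tail G a' = v"
    using split[OF v(2)] by blast
  obtain u w u' w' where walks: "awalk u R w" "awalk u' Q w'"
    using R Q by (auto elim!: routeE)
  have parts: "part_before G v R = p" "part_after G v R = a # q"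
    "part_before G v Q = p'" "part_after G v Q = a' # q'"
    using parts_at[OF walks(1)[unfolded R'(1)]] parts_at[OF walks(2)[unfolded Q'(1)]] R' Q' by auto
  have walk: "awalk u p v" "awalk v (a # q) w" "awalk u' p' v" "awalk v (a' # q') w'"
    using walks R' Q' by (auto simp: awalk_mid awalk_Cons_iff)
  \<comment> \<open>The vertex of divergence is \<open>v\<close> or the head of the last edge of
    \<open>s\<close>, hence inner, so the colour of \<open>b\<close> decides the order
    there.\<close>
  have out: False if x: "awalk v (s @ b # t) x" and y: "awalk v (s @ d # t') y"
    and ne: "b \<noteq> d"
    and ord: "(b, d) \<in> out_ord F (tail G b) \<and> \<not> col b \<or> (d, b) \<in> out_ord F (tail G d) \<and> col b" for s b t d t' x y
  proof -
    have "awalk v s (tail G b)" "awalk v s (tail G d)"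
      using x y by (auto simp: awalk_mid)
    then have bd: "tail G b = tail G d" "b \<in> arcs G" "d \<in> arcs G"
      using x y by (auto simp: awalk_mid elim!: awalkE)
    have "tail G b \<in> inner_verts G"
    proof (cases s rule: rev_cases)
      case Nil
      then have "tail G b = v" using x by (auto simp: awalk_Cons_iff)
      then show ?thesis using v by (auto simp: passes_def)
    next
      case (snoc s' c)
      then have "c \<in> arcs G" "head G c = tail G b" using x by (auto simp: awalk_mid awalk_snoc)
      then show ?thesis using bd by (auto simp: inner_iff)
    qed
    then show False
      using out_pair[of "tail G b" b d] omega_out[of "tail G b" b] ne bd ord by (auto simp: col_def)
  qed
  have inn: False if x: "awalk x (t @ b # s) v" and y: "awalk y (t' @ d # s) v"
    and ne: "b \<noteq> d"
    and ord: "(b, d) \<in> in_ord F (head G b) \<and> \<not> col b \<or> (d, b) \<in> in_ord F (head G d) \<and> col b" for s b t d t' x y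
  proof -
    have bd: "b \<in> arcs G" "d \<in> arcs G" "awalk (head G b) s v" "awalk (head G d) s v"
      using x y by (auto simp: awalk_mid)
    then have h: "head G b = head G d"
      by (cases s) (auto simp: awalk_Nil_iff awalk_Cons_iff)
    have "head G b \<in> inner_verts G"
    proof (cases s)
      case Nil
      then have "head G b = v" using bd by (auto simp: awalk_Nil_iff)
      then show ?thesis using v by (auto simp: passes_def)
    next
      case (Cons c s')
      then have "c \<in> arcs G" "tail G c = head G b" using bd by (auto simp: awalk_Cons_iff)
      then show ?thesis using bd by (auto simp: inner_iff)
    qed
    then show False
      using in_pair[of "head G b" b d] omega_in[of "head G b" b] ne bd ord h by (auto simp: col_def)
  qed
  have "c" if "out_less G F (a # q) (a' # q')"
  proof -
    obtain s b d t t' where eq: "a # q = s @ b # t" "a' # q' = s @ d # t'" "b \<noteq> d" "(b, d) \<in> out_ord F (tail G b)"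
      using \<open>out_less G F (a # q) (a' # q')\<close> unfolding out_less_def by blast
    then have "b \<in> set R" unfolding R' eq by simp
    then show ?thesis using out[of s b t w d t' w'] walk(2,4)[unfolded eq] eq(3,4) R(2) by auto
  qed
  moreover have "\<not> c" if "out_less G F (a' # q') (a # q)"
  proof -
    obtain s b d t t' where eq: "a' # q' = s @ d # t'" "a # q = s @ b # t" "d \<noteq> b" "(d, b) \<in> out_ord F (tail G d)"
      using \<open>out_less G F (a' # q') (a # q)\<close> unfolding out_less_def by blast
    then have "b \<in> set R" unfolding R' eq by simp
    then show ?thesis using out[of s b t w d t' w'] walk(2,4)[unfolded eq] eq(3,4) R(2) by auto
  qed
  moreover have "c" if "in_less G F p p'"
  proof -
    obtain s b d t t' where eq: "p = t @ b # s" "p' = t' @ d # s" "b \<noteq> d" "(b, d) \<in> in_ord F (head G b)"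
      using \<open>in_less G F p p'\<close> unfolding in_less_def by blast
    then have "b \<in> set R" unfolding R' eq by simp
    then show ?thesis using inn[of u t b s u' t' d] walk(1,3)[unfolded eq] eq(3,4) R(2) by auto
  qed
  moreover have "\<not> c" if "in_less G F p' p"
  proof -
    obtain s b d t t' where eq: "p' = t' @ d # s" "p = t @ b # s" "d \<noteq> b" "(d, b) \<in> in_ord F (head G d)"
      using \<open>in_less G F p' p\<close> unfolding in_less_def by blast
    then have "b \<in> set R" unfolding R' eq by simp
    then show ?thesis using inn[of u t b s u' t' d] walk(1,3)[unfolded eq] eq(3,4) R(2) by auto
  qed
  ultimately show False
    using conflict unfolding conflict_at_def parts by blast
qed

text \<open>A route with two colours changes colour between consecutive edges, where
  \<open>exceptional_positions\<close> applies with an empty segment.\<close>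

lemma exceptional_iff: "R \<in> exceptional_routes G F \<longleftrightarrow> R \<in> routes G \<and> (\<exists>c. \<forall>e \<in> set R. col e = c)"
proof
  assume R: "R \<in> exceptional_routes G F"
  then have Rr: "R \<in> routes G" by (simp add: exceptional_routes_def)
  have "\<exists>c. \<forall>e \<in> set R. col e = c"
  proof (rule ccontr)
    assume "\<not> ?thesis"
    then obtain p a b q where pq: "R = p @ a # b # q" "col a \<noteq> col b"
      by (rule consecutive_change)
    note ab = route_consecutive[OF Rr[unfolded pq(1)]]
    have "in_pos a = out_pos b"
      using exceptional_positions[OF R, of p a "[]" b q] pq by simp
    moreover have "omega G F a = in_pos a" "omega G F b = out_pos b"
      using ab omega_eq(2)[of a] omega_eq(1)[of b] by auto
    ultimately show False using pq by (simp add: col_def)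
  qed
  then show "R \<in> routes G \<and> (\<exists>c. \<forall>e \<in> set R. col e = c)"
    using Rr by simp
next
  assume "R \<in> routes G \<and> (\<exists>c. \<forall>e \<in> set R. col e = c)"
  then show "R \<in> exceptional_routes G F"
    unfolding exceptional_routes_def using mono_coherent by blast
qed

lemma nonexceptional_eq: "nonexceptional_routes G F = nonmono_routes"
  unfolding nonexceptional_routes_def nonmono_routes_def using exceptional_iff by blast

end

section \<open>Vector spaces and functionals\<close>

text \<open>The scalars act through a map \<open>sc\<close>, which is later the action of scalar
  classes of the algebra; thus a module is a vector space without any additional structure.\<close>

locale kspace = abelian_group M for M (structure) +
  fixes sc :: "'k::field \<Rightarrow> 'a \<Rightarrow> 'a"
  assumes sc_closed [simp]: "x \<in> carrier M \<Longrightarrow> sc c x \<in> carrier M"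
    and sc_add_left: "x \<in> carrier M \<Longrightarrow> sc (c + d) x = sc c x \<oplus> sc d x"
    and sc_add_right: "x \<in> carrier M \<Longrightarrow> y \<in> carrier M \<Longrightarrow> sc c (x \<oplus> y) = sc c x \<oplus> sc c y"
    and sc_mult: "x \<in> carrier M \<Longrightarrow> sc (c * d) x = sc c (sc d x)"
    and sc_one [simp]: "x \<in> carrier M \<Longrightarrow> sc 1 x = x"
begin

lemma sc_zero_left [simp]: "x \<in> carrier M \<Longrightarrow> sc 0 x = \<zero>"
  using sc_add_left[of x 0 0] by (metis add.r_cancel_one' add_0 sc_closed)

lemma sc_zero_right [simp]: "sc c \<zero> = \<zero>"
  using sc_add_right[of "\<zero>" "\<zero>" c] by (metis add.r_cancel_one' l_zero sc_closed zero_closed)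

lemma sc_minus_one: "x \<in> carrier M \<Longrightarrow> sc (-1) x = \<ominus> x"
  using sc_add_left[of x "-1" 1] minus_equality[of "sc (-1) x" x] by simp

section \<open>Subspaces, functionals and separation\<close>

definition subsp :: "'a set \<Rightarrow> bool" where
  "subsp S \<longleftrightarrow> S \<subseteq> carrier M \<and> \<zero> \<in> S \<and> (\<forall>x\<in>S. \<forall>y\<in>S. x \<oplus> y \<in> S) \<and> (\<forall>c. \<forall>x\<in>S. sc c x \<in> S)"

lemma subspD:
  assumes "subsp S"
  shows "x \<in> S \<Longrightarrow> x \<in> carrier M" "\<zero> \<in> S" "x \<in> S \<Longrightarrow> y \<in> S \<Longrightarrow> x \<oplus> y \<in> S" "x \<in> S \<Longrightarrow> sc c x \<in> S"
    "x \<in> S \<Longrightarrow> \<ominus> x \<in> S" "x \<in> S \<Longrightarrow> y \<in> S \<Longrightarrow> x \<ominus> y \<in> S"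
  using assms sc_minus_one unfolding subsp_def a_minus_def by (auto, metis subsetD, metis subsetD)

lemma subsp_zero: "subsp {\<zero>}"
  by (simp add: subsp_def)

lemma subsp_sum:
  assumes "subsp S" "subsp T"
  shows "subsp {s \<oplus> t | s t. s \<in> S \<and> t \<in> T}"
  unfolding subsp_def
proof (intro conjI ballI allI subsetI)
  show "\<zero> \<in> {s \<oplus> t | s t. s \<in> S \<and> t \<in> T}"
    using subspD(2)[OF assms(1)] subspD(2)[OF assms(2)] by force
  fix x assume "x \<in> {s \<oplus> t | s t. s \<in> S \<and> t \<in> T}"
  then obtain s t where x: "x = s \<oplus> t" "s \<in> S" "t \<in> T" by blast
  then have c: "s \<in> carrier M" "t \<in> carrier M" using assms subspD(1) by auto
  then show "x \<in> carrier M" using x by simp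
  show "sc c x \<in> {s \<oplus> t | s t. s \<in> S \<and> t \<in> T}" for c
    using c x sc_add_right[of s t c] subspD(4)[OF assms(1)] subspD(4)[OF assms(2)] by blast
  fix y assume "y \<in> {s \<oplus> t | s t. s \<in> S \<and> t \<in> T}"
  then obtain s' t' where y: "y = s' \<oplus> t'" "s' \<in> S" "t' \<in> T" by blast
  then have "s' \<in> carrier M" "t' \<in> carrier M" using assms subspD(1) by auto
  then have "x \<oplus> y = (s \<oplus> s') \<oplus> (t \<oplus> t')"
    using x y c by (simp add: a_ac)
  then show "x \<oplus> y \<in> {s \<oplus> t | s t. s \<in> S \<and> t \<in> T}"
    using x y subspD(3)[OF assms(1)] subspD(3)[OF assms(2)] by blast
qed

definition functional :: "('a \<Rightarrow> 'k) \<Rightarrow> bool" where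
  "functional \<xi> \<longleftrightarrow> (\<forall>x\<in>carrier M. \<forall>y\<in>carrier M. \<xi> (x \<oplus> y) = \<xi> x + \<xi> y) \<and>
     (\<forall>c. \<forall>x\<in>carrier M. \<xi> (sc c x) = c * \<xi> x)"

lemma functionalD:
  assumes "functional \<xi>"
  shows "x \<in> carrier M \<Longrightarrow> y \<in> carrier M \<Longrightarrow> \<xi> (x \<oplus> y) = \<xi> x + \<xi> y"
    "x \<in> carrier M \<Longrightarrow> \<xi> (sc c x) = c * \<xi> x"
    "\<xi> \<zero> = 0" "x \<in> carrier M \<Longrightarrow> \<xi> (\<ominus> x) = - \<xi> x"
    "x \<in> carrier M \<Longrightarrow> y \<in> carrier M \<Longrightarrow> \<xi> (x \<ominus> y) = \<xi> x - \<xi> y"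
proof -
  show add: "x \<in> carrier M \<Longrightarrow> y \<in> carrier M \<Longrightarrow> \<xi> (x \<oplus> y) = \<xi> x + \<xi> y" for x y
    using assms by (simp add: functional_def)
  show sc: "x \<in> carrier M \<Longrightarrow> \<xi> (sc c x) = c * \<xi> x" for x c
    using assms by (simp add: functional_def)
  show "\<xi> \<zero> = 0" using sc[of "\<zero>" 0] by simp
  show neg: "\<xi> (\<ominus> x) = - \<xi> x" if "x \<in> carrier M" for x
    using sc[OF that, of "-1"] sc_minus_one[OF that] by simp
  show "\<xi> (x \<ominus> y) = \<xi> x - \<xi> y" if "x \<in> carrier M" "y \<in> carrier M"
    using that neg add by (simp add: a_minus_def)
qed

text \<open>Zorn's lemma. In the next proof \<open>H\<close> turns out to be a hyperplane
  complementary to the line of \<open>x\<close>.\<close>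

lemma maximal_subsp_avoiding:
  assumes "subsp D" "x \<notin> D"
  obtains H where "subsp H" "D \<subseteq> H" "x \<notin> H" "\<And>H'. subsp H' \<Longrightarrow> H \<subseteq> H' \<Longrightarrow> x \<notin> H' \<Longrightarrow> H' = H"
proof -
  let ?A = "{H. subsp H \<and> D \<subseteq> H \<and> x \<notin> H}"
  have "\<exists>H\<in>?A. \<forall>X\<in>?A. H \<subseteq> X \<longrightarrow> X = H"
  proof (rule subset_Zorn_nonempty)
    show "?A \<noteq> {}" using assms by blast
    fix \<C> assume "\<C> \<noteq> {}" and chain: "subset.chain ?A \<C>"
    then obtain H0 where H0: "H0 \<in> \<C>" by blast
    have mem: "H \<in> ?A" if "H \<in> \<C>" for H
      using chain that by (auto simp: subset.chain_def)
    have comb: "\<exists>H\<in>\<C>. a \<in> H \<and> b \<in> H" if "a \<in> \<Union>\<C>" "b \<in> \<Union>\<C>" for a b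
      using chain that unfolding subset.chain_def by blast
    have "subsp (\<Union>\<C>)"
      unfolding subsp_def
    proof (intro conjI ballI allI subsetI)
      show "\<zero> \<in> \<Union>\<C>" using H0 mem subspD(2) by blast
      show "a \<oplus> b \<in> \<Union>\<C>" if "a \<in> \<Union>\<C>" "b \<in> \<Union>\<C>" for a b
        using comb[OF that] mem subspD(3) by blast
      show "a \<in> carrier M" if "a \<in> \<Union>\<C>" for a
        using that mem subspD(1) by blast
      show "sc c a \<in> \<Union>\<C>" if "a \<in> \<Union>\<C>" for a c
        using that mem subspD(4) by blast
    qed
    moreover have "D \<subseteq> \<Union>\<C>" "x \<notin> \<Union>\<C>"
      using H0 mem by blast+
    ultimately show "\<Union>\<C> \<in> ?A" by blast
  qed
  then obtain H where "H \<in> ?A" "\<forall>X\<in>?A. H \<subseteq> X \<longrightarrow> X = H" ..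
  then show ?thesis using that[of H] by blast
qed

text \<open>A maximal subspace \<open>H\<close> that contains \<open>D\<close> but not
  \<open>x\<close> satisfies \<open>H + K x = M\<close>, and the functional is the coefficient of
  \<open>x\<close> in this decomposition.\<close>

lemma separating_functional:
  assumes D: "subsp D" and x: "x \<in> carrier M" "x \<notin> D"
  obtains \<xi> where "functional \<xi>" "\<And>d. d \<in> D \<Longrightarrow> \<xi> d = 0" "\<xi> x = 1"
proof -
  obtain H where H: "subsp H" "D \<subseteq> H" "x \<notin> H"
    and max: "\<And>H'. subsp H' \<Longrightarrow> H \<subseteq> H' \<Longrightarrow> x \<notin> H' \<Longrightarrow> H' = H"
    using D x(2) by (rule maximal_subsp_avoiding) blast
  have span: "\<exists>c. y \<oplus> sc (- c) x \<in> H" if y: "y \<in> carrier M" for y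
  proof (cases "y \<in> H")
    case True
    then show ?thesis using x y by (intro exI[of _ 0]) simp
  next
    case False
    have L: "subsp (range (\<lambda>c. sc c y))"
      unfolding subsp_def
    proof (intro conjI ballI allI subsetI)
      show "\<zero> \<in> range (\<lambda>c. sc c y)" using y by (intro range_eqI[of _ _ 0]) simp
    qed (use y in \<open>auto simp flip: sc_add_left sc_mult\<close>)
    let ?H = "{s \<oplus> t | s t. s \<in> H \<and> t \<in> range (\<lambda>c. sc c y)}"
    have "H \<subseteq> ?H"
      using y H(1) by (force intro: exI[of _ "\<zero>"] simp: subspD range_eqI[of _ _ 0])
    moreover have "y \<in> ?H"
      using y subspD(2)[OF H(1)] by (force intro: range_eqI[of _ _ 1])
    \<comment> \<open>\<open>H + K y\<close> is strictly larger than \<open>H\<close>, so maximality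
      forces it to contain \<open>x\<close>; the coefficient of \<open>y\<close> is then nonzero and
      can be inverted.\<close>
    ultimately have "x \<in> ?H"
      using max[OF subsp_sum[OF H(1) L]] False by blast
    then obtain h c where hc: "x = h \<oplus> sc c y" "h \<in> H" by blast
    then have h: "h \<in> carrier M" using H(1) subspD(1) by blast
    have c: "c \<noteq> 0" using hc H(3) h y by auto
    have "sc (inverse c) x = sc (inverse c) h \<oplus> y"
      using c hc(1) h y by (simp add: sc_add_right flip: sc_mult)
    then have "y \<oplus> sc (- inverse c) x = sc (- inverse c) h"
    proof -
      assume eq: "sc (inverse c) x = sc (inverse c) h \<oplus> y"
      have neg: "sc (- inverse c) z = \<ominus> sc (inverse c) z" if "z \<in> carrier M" for z
        using sc_minus_one[of "sc (inverse c) z"] that sc_mult[of z "-1" "inverse c"] by simp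
      have "y \<oplus> sc (- inverse c) x = y \<oplus> (\<ominus> sc (inverse c) h \<oplus> \<ominus> y)"
        using neg[OF x(1)] eq y h by (simp add: minus_add)
      also have "\<dots> = \<ominus> sc (inverse c) h"
        using y h a_lcomm[of y "\<ominus> sc (inverse c) h" "\<ominus> y"] by (simp add: r_neg)
      finally show ?thesis using neg[OF h] by simp
    qed
    then show ?thesis using subspD(4)[OF H(1) hc(2)] by metis
  qed
  have unique: "c = d" if "y \<oplus> sc (- c) x \<in> H" "y \<oplus> sc (- d) x \<in> H" "y \<in> carrier M" for y c d
  proof (rule ccontr)
    assume "c \<noteq> d"
    have "(y \<oplus> sc (- c) x) \<oplus> sc (-1) (y \<oplus> sc (- d) x) \<in> H"
      using that subspD[OF H(1)] by blast
    moreover have "(y \<oplus> sc (- c) x) \<oplus> sc (-1) (y \<oplus> sc (- d) x) = sc (d - c) x"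
    proof -
      have "(y \<oplus> sc (- c) x) \<oplus> sc (-1) (y \<oplus> sc (- d) x) = (y \<oplus> sc (-1) y) \<oplus> (sc (- c) x \<oplus> sc d x)"
        using that(3) x by (simp add: sc_add_right a_ac flip: sc_mult)
      also have "\<dots> = sc (d - c) x"
        using that(3) x by (simp add: sc_minus_one r_neg flip: sc_add_left)
      finally show ?thesis .
    qed
    ultimately have "sc (inverse (d - c)) (sc (d - c) x) \<in> H"
      using subspD(4)[OF H(1)] by metis
    then show False
      using \<open>c \<noteq> d\<close> x H(3) by (simp flip: sc_mult)
  qed
  \<comment> \<open>The coefficient of \<open>y\<close> along \<open>x\<close> modulo
    \<open>H\<close>, unique because \<open>x \<notin> H\<close>.\<close>
  define \<xi> where "\<xi> y = (THE c. y \<oplus> sc (- c) x \<in> H)" for y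
  have \<xi>: "\<xi> y = c" if "y \<oplus> sc (- c) x \<in> H" "y \<in> carrier M" for y c
    unfolding \<xi>_def using that unique by blast
  have mem: "y \<oplus> sc (- \<xi> y) x \<in> H" if "y \<in> carrier M" for y
    using span[OF that] \<xi> that by metis
  have "functional \<xi>"
    unfolding functional_def
  proof (intro conjI ballI allI)
    fix y z assume y: "y \<in> carrier M" and z: "z \<in> carrier M"
    have "(y \<oplus> sc (- \<xi> y) x) \<oplus> (z \<oplus> sc (- \<xi> z) x) = (y \<oplus> z) \<oplus> (sc (- \<xi> y) x \<oplus> sc (- \<xi> z) x)"
      using y z x by (simp add: a_ac)
    also have "\<dots> = (y \<oplus> z) \<oplus> sc (- (\<xi> y + \<xi> z)) x"
      using x by (simp flip: sc_add_left)
    finally show "\<xi> (y \<oplus> z) = \<xi> y + \<xi> z"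
      using subspD(3)[OF H(1) mem[OF y] mem[OF z]] y z by (intro \<xi>) auto
  next
    fix c y assume y: "y \<in> carrier M"
    have "sc c (y \<oplus> sc (- \<xi> y) x) = sc c y \<oplus> sc (- (c * \<xi> y)) x"
      using x y by (simp add: sc_add_right flip: sc_mult)
    then show "\<xi> (sc c y) = c * \<xi> y"
      using subspD(4)[OF H(1) mem[OF y], of c] y by (intro \<xi>) auto
  qed
  moreover have "\<xi> d = 0" if "d \<in> D" for d
    using that H x subspD(1)[OF D] by (intro \<xi>) auto
  moreover have "\<xi> x = 1"
    using x subspD(2)[OF H(1)] by (intro \<xi>) (auto simp: sc_minus_one r_neg)
  ultimately show ?thesis by (rule that)
qed

end

section \<open>String summands of representations\<close>

context coloured_dag
begin

section \<open>Arrows of the quiver along walks of the DAG\<close>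

definition qarcs :: "'e set" where
  "qarcs = {e \<in> arcs G. tail G e \<in> inner_verts G \<and> head G e \<in> inner_verts G}"

definition qtail :: "'e \<Rightarrow> 'v" where
  "qtail e = (if col e then tail G e else head G e)"

definition qhead :: "'e \<Rightarrow> 'v" where
  "qhead e = (if col e then head G e else tail G e)"

definition walk_verts :: "'v \<Rightarrow> 'e list \<Rightarrow> 'v set" where
  "walk_verts u es = insert u (head G ` set es)"

lemma walk_verts_Nil [simp]: "walk_verts u [] = {u}"
  by (simp add: walk_verts_def)

lemma walk_verts_Cons [simp]: "walk_verts u (e # es) = insert u (walk_verts (head G e) es)"
  by (auto simp: walk_verts_def)

lemma start_in_walk_verts [simp]: "u \<in> walk_verts u es"
  by (simp add: walk_verts_def)

lemma finite_walk_verts [simp]: "finite (walk_verts u es)"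
  by (simp add: walk_verts_def)

lemma iwalk_start: "iwalk u es \<Longrightarrow> u \<in> inner_verts G"
  by (cases es) auto

lemma iwalk_arc:
  "iwalk u es \<Longrightarrow> e \<in> set es \<Longrightarrow>
    e \<in> qarcs \<and> tail G e \<in> walk_verts u es \<and> head G e \<in> walk_verts u es \<and> rank u \<le> rank (tail G e)"
proof (induction es arbitrary: u)
  case (Cons a es)
  then show ?case
    using rank_arc[of a] iwalk_start[of "head G a" es] by (fastforce simp: qarcs_def)
qed simp

lemma iwalk_vert: "iwalk u es \<Longrightarrow> w \<in> walk_verts u es \<Longrightarrow> w \<in> inner_verts G \<and> rank u \<le> rank w"
proof (induction es arbitrary: u)
  case (Cons a es)
  then show ?case
    using rank_arc[of a] by fastforce
qed simp

lemma qarcs_ends: "e \<in> qarcs \<Longrightarrow> qtail e \<in> inner_verts G" "e \<in> qarcs \<Longrightarrow> qhead e \<in> inner_verts G"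
  by (auto simp: qarcs_def qtail_def qhead_def)

lemma rank_qarc: "e \<in> qarcs \<Longrightarrow> rank (tail G e) < rank (head G e)"
  by (simp add: qarcs_def rank_arc)

lemma out_same_col: "a \<in> qarcs \<Longrightarrow> b \<in> qarcs \<Longrightarrow> tail G a = tail G b \<Longrightarrow> col a = col b \<Longrightarrow> a = b"
  using out_ex1[of "tail G a" "col a"] by (auto simp: qarcs_def)

lemma in_same_col: "a \<in> qarcs \<Longrightarrow> b \<in> qarcs \<Longrightarrow> head G a = head G b \<Longrightarrow> col a = col b \<Longrightarrow> a = b"
  using in_ex1[of "head G a" "col a"] by (auto simp: qarcs_def)

end

text \<open>A representation of the bound quiver inside one space: \<open>ev v\<close> projects to
  the space at \<open>v\<close>, \<open>ar e\<close> is the map of an arrow, extended by zero from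
  its tail, and \<open>ar_ar\<close> is the zero relations. \<open>ev_complete\<close> states that
  the projections together detect every vector.\<close>

locale coloured_rep = coloured_dag G col + M?: kspace M sc
  for G :: "('v,'e) pre_digraph" and col :: "'e \<Rightarrow> bool"
    and M :: "('m,'z) ring_scheme" and sc :: "'k::field \<Rightarrow> 'm \<Rightarrow> 'm" +
  fixes ev :: "'v \<Rightarrow> 'm \<Rightarrow> 'm" and ar :: "'e \<Rightarrow> 'm \<Rightarrow> 'm"
  assumes ev_closed [simp]: "v \<in> inner_verts G \<Longrightarrow> x \<in> carrier M \<Longrightarrow> ev v x \<in> carrier M"
    and ev_add: "v \<in> inner_verts G \<Longrightarrow> x \<in> carrier M \<Longrightarrow> y \<in> carrier M \<Longrightarrow> ev v (x \<oplus>\<^bsub>M\<^esub> y) = ev v x \<oplus>\<^bsub>M\<^esub> ev v y"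
    and ev_sc: "v \<in> inner_verts G \<Longrightarrow> x \<in> carrier M \<Longrightarrow> ev v (sc c x) = sc c (ev v x)"
    and ev_ev: "v \<in> inner_verts G \<Longrightarrow> w \<in> inner_verts G \<Longrightarrow> x \<in> carrier M \<Longrightarrow>
      ev w (ev v x) = (if v = w then ev v x else \<zero>\<^bsub>M\<^esub>)"
    and ev_complete: "x \<in> carrier M \<Longrightarrow> (\<And>v. v \<in> inner_verts G \<Longrightarrow> ev v x = \<zero>\<^bsub>M\<^esub>) \<Longrightarrow> x = \<zero>\<^bsub>M\<^esub>"
    and ar_closed [simp]: "e \<in> qarcs \<Longrightarrow> x \<in> carrier M \<Longrightarrow> ar e x \<in> carrier M"
    and ar_add: "e \<in> qarcs \<Longrightarrow> x \<in> carrier M \<Longrightarrow> y \<in> carrier M \<Longrightarrow> ar e (x \<oplus>\<^bsub>M\<^esub> y) = ar e x \<oplus>\<^bsub>M\<^esub> ar e y"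
    and ar_sc: "e \<in> qarcs \<Longrightarrow> x \<in> carrier M \<Longrightarrow> ar e (sc c x) = sc c (ar e x)"
    and ar_ev: "e \<in> qarcs \<Longrightarrow> x \<in> carrier M \<Longrightarrow> ar e (ev (qtail e) x) = ar e x"
    and ev_ar: "e \<in> qarcs \<Longrightarrow> x \<in> carrier M \<Longrightarrow> ev (qhead e) (ar e x) = ar e x"
    and ar_ar: "a \<in> qarcs \<Longrightarrow> b \<in> qarcs \<Longrightarrow> x \<in> carrier M \<Longrightarrow> qhead a = qtail b \<Longrightarrow> col a \<noteq> col b \<Longrightarrow>
      ar b (ar a x) = \<zero>\<^bsub>M\<^esub>"
begin

definition vspace :: "'v \<Rightarrow> 'm set" where
  "vspace v = {x \<in> carrier M. ev v x = x}"

lemma ev_zero [simp]: "v \<in> inner_verts G \<Longrightarrow> ev v \<zero>\<^bsub>M\<^esub> = \<zero>\<^bsub>M\<^esub>"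
  using ev_sc[of v "\<zero>\<^bsub>M\<^esub>" 0] by simp

lemma ar_zero [simp]: "e \<in> qarcs \<Longrightarrow> ar e \<zero>\<^bsub>M\<^esub> = \<zero>\<^bsub>M\<^esub>"
  using ar_sc[of e "\<zero>\<^bsub>M\<^esub>" 0] by simp

lemma vspace_carrier: "x \<in> vspace v \<Longrightarrow> x \<in> carrier M"
  by (simp add: vspace_def)

lemma ev_in_vspace: "v \<in> inner_verts G \<Longrightarrow> x \<in> carrier M \<Longrightarrow> ev v x \<in> vspace v"
  by (simp add: vspace_def ev_ev)

lemma ar_in_vspace: "e \<in> qarcs \<Longrightarrow> x \<in> carrier M \<Longrightarrow> ar e x \<in> vspace (qhead e)"
  by (simp add: vspace_def ev_ar)

lemma subsp_vspace: "v \<in> inner_verts G \<Longrightarrow> subsp (vspace v)"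
  by (auto simp: subsp_def vspace_def ev_add ev_sc)

lemma subsp_image_ar: "e \<in> qarcs \<Longrightarrow> subsp S \<Longrightarrow> subsp (ar e ` S)"
  unfolding subsp_def
  by (intro conjI ballI allI; force simp: image_iff subset_iff simp flip: ar_add ar_sc intro: bexI[of _ "\<zero>\<^bsub>M\<^esub>"])

lemma subsp_preimage_ar:
  "e \<in> qarcs \<Longrightarrow> subsp S \<Longrightarrow> subsp {z \<in> vspace (qtail e). ar e z \<in> S}"
  using subsp_vspace[of "qtail e"] qarcs_ends(1)[of e]
  by (auto simp: subsp_def ar_add ar_sc subset_iff)

lemma functional_ev: "functional \<xi> \<Longrightarrow> v \<in> inner_verts G \<Longrightarrow> functional (\<lambda>z. \<xi> (ev v z))"
  by (simp add: functional_def ev_add ev_sc)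

lemma functional_ar: "functional \<xi> \<Longrightarrow> e \<in> qarcs \<Longrightarrow> functional (\<lambda>z. \<xi> (ar e z))"
  by (simp add: functional_def ar_add ar_sc)

text \<open>If no arc is exempt, the vectors \<open>x\<close> span a submodule isomorphic to a string module, and the
  common kernel of the functionals \<open>\<xi>\<close> is a complement. The induction below constructs such families
  with exempt arcs that end at the start of the walk.\<close>

definition splitting :: "('e \<Rightarrow> bool) \<Rightarrow> 'v \<Rightarrow> 'e list \<Rightarrow> ('v \<Rightarrow> 'm) \<Rightarrow> ('v \<Rightarrow> 'm \<Rightarrow> 'k) \<Rightarrow> bool" where
  "splitting exempt v es x \<xi> \<longleftrightarrow> iwalk v es \<and>
     (\<forall>w. functional (\<xi> w)) \<and>
     (\<forall>w. w \<notin> walk_verts v es \<longrightarrow> x w = \<zero>\<^bsub>M\<^esub> \<and> \<xi> w = (\<lambda>_. 0)) \<and>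
     (\<forall>w \<in> walk_verts v es. x w \<in> vspace w \<and> \<xi> w (x w) = 1 \<and> (\<forall>z \<in> carrier M. \<xi> w (ev w z) = \<xi> w z)) \<and>
     (\<forall>e \<in> qarcs. \<not> exempt e \<longrightarrow>
        ar e (x (qtail e)) = (if e \<in> set es then x (qhead e) else \<zero>\<^bsub>M\<^esub>) \<and>
        (\<forall>z \<in> carrier M. \<xi> (qhead e) (ar e z) = (if e \<in> set es then \<xi> (qtail e) z else 0)))"

lemma functional_zero: "functional (\<lambda>_. 0)"
  by (simp add: functional_def)

text \<open>An outgoing edge of colour \<open>True\<close> is an arrow leaving \<open>v\<close>, so
  it must kill the vector; one of colour \<open>False\<close> is an arrow entering \<open>v\<close>,
  so the functional must kill its image. The incoming edges are exempt.\<close>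

lemma splitting_Nil:
  assumes v: "v \<in> inner_verts G" and \<xi>: "functional \<xi>" and x: "x \<in> vspace v" "\<xi> x = 1"
    and \<xi>ev: "\<And>z. z \<in> carrier M \<Longrightarrow> \<xi> (ev v z) = \<xi> z"
    and x0: "\<And>e. e \<in> qarcs \<Longrightarrow> tail G e = v \<Longrightarrow> col e \<Longrightarrow> ar e x = \<zero>\<^bsub>M\<^esub>"
    and \<xi>0: "\<And>e z. e \<in> qarcs \<Longrightarrow> tail G e = v \<Longrightarrow> \<not> col e \<Longrightarrow> z \<in> carrier M \<Longrightarrow> \<xi> (ar e z) = 0"
  shows "splitting (\<lambda>e. head G e = v) v [] (\<lambda>w. if w = v then x else \<zero>\<^bsub>M\<^esub>) (\<lambda>w. if w = v then \<xi> else (\<lambda>_. 0))"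
  unfolding splitting_def
  using assms functional_zero by (auto simp: qtail_def qhead_def)

text \<open>Prepending \<open>a\<close> ends the exemption of the edges into
  \<open>head G a\<close>. Such an edge other than \<open>a\<close> has the other colour, hence
  meets the arrow \<open>a\<close> there in a zero relation, and this gives the vanishing required.
  The other edge out of \<open>tail G a\<close> is treated by the relation at that vertex.\<close>

lemma splitting_Cons:
  assumes spl: "splitting (\<lambda>e. head G e = head G a) (head G a) es x \<xi>" and a: "a \<in> qarcs"
    and \<xi>0: "functional \<xi>0" and x0: "x0 \<in> vspace (tail G a)" "\<xi>0 x0 = 1"
    and \<xi>0ev: "\<And>z. z \<in> carrier M \<Longrightarrow> \<xi>0 (ev (tail G a) z) = \<xi>0 z"
    and ar1: "col a \<Longrightarrow> x (head G a) = ar a x0" and ar2: "\<not> col a \<Longrightarrow> x0 = ar a (x (head G a))"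
    and \<xi>1: "\<And>z. col a \<Longrightarrow> z \<in> carrier M \<Longrightarrow> \<xi>0 z = \<xi> (head G a) (ar a z)"
    and \<xi>2: "\<And>z. \<not> col a \<Longrightarrow> z \<in> carrier M \<Longrightarrow> \<xi>0 (ar a z) = \<xi> (head G a) z"
  shows "splitting (\<lambda>e. head G e = tail G a) (tail G a) (a # es) (x(tail G a := x0)) (\<xi>(tail G a := \<xi>0))"
proof -
  let ?v = "tail G a" and ?w = "head G a"
  let ?x = "x(?v := x0)" and ?\<xi> = "\<xi>(?v := \<xi>0)"
  have iw: "iwalk ?w es" and lin: "\<And>u. functional (\<xi> u)"
    and out: "\<And>u. u \<notin> walk_verts ?w es \<Longrightarrow> x u = \<zero>\<^bsub>M\<^esub> \<and> \<xi> u = (\<lambda>_. 0)"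
    and on: "\<And>u. u \<in> walk_verts ?w es \<Longrightarrow> x u \<in> vspace u \<and> \<xi> u (x u) = 1 \<and> (\<forall>z \<in> carrier M. \<xi> u (ev u z) = \<xi> u z)"
    and S: "\<And>e. e \<in> qarcs \<Longrightarrow> head G e \<noteq> ?w \<Longrightarrow> ar e (x (qtail e)) = (if e \<in> set es then x (qhead e) else \<zero>\<^bsub>M\<^esub>)"
    and T: "\<And>e z. e \<in> qarcs \<Longrightarrow> head G e \<noteq> ?w \<Longrightarrow> z \<in> carrier M \<Longrightarrow>
      \<xi> (qhead e) (ar e z) = (if e \<in> set es then \<xi> (qtail e) z else 0)"
    using spl by (auto simp: splitting_def)
  have ranks: "rank ?v < rank ?w" using a by (rule rank_qarc)
  \<comment> \<open>The old walk does not meet \<open>?v\<close>, so the updates at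
    \<open>?v\<close> leave its data intact.\<close>
  have v_out: "?v \<notin> walk_verts ?w es" "?v \<noteq> ?w"
    using iwalk_vert[OF iw] ranks by fastforce+
  have iw': "iwalk ?v (a # es)"
    using iw a by (auto simp: qarcs_def)
  have low: "e \<notin> set es" if "rank (tail G e) < rank ?w" for e
    using iwalk_arc[OF iw, of e] that by auto
  have xw: "x ?w \<in> carrier M" using on[of ?w] by (auto intro: vspace_carrier)
  have x0c: "x0 \<in> carrier M" using x0 by (auto intro: vspace_carrier)
  have zero: "\<xi> u \<zero>\<^bsub>M\<^esub> = 0" "\<xi>0 \<zero>\<^bsub>M\<^esub> = 0" for u
    using lin \<xi>0 functionalD(3) by auto
  have main: "ar e (?x (qtail e)) = (if e \<in> set (a # es) then ?x (qhead e) else \<zero>\<^bsub>M\<^esub>) \<and>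
      (\<forall>z \<in> carrier M. ?\<xi> (qhead e) (ar e z) = (if e \<in> set (a # es) then ?\<xi> (qtail e) z else 0))"
    if e: "e \<in> qarcs" "head G e \<noteq> ?v" for e
  proof -
    consider "e = a" | "e \<noteq> a" "head G e = ?w" | "e \<noteq> a" "head G e \<noteq> ?w" "tail G e = ?v"
      | "e \<noteq> a" "head G e \<noteq> ?w" "tail G e \<noteq> ?v" by blast
    then show ?thesis
    proof cases
      case 1
      show ?thesis
      proof (cases "col a")
        case True
        then show ?thesis
          using 1 v_out ar1[OF True, symmetric] \<xi>1[OF True, symmetric] by (simp add: qtail_def qhead_def)
      next
        case False
        then show ?thesis
          using 1 v_out ar2[OF False, symmetric] \<xi>2[OF False] by (simp add: qtail_def qhead_def)
      qed
    next
      case 2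
      then have rk: "rank (tail G e) < rank ?w" using rank_qarc[OF e(1)] by simp
      then have nes: "e \<notin> set (a # es)" using low 2 by auto
      have tl_out: "tail G e \<notin> walk_verts ?w es"
        using iwalk_vert[OF iw, of "tail G e"] rk by auto
      have cols: "col e \<noteq> col a" using in_same_col[OF e(1) a] 2 by auto
      show ?thesis
      proof (cases "col a")
        case True
        then have q: "qtail e = ?w" "qhead e = tail G e" "qtail a = ?v" "qhead a = ?w"
          using cols 2 by (auto simp: qtail_def qhead_def)
        have "ar e (x ?w) = \<zero>\<^bsub>M\<^esub>"
          using ar_ar[OF a e(1) x0c] cols q ar1[OF True] by simp
        \<comment> \<open>Only an edge parallel to \<open>a\<close> involves the new functional; for
          any other tail, the functional is zero because that tail lies below the old walk in
          rank.\<close>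
        moreover have "\<xi>0 (ar e z) = 0" if "tail G e = ?v" "z \<in> carrier M" for z
          using ar_ar[OF e(1) a that(2)] cols q \<xi>1[OF True, of "ar e z"] that e(1) zero by simp
        ultimately show ?thesis
          using nes q v_out out[OF tl_out] by auto
      next
        case False
        then have q: "qtail e = tail G e" "qhead e = ?w" "qtail a = ?w" "qhead a = ?v"
          using cols 2 by (auto simp: qtail_def qhead_def)
        have "ar e x0 = \<zero>\<^bsub>M\<^esub>" if "tail G e = ?v"
          using ar_ar[OF a e(1) xw] cols q ar2[OF False] that by simp
        moreover have "\<xi> ?w (ar e z) = 0" if "z \<in> carrier M" for z
          using ar_ar[OF e(1) a that] cols q \<xi>2[OF False, of "ar e z"] that e(1) zero by simp
        ultimately show ?thesis
          using nes q v_out out[OF tl_out] e(1) by auto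
      qed
    next
      case 3
      then have nes: "e \<notin> set (a # es)" using low[of e] ranks by auto
      have cols: "col e \<noteq> col a" using out_same_col[OF e(1) a] 3 by auto
      show ?thesis
      proof (cases "col a")
        case True
        then have q: "qtail e = head G e" "qhead e = ?v" "qtail a = ?v"
          using cols 3 by (auto simp: qtail_def qhead_def)
        have "\<xi>0 (ar e z) = 0" if "z \<in> carrier M" for z
          using ar_ar[OF e(1) a that] cols q \<xi>1[OF True, of "ar e z"] that e(1) zero by simp
        then show ?thesis
          using nes q S[OF e(1) 3(2)] e(2) by auto
      next
        case False
        then have q: "qtail e = ?v" "qhead e = head G e" "qhead a = ?v"
          using cols 3 by (auto simp: qtail_def qhead_def)
        have "ar e x0 = \<zero>\<^bsub>M\<^esub>"
          using ar_ar[OF a e(1) xw] cols q ar2[OF False] by simp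
        then show ?thesis
          using nes q T[OF e(1) 3(2)] e(2) by auto
      qed
    next
      case 4
      then have "qtail e \<noteq> ?v" "qhead e \<noteq> ?v"
        using e(2) by (auto simp: qtail_def qhead_def)
      then show ?thesis
        using S[OF e(1) 4(2)] T[OF e(1) 4(2)] 4(1) by auto
    qed
  qed
  show ?thesis
    unfolding splitting_def
    using iw' lin \<xi>0 out on x0 \<xi>0ev main v_out by auto
qed

text \<open>Membership in \<open>C\<close> lets the vector be transferred back along an edge: after
  a move by images it is lifted, after a move by preimages it is mapped forward. Vanishing on
  \<open>D\<close> does the same for the functional: it is composed with the arrow in the first case
  and extended from the image of the arrow in the second.\<close>

lemma splitting_exists_from:
  assumes "v \<in> inner_verts G" "subsp C" "subsp D" "D \<subset> C" "C \<subseteq> vspace v"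
  shows "\<exists>es x \<xi>. splitting (\<lambda>e. head G e = v) v es x \<xi> \<and> x v \<in> C \<and> (\<forall>d \<in> D. \<xi> v d = 0)"
  using assms
proof (induction "card (verts G) - rank v" arbitrary: v C D rule: less_induct)
  case less
  note v = less.prems(1) and C = less.prems(2) and D = less.prems(3) and DC = less.prems(4) and CV = less.prems(5)
  have Cc: "C \<subseteq> carrier M" "D \<subseteq> carrier M"
    using C D by (auto simp: subsp_def)
  have IH: "\<exists>es x \<xi>. splitting (\<lambda>e. head G e = head G a) (head G a) es x \<xi> \<and> x (head G a) \<in> C' \<and> (\<forall>d \<in> D'. \<xi> (head G a) d = 0)"
    if "a \<in> qarcs" "tail G a = v" "subsp C'" "subsp D'" "D' \<subset> C'" "C' \<subseteq> vspace (head G a)" for a C' D'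
    using less.hyps[OF _ _ that(3-6)] that(1,2) rank_qarc[of a] rank_le[of "head G a"]
    by (auto simp: qarcs_def)
  define O1 where "O1 = {a \<in> qarcs. tail G a = v \<and> col a}"
  define O2 where "O2 = {a \<in> qarcs. tail G a = v \<and> \<not> col a}"
  \<comment> \<open>The summand \<open>{\<zero>}\<close> covers the case that \<open>O2\<close> is
    empty; otherwise \<open>O2\<close> has a single edge and the union is one image.\<close>
  define I where "I = {\<zero>\<^bsub>M\<^esub>} \<union> (\<Union>a\<in>O2. ar a ` carrier M)"
  have O2_unique: "a = b" if "a \<in> O2" "b \<in> O2" for a b
    using out_same_col[of a b] that by (auto simp: O2_def)
  have O1_unique: "a = b" if "a \<in> O1" "b \<in> O1" for a b
    using out_same_col[of a b] that by (auto simp: O1_def)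
  have I: "subsp I"
  proof (cases "O2 = {}")
    case True
    then show ?thesis by (simp add: I_def subsp_zero)
  next
    case False
    then obtain a where "a \<in> O2" by blast
    then have "O2 = {a}" "a \<in> qarcs" using O2_unique by (auto simp: O2_def)
    then have "I = ar a ` carrier M"
      by (auto simp: I_def image_iff intro!: bexI[of _ "\<zero>\<^bsub>M\<^esub>"])
    moreover have "subsp (carrier M)" by (auto simp: subsp_def)
    ultimately show ?thesis using \<open>a \<in> qarcs\<close> by (simp add: subsp_image_ar)
  qed
  define S where "S = {d \<oplus>\<^bsub>M\<^esub> i | d i. d \<in> D \<and> i \<in> I}"
  have S: "subsp S" unfolding S_def by (rule subsp_sum[OF D I])
  have DS: "D \<subseteq> S" and IS: "I \<subseteq> S"
    using subspD(1,2)[OF D] subspD(1,2)[OF I] unfolding S_def by force+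
  \<comment> \<open>With \<open>K\<close> the kernel of the first outgoing edge (\<open>O1\<close>) and \<open>I\<close> the image of the second (\<open>O2\<close>),
    stop if \<open>C \<inter> K\<close> is not contained in \<open>D + I\<close>. Otherwise one of the edges keeps \<open>C\<close> and \<open>D\<close>
    apart, by images or by preimages: if both fail, \<open>C \<subseteq> D + (C \<inter> K) \<subseteq> D + (C \<inter> I) \<subseteq> D\<close>.\<close>
  show ?case
  proof (cases "\<exists>x\<in>C. x \<notin> S \<and> (\<forall>a\<in>O1. ar a x = \<zero>\<^bsub>M\<^esub>)")
    case True
    then obtain x where x: "x \<in> C" "x \<notin> S" "\<And>a. a \<in> O1 \<Longrightarrow> ar a x = \<zero>\<^bsub>M\<^esub>" by blast
    then obtain \<xi> where \<xi>: "functional \<xi>" "\<And>d. d \<in> S \<Longrightarrow> \<xi> d = 0" "\<xi> x = 1"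
      using separating_functional[OF S, of x] Cc by blast
    \<comment> \<open>\<open>splitting\<close> asks each functional to factor through the projection
      at its vertex, while \<open>\<xi>\<close> is obtained on the whole space.\<close>
    define \<xi>' where "\<xi>' z = \<xi> (ev v z)" for z
    have xv: "x \<in> vspace v" using x CV by auto
    have "splitting (\<lambda>e. head G e = v) v [] (\<lambda>w. if w = v then x else \<zero>\<^bsub>M\<^esub>) (\<lambda>w. if w = v then \<xi>' else (\<lambda>_. 0))"
    proof (rule splitting_Nil[OF v])
      show "functional \<xi>'" unfolding \<xi>'_def using \<xi>(1) v by (rule functional_ev)
      show "\<xi>' x = 1" using xv \<xi>(3) by (simp add: \<xi>'_def vspace_def)
      show "\<xi>' (ev v z) = \<xi>' z" if "z \<in> carrier M" for z
        using that v by (simp add: \<xi>'_def ev_ev)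
      show "ar e x = \<zero>\<^bsub>M\<^esub>" if "e \<in> qarcs" "tail G e = v" "col e" for e
        using that x(3) by (simp add: O1_def)
      show "\<xi>' (ar e z) = 0" if e: "e \<in> qarcs" "tail G e = v" "\<not> col e" "z \<in> carrier M" for e z
      proof -
        have "ar e z \<in> I" using e by (auto simp: I_def O2_def)
        moreover have "ev v (ar e z) = ar e z" using e ev_ar[of e z] by (simp add: qhead_def)
        ultimately show ?thesis using IS \<xi>(2) by (auto simp: \<xi>'_def)
      qed
    qed (rule xv)
    moreover have "\<xi>' d = 0" if "d \<in> D" for d
    proof -
      have "d \<in> vspace v" "d \<in> S" using that DS DC CV by blast+
      then show ?thesis using \<xi>(2) by (simp add: \<xi>'_def vspace_def)
    qed
    ultimately show ?thesis
      using x(1) by (intro exI[of _ "[]"] exI[of _ "\<lambda>w. if w = v then x else \<zero>\<^bsub>M\<^esub>"]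
          exI[of _ "\<lambda>w. if w = v then \<xi>' else (\<lambda>_. 0)"]) auto
  next
    case A: False
    show ?thesis
    proof (cases "\<exists>a\<in>O1. ar a ` D \<noteq> ar a ` C")
      case True
      then obtain a where a: "a \<in> qarcs" "tail G a = v" "col a" and ne: "ar a ` D \<noteq> ar a ` C"
        unfolding O1_def by blast
      have q: "qtail a = v" "qhead a = head G a" using a by (auto simp: qtail_def qhead_def)
      have "ar a ` D \<subset> ar a ` C" using ne DC by blast
      moreover have "ar a ` C \<subseteq> vspace (head G a)"
        using ar_in_vspace[OF a(1)] Cc q by auto
      ultimately obtain es x \<xi> where spl: "splitting (\<lambda>e. head G e = head G a) (head G a) es x \<xi>"
        and x: "x (head G a) \<in> ar a ` C" and \<xi>: "\<forall>d \<in> ar a ` D. \<xi> (head G a) d = 0"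
        using IH[OF a(1,2) subsp_image_ar[OF a(1) C] subsp_image_ar[OF a(1) D]] by blast
      obtain x0 where x0: "x0 \<in> C" "x (head G a) = ar a x0" using x by blast
      define \<xi>0 where "\<xi>0 z = \<xi> (head G a) (ar a z)" for z
      have "splitting (\<lambda>e. head G e = tail G a) (tail G a) (a # es) (x(tail G a := x0)) (\<xi>(tail G a := \<xi>0))"
      proof (rule splitting_Cons[OF spl a(1)])
        have "functional (\<xi> (head G a))" using spl by (simp add: splitting_def)
        then show "functional \<xi>0" unfolding \<xi>0_def using a(1) by (rule functional_ar)
        show "x0 \<in> vspace (tail G a)" using x0 CV a by auto
        have "\<xi> (head G a) (x (head G a)) = 1" using spl by (auto simp: splitting_def)
        then show "\<xi>0 x0 = 1" using x0(2) by (simp add: \<xi>0_def)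
        show "\<xi>0 (ev (tail G a) z) = \<xi>0 z" if "z \<in> carrier M" for z
          using ar_ev[OF a(1) that] q a by (simp add: \<xi>0_def)
      qed (use a x0 in \<open>auto simp: \<xi>0_def\<close>)
      moreover have "\<forall>d \<in> D. \<xi>0 d = 0" using \<xi> by (simp add: \<xi>0_def)
      ultimately show ?thesis
        using x0(1) a(2) by (intro exI[of _ "a # es"] exI[of _ "x(tail G a := x0)"] exI[of _ "\<xi>(tail G a := \<xi>0)"]) auto
    next
      case B: False
      obtain y where y: "y \<in> C" "y \<notin> D" using DC by blast
      \<comment> \<open>Along the edge in \<open>O1\<close>, if there is one, \<open>C\<close> and
        \<open>D\<close> have the same image, so subtracting an element of \<open>D\<close> moves
        \<open>y\<close> into the kernel.\<close>
      have "\<exists>d\<in>D. \<forall>a\<in>O1. ar a (y \<ominus>\<^bsub>M\<^esub> d) = \<zero>\<^bsub>M\<^esub>"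
      proof (cases "O1 = {}")
        case True
        then show ?thesis using subspD(2)[OF D] by blast
      next
        case False
        then obtain a where a: "a \<in> O1" by blast
        then have O1: "O1 = {a}" "a \<in> qarcs" using O1_unique by (auto simp: O1_def)
        have "ar a y \<in> ar a ` D" using B a y(1) by blast
        then obtain d where d: "d \<in> D" "ar a y = ar a d" by blast
        then have c: "y \<in> carrier M" "d \<in> carrier M" using y Cc by auto
        have "ar a (y \<ominus>\<^bsub>M\<^esub> d) = ar a (y \<oplus>\<^bsub>M\<^esub> sc (-1) d)"
          using c by (simp add: a_minus_def sc_minus_one)
        also have "\<dots> = ar a y \<oplus>\<^bsub>M\<^esub> sc (-1) (ar a d)"
          using O1(2) c by (simp add: ar_add ar_sc)
        also have "\<dots> = \<zero>\<^bsub>M\<^esub>"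
          using O1(2) c d(2) by (simp add: sc_minus_one M.r_neg)
        finally show ?thesis using O1 d(1) by auto
      qed
      then obtain d where d: "d \<in> D" "\<And>a. a \<in> O1 \<Longrightarrow> ar a (y \<ominus>\<^bsub>M\<^esub> d) = \<zero>\<^bsub>M\<^esub>" by blast
      have "y \<ominus>\<^bsub>M\<^esub> d \<in> C" using y d DC subspD(6)[OF C] by blast
      then have "y \<ominus>\<^bsub>M\<^esub> d \<in> S" using A d(2) by blast
      then obtain d' i where di: "y \<ominus>\<^bsub>M\<^esub> d = d' \<oplus>\<^bsub>M\<^esub> i" "d' \<in> D" "i \<in> I" unfolding S_def by blast
      have cs: "y \<in> carrier M" "d \<in> carrier M" "d' \<in> carrier M" "i \<in> carrier M"
        using y d di Cc subspD(1)[OF I] by auto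
      have y_eq: "y = (d' \<oplus>\<^bsub>M\<^esub> d) \<oplus>\<^bsub>M\<^esub> i"
      proof -
        have "y = (y \<ominus>\<^bsub>M\<^esub> d) \<oplus>\<^bsub>M\<^esub> d"
          using cs by (simp add: a_minus_def M.a_assoc M.l_neg)
        also have "\<dots> = (d' \<oplus>\<^bsub>M\<^esub> d) \<oplus>\<^bsub>M\<^esub> i"
          using cs by (simp add: di(1) M.a_ac)
        finally show ?thesis .
      qed
      have dd: "d' \<oplus>\<^bsub>M\<^esub> d \<in> D" using subspD(3)[OF D di(2) d(1)] .
      \<comment> \<open>The two failures meet here: \<open>i\<close> comes from the image
        \<open>I\<close> and lies in \<open>C\<close> but not in \<open>D\<close>, so it will
        distinguish the preimages of \<open>C\<close> and \<open>D\<close>.\<close>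
      have iD: "i \<notin> D" using y_eq y(2) dd subspD(3)[OF D] by auto
      have iC: "i \<in> C"
      proof -
        have "i = y \<ominus>\<^bsub>M\<^esub> (d' \<oplus>\<^bsub>M\<^esub> d)"
        proof -
          have "y \<ominus>\<^bsub>M\<^esub> (d' \<oplus>\<^bsub>M\<^esub> d) = i \<oplus>\<^bsub>M\<^esub> ((d' \<oplus>\<^bsub>M\<^esub> d) \<ominus>\<^bsub>M\<^esub> (d' \<oplus>\<^bsub>M\<^esub> d))"
            unfolding y_eq[symmetric] a_minus_def using cs by (subst y_eq) (simp add: M.a_ac)
          then show ?thesis using cs by (simp add: a_minus_def M.r_neg)
        qed
        then show ?thesis using y(1) dd DC subspD(6)[OF C] by auto
      qed
      have "i \<noteq> \<zero>\<^bsub>M\<^esub>" using iD subspD(2)[OF D] by auto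
      then obtain a z where a: "a \<in> qarcs" "tail G a = v" "\<not> col a" and z: "z \<in> carrier M" "i = ar a z"
        using di(3) by (auto simp: I_def O2_def)
      have q: "qtail a = head G a" "qhead a = v" using a by (auto simp: qtail_def qhead_def)
      have w: "head G a \<in> inner_verts G" using a by (simp add: qarcs_def)
      let ?C = "{z \<in> vspace (qtail a). ar a z \<in> C}" and ?D = "{z \<in> vspace (qtail a). ar a z \<in> D}"
      \<comment> \<open>\<open>z\<close> is taken from the whole module; its component at the tail
        of the arrow has the same image and lies in the space where the preimages are
        formed.\<close>
      have "ev (head G a) z \<in> ?C - ?D"
        using z iC iD ev_in_vspace[OF w z(1)] ar_ev[OF a(1) z(1)] q by auto
      then have "?D \<subset> ?C" using DC by blast
      moreover have "?C \<subseteq> vspace (head G a)" unfolding q(1) by blast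
      ultimately obtain es x \<xi> where spl: "splitting (\<lambda>e. head G e = head G a) (head G a) es x \<xi>"
        and x: "x (head G a) \<in> ?C" and \<xi>: "\<forall>d \<in> ?D. \<xi> (head G a) d = 0"
        using IH[OF a(1,2) subsp_preimage_ar[OF a(1) C] subsp_preimage_ar[OF a(1) D]] 
        by (auto simp del: mem_Collect_eq split del: if_split)
      let ?\<xi> = "\<xi> (head G a)" and ?x = "x (head G a)"
      have fw: "functional ?\<xi>" "?\<xi> ?x = 1" "\<And>z. z \<in> carrier M \<Longrightarrow> ?\<xi> (ev (head G a) z) = ?\<xi> z"
        using spl by (auto simp: splitting_def)
      have xc: "?x \<in> carrier M" "?x \<in> vspace (head G a)" using x q by (auto intro: vspace_carrier)
      \<comment> \<open>The new functional is to satisfy \<open>\<xi>0 (ar a z) = ?\<xi> z\<close>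
        and to kill \<open>D\<close>, so it must kill \<open>H\<close>. The vector
        \<open>ar a ?x\<close> stays outside \<open>H\<close>: from
        \<open>ar a ?x = d + ar a n\<close> it would follow that \<open>?x - n\<close> lies in the
        preimage of \<open>D\<close>, where \<open>?\<xi>\<close> vanishes, but its value is
        1.\<close>
      define N where "N = {z \<in> vspace (head G a). ?\<xi> z = 0}"
      have N: "subsp N"
        using subsp_vspace[OF w] functionalD(1-3)[OF fw(1)] unfolding subsp_def N_def
        by (auto simp: subset_iff)
      have aN: "subsp (ar a ` N)" by (rule subsp_image_ar[OF a(1) N])
      define H where "H = {d \<oplus>\<^bsub>M\<^esub> i | d i. d \<in> D \<and> i \<in> ar a ` N}"
      have H: "subsp H" unfolding H_def by (rule subsp_sum[OF D aN])
      have DH: "D \<subseteq> H" and NH: "ar a ` N \<subseteq> H"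
        using subspD(1,2)[OF D] subspD(1,2)[OF aN] unfolding H_def by force+
      have notH: "ar a ?x \<notin> H"
      proof
        assume "ar a ?x \<in> H"
        then obtain d n where dn: "ar a ?x = d \<oplus>\<^bsub>M\<^esub> ar a n" "d \<in> D" "n \<in> N" unfolding H_def by blast
        have n: "n \<in> carrier M" "n \<in> vspace (head G a)" "?\<xi> n = 0"
          using dn(3) by (auto simp: N_def intro: vspace_carrier)
        have dc: "d \<in> carrier M" using dn Cc by auto
        let ?y = "?x \<oplus>\<^bsub>M\<^esub> sc (-1) n"
        have "ar a ?y = ar a ?x \<oplus>\<^bsub>M\<^esub> sc (-1) (ar a n)"
          using a(1) n xc by (simp add: ar_add ar_sc)
        also have "\<dots> = d"
          using a(1) n dc by (simp add: dn(1) sc_minus_one M.a_assoc M.r_neg)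
        finally have "ar a ?y = d" .
        moreover have "?y \<in> vspace (head G a)"
          using n xc subspD(3,4)[OF subsp_vspace[OF w]] by blast
        ultimately have "?\<xi> ?y = 0" using \<xi> dn(2) q by auto
        moreover have "?\<xi> ?y = 1"
          using n xc functionalD(1,2)[OF fw(1)] fw(2) by simp
        ultimately show False by simp
      qed
      then obtain \<zeta> where \<zeta>: "functional \<zeta>" "\<And>d. d \<in> H \<Longrightarrow> \<zeta> d = 0" "\<zeta> (ar a ?x) = 1"
        using separating_functional[OF H, of "ar a ?x"] a(1) xc by auto
      define \<xi>0 where "\<xi>0 z = \<zeta> (ev v z)" for z
      have "splitting (\<lambda>e. head G e = tail G a) (tail G a) (a # es) (x(tail G a := ar a ?x)) (\<xi>(tail G a := \<xi>0))"
      proof (rule splitting_Cons[OF spl a(1)])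
        show "functional \<xi>0" unfolding \<xi>0_def using \<zeta>(1) v by (rule functional_ev)
        show "ar a ?x \<in> vspace (tail G a)" using ar_in_vspace[OF a(1) xc(1)] q a(2) by simp
        show "\<xi>0 (ar a ?x) = 1" using ev_ar[OF a(1) xc(1)] \<zeta>(3) q by (simp add: \<xi>0_def)
        show "\<xi>0 (ev (tail G a) z) = \<xi>0 z" if "z \<in> carrier M" for z
          using that v a(2) by (simp add: \<xi>0_def ev_ev)
        show "\<xi>0 (ar a z) = ?\<xi> z" if z: "z \<in> carrier M" for z
        proof -
          let ?z = "ev (head G a) z"
          \<comment> \<open>Subtracting the right multiple of \<open>?x\<close> moves
            \<open>?z\<close> into \<open>N\<close>, whose image is killed by
            \<open>\<zeta>\<close>.\<close>
          let ?n = "?z \<oplus>\<^bsub>M\<^esub> sc (- ?\<xi> z) ?x"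
          have zc: "?z \<in> carrier M" "?z \<in> vspace (head G a)" using z w by (auto intro: ev_in_vspace)
          have "?n \<in> vspace (head G a)"
            using zc xc subspD(3,4)[OF subsp_vspace[OF w]] by blast
          moreover have "?\<xi> ?n = 0"
            using zc xc z functionalD(1,2)[OF fw(1)] fw(2,3) by simp
          ultimately have "?n \<in> N" by (simp add: N_def)
          then have "\<zeta> (ar a ?n) = 0" using NH \<zeta>(2) by blast
          moreover have "ar a ?n = ar a z \<oplus>\<^bsub>M\<^esub> sc (- ?\<xi> z) (ar a ?x)"
            using a(1) zc xc ar_ev[OF a(1) z] q by (simp add: ar_add ar_sc)
          moreover have "\<zeta> (ar a z \<oplus>\<^bsub>M\<^esub> sc (- ?\<xi> z) (ar a ?x)) = \<zeta> (ar a z) - ?\<xi> z"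
            using a(1) z xc functionalD(1,2)[OF \<zeta>(1)] \<zeta>(3) by simp
          moreover have "ev v (ar a z) = ar a z" using ev_ar[OF a(1) z] q by simp
          ultimately show ?thesis by (simp add: \<xi>0_def)
        qed
      qed (use a in auto)
      moreover have "\<forall>d \<in> D. \<xi>0 d = 0"
      proof
        fix d assume "d \<in> D"
        then have "d \<in> vspace v" "d \<in> H" using DH DC CV by blast+
        then show "\<xi>0 d = 0" using \<zeta>(2) by (simp add: \<xi>0_def vspace_def)
      qed
      ultimately show ?thesis
        using x a(2) by (intro exI[of _ "a # es"] exI[of _ "x(tail G a := ar a ?x)"] exI[of _ "\<xi>(tail G a := \<xi>0)"]) auto
    qed
  qed
qed

text \<open>The exempt edges end at \<open>v\<close>, so their tails have smaller rank. With
  \<open>v\<close> of least rank in the support, the spaces at those tails are zero and the missing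
  conditions hold trivially.\<close>

theorem splitting_exists:
  assumes "carrier M \<noteq> {\<zero>\<^bsub>M\<^esub>}"
  obtains v es x \<xi> where "splitting (\<lambda>_. False) v es x \<xi>"
proof -
  let ?P = "\<lambda>v. v \<in> inner_verts G \<and> vspace v \<noteq> {\<zero>\<^bsub>M\<^esub>}"
  obtain y where y: "y \<in> carrier M" "y \<noteq> \<zero>\<^bsub>M\<^esub>" using assms by blast
  then obtain u where "u \<in> inner_verts G" "ev u y \<noteq> \<zero>\<^bsub>M\<^esub>" using ev_complete by blast
  then have "?P u" using ev_in_vspace y(1) by blast
  then obtain v where v: "?P v" and min: "\<And>w. ?P w \<Longrightarrow> rank v \<le> rank w"
    using ex_has_least_nat[of ?P u rank] by blast
  have null: "vspace w = {\<zero>\<^bsub>M\<^esub>}" if "w \<in> inner_verts G" "rank w < rank v" for w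
    using that min[of w] by auto
  have "{\<zero>\<^bsub>M\<^esub>} \<subset> vspace v"
    using v subspD(2)[OF subsp_vspace[of v]] by blast
  then obtain es x \<xi> where spl: "splitting (\<lambda>e. head G e = v) v es x \<xi>"
    using splitting_exists_from[of v "vspace v" "{\<zero>\<^bsub>M\<^esub>}"] v subsp_vspace subsp_zero by blast
  have iw: "iwalk v es" and lin: "\<And>w. functional (\<xi> w)"
    and off: "\<And>w. w \<notin> walk_verts v es \<Longrightarrow> x w = \<zero>\<^bsub>M\<^esub> \<and> \<xi> w = (\<lambda>_. 0)"
    and xv: "x v \<in> vspace v"
    using spl by (auto simp: splitting_def)
  have "ar e (x (qtail e)) = (if e \<in> set es then x (qhead e) else \<zero>\<^bsub>M\<^esub>) \<and>
      (\<forall>z \<in> carrier M. \<xi> (qhead e) (ar e z) = (if e \<in> set es then \<xi> (qtail e) z else 0))"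
    if e: "e \<in> qarcs" "head G e = v" for e
  proof -
    have rk: "rank (tail G e) < rank v" using rank_qarc[OF e(1)] e(2) by simp
    have t: "tail G e \<in> inner_verts G" using e by (simp add: qarcs_def)
    have nes: "e \<notin> set es" using iwalk_arc[OF iw, of e] rk by auto
    have "tail G e \<notin> walk_verts v es" using iwalk_vert[OF iw, of "tail G e"] rk by auto
    note o = off[OF this]
    show ?thesis
    proof (cases "col e")
      case True
      then have q: "qtail e = tail G e" "qhead e = v" using e by (auto simp: qtail_def qhead_def)
      have "ar e z = \<zero>\<^bsub>M\<^esub>" if "z \<in> carrier M" for z
        using ar_ev[OF e(1) that] ev_in_vspace[OF t that] null[OF t rk] e(1) q by simp
      then show ?thesis using o q nes e(1) functionalD(3)[OF lin] by simp
    next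
      case False
      then have q: "qtail e = v" "qhead e = tail G e" using e by (auto simp: qtail_def qhead_def)
      then have "ar e (x v) = \<zero>\<^bsub>M\<^esub>"
        using ar_in_vspace[OF e(1) vspace_carrier[OF xv]] null[OF t rk] by simp
      then show ?thesis using o q nes by simp
    qed
  qed
  then have "splitting (\<lambda>_. False) v es x \<xi>"
    using spl unfolding splitting_def by blast
  then show ?thesis by (rule that)
qed

end

section \<open>Path algebras and string representations\<close>

lemma path_algebra_carrier:
  "f \<in> carrier (path_algebra Q) \<longleftrightarrow> finite {x. f x \<noteq> 0} \<and> {x. f x \<noteq> 0} \<subseteq> qpaths Q"
  by (simp add: path_algebra_def)

lemma path_algebra_add: "f \<oplus>\<^bsub>path_algebra Q\<^esub> g = (\<lambda>x. f x + g x)"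
  by (simp add: path_algebra_def)

lemma path_algebra_zero: "\<zero>\<^bsub>path_algebra Q\<^esub> = (\<lambda>_. 0)"
  by (simp add: path_algebra_def)

lemma path_algebra_one: "\<one>\<^bsub>path_algebra Q\<^esub> = (\<lambda>(u, r). if u \<in> verts Q \<and> r = [] then 1 else 0)"
  by (simp add: path_algebra_def)

lemma path_algebra_mult_apply:
  "(f \<otimes>\<^bsub>path_algebra Q\<^esub> g) (u, r) =
     (\<Sum>i\<le>length r. f (u, take i r) * g (pre_digraph.awlast Q u (take i r), drop i r))"
  by (simp add: path_algebra_def)

lemma path_algebra_mult_distrib:
  "(\<lambda>x. f x + c * f' x) \<otimes>\<^bsub>path_algebra Q\<^esub> g =
     (\<lambda>x. (f \<otimes>\<^bsub>path_algebra Q\<^esub> g) x + c * (f' \<otimes>\<^bsub>path_algebra Q\<^esub> g) x)"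
  "g \<otimes>\<^bsub>path_algebra Q\<^esub> (\<lambda>x. f x + c * f' x) =
     (\<lambda>x. (g \<otimes>\<^bsub>path_algebra Q\<^esub> f) x + c * (g \<otimes>\<^bsub>path_algebra Q\<^esub> f') x)"
  by (auto simp: fun_eq_iff path_algebra_mult_apply sum.distrib sum_distrib_left algebra_simps)

lemma path_elem_mult:
  "path_elem (u, p) \<otimes>\<^bsub>path_algebra Q\<^esub> path_elem (w, q) =
     (if pre_digraph.awlast Q u p = w then path_elem (u, p @ q) else (\<lambda>_. 0 :: 'k::field))"
proof
  fix x :: "('a, 'b) qpath"
  obtain u' r where x: "x = (u', r)" by force
  let ?ok = "u' = u \<and> r = p @ q \<and> pre_digraph.awlast Q u p = w"
  have "(path_elem (u, p) \<otimes>\<^bsub>path_algebra Q\<^esub> path_elem (w, q)) x =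
      (\<Sum>i\<le>length r. if i = length p then (if ?ok then 1 else 0) else 0 :: 'k)"
    unfolding x path_algebra_mult_apply
  proof (rule sum.cong[OF refl])
    fix i assume "i \<in> {..length r}"
    then have i: "i \<le> length r" by simp
    have "u' = u \<and> take i r = p \<and> pre_digraph.awlast Q u' (take i r) = w \<and> drop i r = q \<longleftrightarrow> i = length p \<and> ?ok"
      using i by (metis append_take_drop_id append_eq_conv_conj length_take min.absorb2)
    moreover have "path_elem (u, p) (u', take i r) * path_elem (w, q) (pre_digraph.awlast Q u' (take i r), drop i r) =
        (if u' = u \<and> take i r = p \<and> pre_digraph.awlast Q u' (take i r) = w \<and> drop i r = q then 1 else (0 :: 'k))"
      by (auto simp: path_elem_def)
    ultimately show "path_elem (u, p) (u', take i r) * path_elem (w, q) (pre_digraph.awlast Q u' (take i r), drop i r) =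
        (if i = length p then (if ?ok then 1 else 0) else (0 :: 'k))"
      by presburger
  qed
  also have "\<dots> = (if ?ok then 1 else 0)"
    by auto
  finally show "(path_elem (u, p) \<otimes>\<^bsub>path_algebra Q\<^esub> path_elem (w, q)) x =
      (if pre_digraph.awlast Q u p = w then path_elem (u, p @ q) else (\<lambda>_. 0 :: 'k)) x"
    by (auto simp: x path_elem_def)
qed

lemma path_algebra_induct [consumes 1, case_names zero add]:
  assumes "f \<in> carrier (path_algebra Q :: (('v,'e) qpath \<Rightarrow> 'k::field) ring)"
    and zero: "P (\<lambda>_. 0)"
    and add: "\<And>f c y. f \<in> carrier (path_algebra Q :: (('v,'e) qpath \<Rightarrow> 'k) ring) \<Longrightarrow> y \<in> qpaths Q \<Longrightarrow> P f \<Longrightarrow>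
      P (\<lambda>x. f x + c * path_elem y x)"
  shows "P f"
proof -
  have "finite S \<Longrightarrow> S \<subseteq> qpaths Q \<Longrightarrow> {x. f x \<noteq> 0} \<subseteq> S \<Longrightarrow> P f" for S f
  proof (induction S arbitrary: f rule: finite_induct)
    case empty
    then have "f = (\<lambda>_. 0)" by auto
    then show ?case using zero by simp
  next
    case (insert y S)
    let ?f = "f(y := 0)"
    have sup: "{x. ?f x \<noteq> 0} \<subseteq> S" using insert.prems by auto
    have "P ?f" by (rule insert.IH) (use sup insert.prems in auto)
    moreover have "?f \<in> carrier (path_algebra Q)"
      using sup insert.hyps insert.prems by (auto simp: path_algebra_carrier intro: finite_subset)
    ultimately have "P (\<lambda>x. ?f x + f y * path_elem y x)"
      using add[of ?f y "f y"] insert.prems by (simp del: fun_upd_apply)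
    moreover have "(\<lambda>x. ?f x + f y * path_elem y x) = f"
      by (auto simp: path_elem_def)
    ultimately show ?case by simp
  qed
  then show ?thesis using assms(1) by (auto simp: path_algebra_carrier)
qed

lemma path_algebra_scale_closed:
  assumes "f \<in> carrier (path_algebra Q :: (('v,'e) qpath \<Rightarrow> 'k::field) ring)"
  shows "(\<lambda>x. c * f x) \<in> carrier (path_algebra Q)"
  using assms by (auto simp: path_algebra_carrier elim!: finite_subset[rotated])

lemma path_algebra_scalar_mult:
  assumes "wf_digraph Q" "finite (verts Q)" "f \<in> carrier (path_algebra Q :: (('v,'e) qpath \<Rightarrow> 'k::field) ring)"
  shows "(\<lambda>x. c * \<one>\<^bsub>path_algebra Q\<^esub> x) \<otimes>\<^bsub>path_algebra Q\<^esub> f = (\<lambda>x. c * f x)"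
proof -
  interpret ring "path_algebra Q :: (('v,'e) qpath \<Rightarrow> 'k) ring"
    using assms by (intro path_algebra_ring)
  have "(\<lambda>x. c * \<one>\<^bsub>path_algebra Q\<^esub> x) \<otimes>\<^bsub>path_algebra Q\<^esub> f = (\<lambda>x. c * (\<one>\<^bsub>path_algebra Q\<^esub> \<otimes>\<^bsub>path_algebra Q\<^esub> f) x)"
    by (auto simp: fun_eq_iff path_algebra_mult_apply sum_distrib_left algebra_simps)
  then show ?thesis using assms(3) by simp
qed

lemma qpaths_Nil_iff: "wf_digraph Q \<Longrightarrow> (u, []) \<in> qpaths Q \<longleftrightarrow> u \<in> verts Q"
  by (auto simp: qpaths_def wf_digraph.awalk_Nil_iff)

lemma qpaths_Cons_iff:
  "wf_digraph Q \<Longrightarrow> (u, e # p) \<in> qpaths Q \<longleftrightarrow> e \<in> arcs Q \<and> u = tail Q e \<and> (head Q e, p) \<in> qpaths Q"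
  by (auto simp: qpaths_def wf_digraph.awalk_Cons_iff)

text \<open>Reduces closure arguments, such as compatibility of a map with the whole algebra, to
  scalars, trivial paths and arrows: a path is the product of its arrows.\<close>

lemma path_algebra_generated:
  assumes wf: "wf_digraph Q" "finite (verts Q)"
    and f: "f \<in> carrier (path_algebra Q :: (('v,'e) qpath \<Rightarrow> 'k::field) ring)"
    and add: "\<And>f g. f \<in> carrier (path_algebra Q) \<Longrightarrow> g \<in> carrier (path_algebra Q) \<Longrightarrow> P f \<Longrightarrow> P g \<Longrightarrow>
      P (f \<oplus>\<^bsub>path_algebra Q\<^esub> g)"
    and mult: "\<And>f g. f \<in> carrier (path_algebra Q) \<Longrightarrow> g \<in> carrier (path_algebra Q) \<Longrightarrow> P f \<Longrightarrow> P g \<Longrightarrow>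
      P (f \<otimes>\<^bsub>path_algebra Q\<^esub> g)"
    and scalar: "\<And>c. P (\<lambda>x. c * \<one>\<^bsub>path_algebra Q\<^esub> x)"
    and vert: "\<And>v. v \<in> verts Q \<Longrightarrow> P (path_elem (v, []))"
    and arc: "\<And>e. e \<in> arcs Q \<Longrightarrow> P (path_elem (tail Q e, [e]))"
  shows "P f"
proof -
  interpret wf_digraph Q by fact
  have path: "P (path_elem (u, p))" if "(u, p) \<in> qpaths Q" for u p
    using that
  proof (induction p arbitrary: u)
    case Nil
    then show ?case using vert by (simp add: qpaths_Nil_iff[OF wf(1)])
  next
    case (Cons e p)
    then have e: "e \<in> arcs Q" "u = tail Q e" "(head Q e, p) \<in> qpaths Q"
      by (auto simp: qpaths_Cons_iff[OF wf(1)])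
    have "path_elem (u, e # p) = path_elem (u, [e]) \<otimes>\<^bsub>path_algebra Q\<^esub> (path_elem (head Q e, p) :: _ \<Rightarrow> 'k)"
      by (simp add: path_elem_mult)
    moreover have "(u, [e]) \<in> qpaths Q"
      using e by (simp add: qpaths_Cons_iff[OF wf(1)] qpaths_Nil_iff[OF wf(1)])
    ultimately show ?case
      using e mult[OF path_elem_closed path_elem_closed, of "(u, [e])" "(head Q e, p)"] arc Cons.IH by simp
  qed
  from f show ?thesis
  proof (induction rule: path_algebra_induct)
    case zero
    show ?case using scalar[of 0] by simp
  next
    case (add f c y)
    let ?c = "\<lambda>x. c * \<one>\<^bsub>path_algebra Q\<^esub> x"
    have pe: "path_elem y \<in> carrier (path_algebra Q :: (('v,'e) qpath \<Rightarrow> 'k) ring)"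
      using add by (intro path_elem_closed)
    have c: "?c \<in> carrier (path_algebra Q :: (('v,'e) qpath \<Rightarrow> 'k) ring)"
      by (intro path_algebra_scale_closed path_algebra_one_closed wf)
    have "P (f \<oplus>\<^bsub>path_algebra Q\<^esub> (?c \<otimes>\<^bsub>path_algebra Q\<^esub> path_elem y))"
      using add pe c path[of "fst y" "snd y"] scalar by (intro assms(4) mult path_algebra_mult_closed) auto
    then show ?case
      by (simp add: path_algebra_add path_algebra_scalar_mult[OF wf pe])
  qed
qed

text \<open>One-dimensional spaces at the vertices in \<open>V\<close>, identity maps along the
  arrows in \<open>E\<close>, zero elsewhere. The basis vector of \<open>v\<close> is the coordinate
  \<open>s v\<close> because the modules to be classified have sequences as elements. The relations
  do not enter yet.\<close>

locale string_data = fin_digraph Q for Q :: "('v,'e) pre_digraph" +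
  fixes s :: "'v \<Rightarrow> nat" and V :: "'v set" and E :: "'e set"
  assumes s_inj: "inj_on s (verts Q)" and V: "V \<subseteq> verts Q" and E: "E \<subseteq> arcs Q"
    and E_ends: "e \<in> E \<Longrightarrow> tail Q e \<in> V" "e \<in> E \<Longrightarrow> head Q e \<in> V"
begin

definition string_space :: "(nat \<Rightarrow> 'k::field) set" where
  "string_space = {x. \<forall>n. x n \<noteq> 0 \<longrightarrow> n \<in> s ` V}"

definition vert_op :: "'v \<Rightarrow> (nat \<Rightarrow> 'k::field) \<Rightarrow> nat \<Rightarrow> 'k" where
  "vert_op v x = (\<lambda>n. if v \<in> V \<and> n = s v then x n else 0)"

definition arc_op :: "'e \<Rightarrow> (nat \<Rightarrow> 'k::field) \<Rightarrow> nat \<Rightarrow> 'k" where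
  "arc_op e x = (\<lambda>n. if e \<in> E \<and> n = s (head Q e) then x (s (tail Q e)) else 0)"

text \<open>The vertex argument matters only for the empty path. After an arrow, the final
  \<open>vert_op\<close> at its head changes nothing, since the image is supported there.\<close>

primrec path_op :: "'e list \<Rightarrow> 'v \<Rightarrow> (nat \<Rightarrow> 'k::field) \<Rightarrow> nat \<Rightarrow> 'k" where
  "path_op [] u x = vert_op u x"
| "path_op (e # p) u x = path_op p (head Q e) (arc_op e x)"

definition act :: "(('v,'e) qpath \<Rightarrow> 'k::field) \<Rightarrow> (nat \<Rightarrow> 'k) \<Rightarrow> nat \<Rightarrow> 'k" where
  "act f x = (\<lambda>n. \<Sum>y | f y \<noteq> 0. f y * path_op (snd y) (fst y) x n)"

lemma s_eq: "u \<in> verts Q \<Longrightarrow> v \<in> verts Q \<Longrightarrow> s u = s v \<longleftrightarrow> u = v"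
  using s_inj by (auto simp: inj_on_def)

lemma path_op_add: "path_op p u (\<lambda>n. x n + y n) = (\<lambda>n. path_op p u x n + path_op p u y n)"
proof (induction p arbitrary: u x y)
  case (Cons e p)
  have "arc_op e (\<lambda>n. x n + y n) = (\<lambda>n. arc_op e x n + arc_op e y n)"
    by (auto simp: arc_op_def)
  then show ?case using Cons by simp
qed (auto simp: vert_op_def)

lemma path_op_scale: "path_op p u (\<lambda>n. c * x n) = (\<lambda>n. c * path_op p u x n)"
proof (induction p arbitrary: u x)
  case (Cons e p)
  have "arc_op e (\<lambda>n. c * x n) = (\<lambda>n. c * arc_op e x n)"
    by (auto simp: arc_op_def)
  then show ?case using Cons by simp
qed (auto simp: vert_op_def)

lemma path_op_zero: "path_op p u (\<lambda>n. 0) = (\<lambda>n. 0)"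
  using path_op_scale[of p u 0 "\<lambda>n. 0"] by simp

lemma path_op_support: "path_op p u x n \<noteq> 0 \<Longrightarrow> n \<in> s ` V"
proof (induction p arbitrary: u x)
  case (Cons e p)
  then show ?case by simp
qed (auto simp: vert_op_def split: if_splits)

lemma vert_op_path_op: "vert_op (awlast u p) (path_op p u x) = path_op p u x"
proof (induction p arbitrary: u x)
  case Nil
  then show ?case by (auto simp: vert_op_def)
next
  case (Cons e p)
  then show ?case by simp
qed

lemma path_op_vert_op:
  assumes "(w, q) \<in> qpaths Q" "v \<in> verts Q"
  shows "path_op q w (vert_op v x) = (if v = w then path_op q w x else (\<lambda>_. 0))"
proof (cases q)
  case Nil
  then have "w \<in> verts Q" using assms by (simp add: qpaths_Nil_iff wf_digraph_axioms)
  then show ?thesis using Nil assms s_eq[of v w] by (auto simp: vert_op_def)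
next
  case (Cons e q')
  then have e: "e \<in> arcs Q" "w = tail Q e" using assms by (auto simp: qpaths_Cons_iff wf_digraph_axioms)
  then have "arc_op e (vert_op v x) = (if v = w then arc_op e x else (\<lambda>_. 0))"
    using assms(2) s_eq[of v w] E_ends by (auto simp: arc_op_def vert_op_def fun_eq_iff)
  then show ?thesis using Cons by (simp add: path_op_zero)
qed

lemma path_op_append:
  assumes "(u, p @ q) \<in> qpaths Q"
  shows "path_op q (awlast u p) (path_op p u x) = path_op (p @ q) u x"
  using assms
proof (induction p arbitrary: u x)
  case Nil
  then have "u \<in> verts Q" by (cases q) (auto simp: qpaths_Nil_iff qpaths_Cons_iff wf_digraph_axioms)
  then show ?case using Nil by (simp add: path_op_vert_op)
next
  case (Cons e p)
  then show ?case by (simp add: qpaths_Cons_iff wf_digraph_axioms)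
qed

text \<open>The sum in \<open>act\<close> runs over a support that varies with \<open>f\<close>; a
  common finite superset allows comparison term by term.\<close>

lemma act_superset:
  assumes "finite S" "{y. f y \<noteq> 0} \<subseteq> S"
  shows "act f x n = (\<Sum>y\<in>S. f y * path_op (snd y) (fst y) x n)"
  unfolding act_def using assms by (intro sum.mono_neutral_left) auto

lemma act_add_scale:
  assumes "finite {y. f y \<noteq> 0}" "finite {y. g y \<noteq> 0}"
  shows "act (\<lambda>y. f y + c * g y) x = (\<lambda>n. act f x n + c * act g x n)"
proof
  fix n
  let ?S = "{y. f y \<noteq> 0} \<union> {y. g y \<noteq> 0}"
  have "{y. f y + c * g y \<noteq> 0} \<subseteq> ?S" by auto
  then show "act (\<lambda>y. f y + c * g y) x n = act f x n + c * act g x n"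
    using assms by (subst (1 2 3) act_superset[of ?S])
      (auto simp: sum.distrib sum_distrib_left algebra_simps)
qed

lemma act_path_elem: "act (path_elem y) x = path_op (snd y) (fst y) x"
proof
  fix n
  have "act (path_elem y) x n = (\<Sum>z\<in>{y}. path_elem y z * path_op (snd z) (fst z) x n)"
    by (rule act_superset) (auto simp: path_elem_def split: if_splits)
  then show "act (path_elem y) x n = path_op (snd y) (fst y) x n"
    by (simp add: path_elem_def)
qed

lemma act_zero_left: "act (\<lambda>_. 0) x = (\<lambda>_. 0)"
  by (simp add: act_def)

lemma act_plus: "act f (\<lambda>n. x n + y n) = (\<lambda>n. act f x n + act f y n)"
  by (simp add: act_def path_op_add sum.distrib algebra_simps)

lemma act_scale_right: "act f (\<lambda>n. c * x n) = (\<lambda>n. c * act f x n)"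
  by (simp add: act_def path_op_scale sum_distrib_left algebra_simps)

lemma act_closed: "act f x \<in> string_space"
  using path_op_support by (fastforce simp: string_space_def act_def elim: sum.not_neutral_contains_not_neutral)

lemma fin_supp: "f \<in> carrier (path_algebra Q) \<Longrightarrow> finite {y. f y \<noteq> 0}"
  by (simp add: path_algebra_carrier)

text \<open>For paths that do not compose, the first one ends in the space of its last vertex, and
  the second one, starting elsewhere, kills that space.\<close>

lemma act_path_elem_mult:
  assumes "y \<in> qpaths Q" "z \<in> qpaths Q"
  shows "act (path_elem y \<otimes>\<^bsub>path_algebra Q\<^esub> path_elem z) x = path_op (snd z) (fst z) (path_op (snd y) (fst y) x)"
proof -
  obtain u p w q where yz: "y = (u, p)" "z = (w, q)" by force
  show ?thesis
  proof (cases "awlast u p = w")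
    case True
    then have "(u, p @ q) \<in> qpaths Q"
      using qpaths_append[of u p Q q] assms yz by simp
    then show ?thesis using True yz path_op_append[of u p q x] by (simp add: path_elem_mult act_path_elem)
  next
    case False
    have "awlast u p \<in> verts Q"
      using assms(1) yz by (auto simp: qpaths_def)
    then have "path_op q w (vert_op (awlast u p) (path_op p u x)) = (\<lambda>_. 0)"
      using path_op_vert_op[of w q "awlast u p"] assms(2) yz False by simp
    then show ?thesis using False yz by (simp add: path_elem_mult act_zero_left vert_op_path_op)
  qed
qed

text \<open>Both sides are bilinear in \<open>f\<close> and \<open>g\<close>, so two inductions on
  the supports reduce the claim to a pair of paths. The left factor acts first, as required for
  right modules.\<close>

lemma act_mult:
  fixes x :: "nat \<Rightarrow> 'k::field"
  assumes f: "f \<in> carrier (path_algebra Q)" and g: "g \<in> carrier (path_algebra Q)"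
  shows "act (f \<otimes>\<^bsub>path_algebra Q\<^esub> g) x = act g (act f x)"
  using f
proof (induction rule: path_algebra_induct)
  case zero
  have "(\<lambda>_. 0) \<otimes>\<^bsub>path_algebra Q\<^esub> g = (\<lambda>_. 0)"
    by (auto simp: fun_eq_iff path_algebra_mult_apply)
  then show ?case using act_scale_right[of g 0 "\<lambda>_. 0"] by (simp add: act_zero_left)
next
  case (add f c y)
  have y: "path_elem y \<in> carrier (path_algebra Q :: (('v,'e) qpath \<Rightarrow> 'k) ring)"
    using add(2) by (rule path_elem_closed)
  have yg: "act (path_elem y \<otimes>\<^bsub>path_algebra Q\<^esub> g) x = act g (act (path_elem y) x)"
    using g
  proof (induction rule: path_algebra_induct)
    case zero
    have "path_elem y \<otimes>\<^bsub>path_algebra Q\<^esub> (\<lambda>_. 0) = (\<lambda>_. 0 :: 'k)"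
      by (auto simp: fun_eq_iff path_algebra_mult_apply)
    then show ?case by (simp add: act_zero_left)
  next
    case (add g c z)
    have z: "path_elem z \<in> carrier (path_algebra Q :: (('v,'e) qpath \<Rightarrow> 'k) ring)"
    using add(2) by (rule path_elem_closed)
    show ?case
      using fin_supp[OF path_algebra_mult_closed[OF y add(1)]] fin_supp[OF path_algebra_mult_closed[OF y z]]
        fin_supp[OF add(1)] fin_supp[OF z] add.IH act_path_elem_mult[OF \<open>y \<in> qpaths Q\<close> add(2), of x]
      by (simp add: path_algebra_mult_distrib act_add_scale act_path_elem)
  qed
  show ?case
    using fin_supp[OF path_algebra_mult_closed[OF add(1) g]] fin_supp[OF path_algebra_mult_closed[OF y g]]
      fin_supp[OF add(1)] fin_supp[OF y] add.IH yg
    by (simp add: path_algebra_mult_distrib act_add_scale act_plus act_scale_right)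
qed

lemma act_one:
  assumes "x \<in> string_space"
  shows "act (\<lambda>y. c * \<one>\<^bsub>path_algebra Q\<^esub> y) x = (\<lambda>n. c * x n)"
proof
  fix n
  have "act (\<lambda>y. c * \<one>\<^bsub>path_algebra Q\<^esub> y) x n =
      (\<Sum>y\<in>(\<lambda>v. (v, [])) ` verts Q. c * \<one>\<^bsub>path_algebra Q\<^esub> y * path_op (snd y) (fst y) x n)"
    by (rule act_superset) (auto simp: path_algebra_one split: if_splits)
  also have "\<dots> = (\<Sum>v\<in>verts Q. c * vert_op v x n)"
    by (subst sum.reindex) (auto simp: inj_on_def path_algebra_one)
  also have "\<dots> = c * x n"
  proof (cases "n \<in> s ` V")
    case True
    then obtain w where w: "w \<in> V" "n = s w" by blast
    then have "(\<Sum>v\<in>verts Q. c * vert_op v x n) = (\<Sum>v\<in>verts Q. if v = w then c * x n else 0)"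
      using V s_eq by (intro sum.cong) (auto simp: vert_op_def)
    then show ?thesis using w V by auto
  next
    case False
    then have "x n = 0" using assms by (auto simp: string_space_def)
    then show ?thesis by (auto simp: vert_op_def intro!: sum.neutral)
  qed
  finally show "act (\<lambda>y. c * \<one>\<^bsub>path_algebra Q\<^esub> y) x n = c * x n" .
qed

lemma act_arc: "act (path_elem (tail Q e, [e])) x = arc_op e x"
  using E_ends by (auto simp: act_path_elem vert_op_def arc_op_def fun_eq_iff)

lemma act_vert: "act (path_elem (v, [])) x = vert_op v x"
  by (simp add: act_path_elem)

lemma act_two: "(a \<notin> E \<or> b \<notin> E) \<Longrightarrow> head Q a = tail Q b \<Longrightarrow> act (path_elem (tail Q a, [a, b])) x = (\<lambda>_. 0)"
  by (auto simp: act_path_elem vert_op_def arc_op_def fun_eq_iff)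

end

section \<open>String modules\<close>

context coloured_dag
begin

lemma iwalk_head_inj: "iwalk u es \<Longrightarrow> a \<in> set es \<Longrightarrow> b \<in> set es \<Longrightarrow> head G a = head G b \<Longrightarrow> a = b"
proof (induction es arbitrary: u)
  case (Cons c es)
  have lt: "rank (head G c) < rank (head G x)" if "x \<in> set es" for x
    using iwalk_arc[of "head G c" es x] rank_qarc[of x] Cons.prems(1) that by auto
  have "a = c \<or> a \<in> set es" "b = c \<or> b \<in> set es" "iwalk (head G c) es"
    using Cons.prems by auto
  then show ?case
    using Cons.IH[of "head G c"] Cons.prems(4) lt[of a] lt[of b] by (metis less_irrefl)
qed simp

lemma iwalk_tail_inj: "iwalk u es \<Longrightarrow> a \<in> set es \<Longrightarrow> b \<in> set es \<Longrightarrow> tail G a = tail G b \<Longrightarrow> a = b"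
proof (induction es arbitrary: u)
  case (Cons c es)
  have lt: "rank (tail G c) < rank (tail G x)" if "x \<in> set es" for x
    using iwalk_arc[of "head G c" es x] rank_arc[of c] Cons.prems(1) that by auto
  have "a = c \<or> a \<in> set es" "b = c \<or> b \<in> set es" "iwalk (head G c) es"
    using Cons.prems by auto
  then show ?case
    using Cons.IH[of "head G c"] Cons.prems(4) lt[of a] lt[of b] by (metis less_irrefl)
qed simp

text \<open>Two arrows of different colour compose in the quiver only if the edges share their head
  or share their tail in \<open>G\<close>, which is impossible for two edges of a walk. Hence no
  zero relation lies on a string.\<close>

lemma iwalk_composable_same_col:
  assumes "iwalk u es" "a \<in> set es" "b \<in> set es" "qhead a = qtail b"
  shows "col a = col b"
proof (rule ccontr)
  assume ne: "col a \<noteq> col b"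
  then have "head G a = head G b \<or> tail G a = tail G b"
    using assms(4) by (auto simp: qhead_def qtail_def split: if_splits)
  then show False
    using ne iwalk_head_inj[OF assms(1-3)] iwalk_tail_inj[OF assms(1-3)] by auto
qed

end

context ample_full_dag
begin

abbreviation Q :: "('v,'e) pre_digraph" where
  "Q \<equiv> quiver G F"

abbreviation PA :: "(('v,'e) qpath \<Rightarrow> 'k::field) ring" where
  "PA \<equiv> path_algebra Q"

abbreviation AA :: "(('v,'e) qpath \<Rightarrow> 'k::field) set ring" where
  "AA \<equiv> framed_algebra G F"

lemma quiver_verts [simp]: "verts Q = inner_verts G"
  by (simp add: quiver_def)

lemma quiver_arcs [simp]: "arcs Q = qarcs"
  by (simp add: quiver_def qarcs_def)

lemma quiver_tail [simp]: "tail Q = qtail"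
  by (auto simp: quiver_def qtail_def col_def fun_eq_iff)

lemma quiver_head [simp]: "head Q = qhead"
  by (auto simp: quiver_def qhead_def col_def fun_eq_iff)

text \<open>On these edges \<open>omega\<close> takes only the values 1 and 2, so the Boolean colour
  loses nothing.\<close>

lemma omega_neq_iff: "a \<in> qarcs \<Longrightarrow> b \<in> qarcs \<Longrightarrow> omega G F a \<noteq> omega G F b \<longleftrightarrow> col a \<noteq> col b"
  using omega_cases_out[of "tail G a" a] omega_cases_out[of "tail G b" b] by (auto simp: qarcs_def col_def)

lemma fin_digraph_quiver: "fin_digraph Q"
  by (rule quiver_fin_digraph) (rule fin_digraph_axioms)

lemma wf_digraph_quiver: "wf_digraph Q"
  using fin_digraph_quiver by (simp add: fin_digraph_def)

lemma finite_quiver_verts: "finite (verts Q)"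
  using fin_digraph.finite_verts[OF fin_digraph_quiver] .

lemma ring_PA: "ring (PA :: (('v,'e) qpath \<Rightarrow> 'k::field) ring)"
  by (rule path_algebra_ring[OF wf_digraph_quiver finite_quiver_verts])

lemma ring_AA: "ring (AA :: (('v,'e) qpath \<Rightarrow> 'k::field) set ring)"
  by (rule framed_algebra_ring) (rule fin_digraph_axioms)

lemma ideal_relations: "ideal (relation_ideal G F) (PA :: (('v,'e) qpath \<Rightarrow> 'k::field) ring)"
  by (rule relation_ideal_ideal) (rule fin_digraph_axioms)

section \<open>The quotient by the relations\<close>

definition cl :: "(('v,'e) qpath \<Rightarrow> 'k::field) \<Rightarrow> (('v,'e) qpath \<Rightarrow> 'k) set" where
  "cl f = relation_ideal G F +>\<^bsub>PA\<^esub> f"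

lemma cl_hom: "cl \<in> ring_hom (PA :: (('v,'e) qpath \<Rightarrow> 'k::field) ring) AA"
  using ideal.rcos_ring_hom[OF ideal_relations] by (simp add: cl_def[abs_def] framed_algebra_def)

lemma cl_closed: "f \<in> carrier (PA :: (('v,'e) qpath \<Rightarrow> 'k::field) ring) \<Longrightarrow> cl f \<in> carrier AA"
  using cl_hom by (rule ring_hom_closed)

lemma cl_add: "f \<in> carrier (PA :: (('v,'e) qpath \<Rightarrow> 'k::field) ring) \<Longrightarrow> g \<in> carrier PA \<Longrightarrow>
    cl (f \<oplus>\<^bsub>PA\<^esub> g) = cl f \<oplus>\<^bsub>AA\<^esub> cl g"
  using cl_hom by (rule ring_hom_add)

lemma cl_mult: "f \<in> carrier (PA :: (('v,'e) qpath \<Rightarrow> 'k::field) ring) \<Longrightarrow> g \<in> carrier PA \<Longrightarrow>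
    cl (f \<otimes>\<^bsub>PA\<^esub> g) = cl f \<otimes>\<^bsub>AA\<^esub> cl g"
  using cl_hom by (rule ring_hom_mult)

lemma cl_one: "cl (\<one>\<^bsub>PA\<^esub> :: ('v,'e) qpath \<Rightarrow> 'k::field) = \<one>\<^bsub>AA\<^esub>"
  using cl_hom by (rule ring_hom_one)

lemma carrier_AA: "carrier (AA :: (('v,'e) qpath \<Rightarrow> 'k::field) set ring) = cl ` carrier PA"
  by (auto simp: framed_algebra_def FactRing_def A_RCOSETS_def' cl_def)

lemma cl_relation:
  assumes "f \<in> relation_ideal G F"
  shows "cl (f :: ('v,'e) qpath \<Rightarrow> 'k::field) = cl \<zero>\<^bsub>PA\<^esub>"
proof -
  interpret ideal "relation_ideal G F" "PA :: (('v,'e) qpath \<Rightarrow> 'k) ring"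
    by (rule ideal_relations)
  interpret abelian_subgroup "relation_ideal G F" "PA :: (('v,'e) qpath \<Rightarrow> 'k) ring"
    by (rule abelian_subgroupI3) (unfold_locales)
  show ?thesis
    unfolding cl_def using assms a_rcos_const additive_subgroup.zero_closed[OF additive_subgroup_axioms] by metis
qed

lemma cl_zero: "cl (\<zero>\<^bsub>PA\<^esub> :: ('v,'e) qpath \<Rightarrow> 'k::field) = \<zero>\<^bsub>AA\<^esub>"
proof -
  interpret ring_hom_ring "PA :: (('v,'e) qpath \<Rightarrow> 'k) ring" AA cl
    using ring_PA ring_AA cl_hom by (rule ring_hom_ringI2)
  show ?thesis by (rule hom_zero)
qed

definition scal :: "'k::field \<Rightarrow> ('v,'e) qpath \<Rightarrow> 'k" where
  "scal c = (\<lambda>x. c * \<one>\<^bsub>PA\<^esub> x)"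

lemma algebra_scalar_eq: "algebra_scalar G F c = cl (scal c)"
  by (simp add: algebra_scalar_def cl_def scal_def)

lemma vertex_idem_eq: "vertex_idem G F v = cl (path_elem (v, []))"
  by (simp add: vertex_idem_def cl_def)

lemma scal_closed [simp]: "scal c \<in> carrier PA"
  unfolding scal_def by (intro path_algebra_scale_closed path_algebra_one_closed finite_quiver_verts)

lemma vert_closed [simp]: "v \<in> inner_verts G \<Longrightarrow> path_elem (v, []) \<in> carrier PA"
  by (intro path_elem_closed) (simp add: qpaths_Nil_iff wf_digraph_quiver)

lemma arc_closed [simp]: "e \<in> qarcs \<Longrightarrow> path_elem (qtail e, [e]) \<in> carrier PA"
  by (intro path_elem_closed) (simp add: qpaths_Cons_iff qpaths_Nil_iff wf_digraph_quiver qarcs_ends)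

lemma relation_in_ideal:
  assumes "a \<in> qarcs" "b \<in> qarcs" "qhead a = qtail b" "col a \<noteq> col b"
  shows "path_elem (qtail a, [a, b]) \<in> (relation_ideal G F :: (('v,'e) qpath \<Rightarrow> 'k::field) set)"
proof -
  interpret ring "PA :: (('v,'e) qpath \<Rightarrow> 'k) ring" by (rule ring_PA)
  let ?S = "{path_elem (tail Q a, [a, b]) | a b. a \<in> arcs Q \<and> b \<in> arcs Q \<and> head Q a = tail Q b \<and>
      omega G F a \<noteq> omega G F b} :: (('v,'e) qpath \<Rightarrow> 'k) set"
  have "?S \<subseteq> carrier PA"
    by (auto intro!: path_elem_closed simp: qpaths_Cons_iff qpaths_Nil_iff wf_digraph_quiver qarcs_ends)
  then have "?S \<subseteq> Idl\<^bsub>PA\<^esub> ?S" by (rule genideal_self)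
  moreover have "path_elem (qtail a, [a, b]) \<in> ?S"
    using assms omega_neq_iff[OF assms(1,2)] by auto
  ultimately show ?thesis
    by (auto simp: relation_ideal_def Let_def)
qed

text \<open>Serves two ideals \<open>J\<close>: the elements that act by zero on a string module,
  and those with coefficient zero at a given trivial path.\<close>

lemma relation_ideal_subset:
  assumes "ideal J (PA :: (('v,'e) qpath \<Rightarrow> 'k::field) ring)"
    and "\<And>a b. a \<in> qarcs \<Longrightarrow> b \<in> qarcs \<Longrightarrow> qhead a = qtail b \<Longrightarrow> col a \<noteq> col b \<Longrightarrow>
      path_elem (qtail a, [a, b]) \<in> J"
  shows "relation_ideal G F \<subseteq> J"
proof -
  interpret ring "PA :: (('v,'e) qpath \<Rightarrow> 'k) ring" by (rule ring_PA)
  show ?thesis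
    unfolding relation_ideal_def Let_def
    by (rule genideal_minimal[OF assms(1)]) (use assms(2) omega_neq_iff in auto)
qed

section \<open>String modules of walks\<close>

definition vnum :: "'v \<Rightarrow> nat" where
  "vnum = (SOME f. inj_on f (verts G))"

lemma vnum_inj: "inj_on vnum (verts G)"
  unfolding vnum_def using finite_imp_inj_to_nat_seg[OF finite_verts] by (metis someI_ex)

lemma vnum_eq [simp]: "u \<in> inner_verts G \<Longrightarrow> v \<in> inner_verts G \<Longrightarrow> vnum u = vnum v \<longleftrightarrow> u = v"
  using vnum_inj by (auto simp: inj_on_def inner_verts_def)

lemma string_data_iwalk:
  assumes "iwalk u es"
  shows "string_data Q vnum (walk_verts u es) (set es)"
proof -
  interpret Q: fin_digraph Q by (rule fin_digraph_quiver)
  show ?thesis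
  proof
    show "inj_on vnum (verts Q)"
      by (rule inj_onI) simp
    show "walk_verts u es \<subseteq> verts Q" "set es \<subseteq> arcs Q"
      using iwalk_vert[OF assms] iwalk_arc[OF assms] by auto
    show "tail Q e \<in> walk_verts u es" "head Q e \<in> walk_verts u es" if "e \<in> set es" for e
      using iwalk_arc[OF assms that] by (auto simp: qtail_def qhead_def)
  qed
qed

text \<open>The choice of a representative in the action is harmless, because the relations act by zero.\<close>

definition string_module :: "'v \<Rightarrow> 'e list \<Rightarrow> ((('v,'e) qpath \<Rightarrow> 'k::field) set, nat \<Rightarrow> 'k) module" where
  "string_module u es =
    \<lparr> carrier = string_data.string_space vnum (walk_verts u es), mult = (\<lambda>_ _. undefined), one = undefined,
      zero = (\<lambda>_. 0), add = (\<lambda>x y n. x n + y n),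
      module.smult = (\<lambda>X x. string_data.act Q vnum (walk_verts u es) (set es) (SOME f. f \<in> X) x) \<rparr>"

context
  fixes u :: 'v and es :: "'e list"
  assumes iw: "iwalk u es"
begin

interpretation S: string_data Q vnum "walk_verts u es" "set es"
  by (rule string_data_iwalk[OF iw])

lemma act_add_left:
  assumes "f \<in> carrier (PA :: (('v,'e) qpath \<Rightarrow> 'k::field) ring)" "g \<in> carrier PA"
  shows "S.act (f \<oplus>\<^bsub>PA\<^esub> g) x = (\<lambda>n. S.act f x n + S.act g x n)"
  using S.act_add_scale[of f g 1 x] assms by (simp add: path_algebra_add path_algebra_carrier)

text \<open>The elements that act by zero form an ideal. It contains the relations, because
  composable arrows of different colour cannot both lie on the walk.\<close>

lemma act_relation:
  assumes "f \<in> relation_ideal G F"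
  shows "S.act (f :: ('v,'e) qpath \<Rightarrow> 'k::field) x = (\<lambda>_. 0)"
proof -
  interpret A: ring "PA :: (('v,'e) qpath \<Rightarrow> 'k) ring" by (rule ring_PA)
  let ?J = "{f \<in> carrier PA. \<forall>x. S.act f x = (\<lambda>_. 0)} :: (('v,'e) qpath \<Rightarrow> 'k) set"
  have zero: "S.act g (\<lambda>_. 0) = (\<lambda>_. 0)" for g :: "('v,'e) qpath \<Rightarrow> 'k"
    using S.act_scale_right[of g 0 "\<lambda>_. 0"] by simp
  have "ideal ?J PA"
  proof (rule idealI)
    show "subgroup ?J (add_monoid PA)"
    proof (rule A.add.subgroupI)
      show "?J \<noteq> {}" using A.zero_closed S.act_zero_left by (fastforce simp: path_algebra_zero)
      show "\<ominus>\<^bsub>PA\<^esub> f \<in> ?J" if "f \<in> ?J" for f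
      proof -
        have f: "f \<in> carrier PA" "\<And>x. S.act f x = (\<lambda>_. 0)" using that by auto
        have "S.act (f \<oplus>\<^bsub>PA\<^esub> \<ominus>\<^bsub>PA\<^esub> f) x = S.act (\<ominus>\<^bsub>PA\<^esub> f) x" for x
          using f by (subst act_add_left) auto
        then show ?thesis using f by (simp add: A.r_neg path_algebra_zero S.act_zero_left)
      qed
      show "f \<oplus>\<^bsub>PA\<^esub> g \<in> ?J" if "f \<in> ?J" "g \<in> ?J" for f g
        using that by (auto simp: act_add_left)
    qed auto
    show "g \<otimes>\<^bsub>PA\<^esub> f \<in> ?J" "f \<otimes>\<^bsub>PA\<^esub> g \<in> ?J" if "f \<in> ?J" "g \<in> carrier PA" for f g
      using that by (auto simp: S.act_mult zero)
  qed (rule ring_PA)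
  moreover have "path_elem (qtail a, [a, b]) \<in> ?J"
    if "a \<in> qarcs" "b \<in> qarcs" "qhead a = qtail b" "col a \<noteq> col b" for a b
  proof -
    have "a \<notin> set es \<or> b \<notin> set es"
      using iwalk_composable_same_col[OF iw] that by blast
    then have "S.act (path_elem (qtail a, [a, b])) x = (\<lambda>_. 0 :: 'k)" for x
      using S.act_two[of a b x] that by simp
    then show ?thesis
      using that by (auto intro!: path_elem_closed simp: qpaths_Cons_iff qpaths_Nil_iff wf_digraph_quiver qarcs_ends)
  qed
  ultimately have "relation_ideal G F \<subseteq> ?J" by (rule relation_ideal_subset)
  then show ?thesis using assms by auto
qed

lemma string_smult_cl:
  assumes "f \<in> carrier PA"
  shows "cl f \<odot>\<^bsub>string_module u es\<^esub> x = S.act (f :: ('v,'e) qpath \<Rightarrow> 'k::field) x"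
proof -
  interpret ideal "relation_ideal G F" "PA :: (('v,'e) qpath \<Rightarrow> 'k) ring"
    by (rule ideal_relations)
  have cl: "cl f = (\<Union>h\<in>relation_ideal G F. {h \<oplus>\<^bsub>PA\<^esub> f})"
    by (simp add: cl_def a_r_coset_def')
  then have "\<exists>g. g \<in> cl f"
    using additive_subgroup.zero_closed[OF additive_subgroup_axioms] by blast
  then have "(SOME g. g \<in> cl f) \<in> cl f" by (rule someI_ex)
  then obtain h where h: "h \<in> relation_ideal G F" "(SOME g. g \<in> cl f) = h \<oplus>\<^bsub>PA\<^esub> f"
    using cl by auto
  then have "h \<in> carrier PA" by (metis Icarr)
  then show ?thesis
    using h assms by (simp add: string_module_def act_add_left act_relation)
qed

lemma string_carrier [simp]: "carrier (string_module u es) = S.string_space"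
  and string_zero [simp]: "\<zero>\<^bsub>string_module u es\<^esub> = (\<lambda>_. 0)"
  and string_add [simp]: "x \<oplus>\<^bsub>string_module u es\<^esub> y = (\<lambda>n. x n + y n)"
  by (simp_all add: string_module_def)

lemma right_module_string: "right_module AA (string_module u es :: (_, nat \<Rightarrow> 'k::field) module)"
proof -
  let ?M = "string_module u es :: (_, nat \<Rightarrow> 'k) module"
  have grp: "abelian_group ?M"
  proof (rule abelian_groupI)
    show "x \<oplus>\<^bsub>?M\<^esub> y \<in> carrier ?M" if "x \<in> carrier ?M" "y \<in> carrier ?M" for x y
      using that by (auto simp: S.string_space_def) (metis add_0)
    show "\<exists>y\<in>carrier ?M. y \<oplus>\<^bsub>?M\<^esub> x = \<zero>\<^bsub>?M\<^esub>" if "x \<in> carrier ?M" for x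
      using that by (intro bexI[of _ "\<lambda>n. - x n"]) (auto simp: S.string_space_def)
  qed (auto simp: S.string_space_def add_ac)
  show ?thesis
    unfolding right_module_def right_module_axioms_def
  proof (intro conjI ballI allI impI ring_AA grp)
    fix X Y x y
    assume X: "X \<in> carrier (AA :: (('v,'e) qpath \<Rightarrow> 'k) set ring)"
    then obtain f where f: "f \<in> carrier PA" "X = cl f" by (auto simp: carrier_AA)
    show "x \<in> carrier ?M \<Longrightarrow> X \<odot>\<^bsub>?M\<^esub> x \<in> carrier ?M"
      using f by (simp add: string_smult_cl S.act_closed)
    show "X \<odot>\<^bsub>?M\<^esub> (x \<oplus>\<^bsub>?M\<^esub> y) = X \<odot>\<^bsub>?M\<^esub> x \<oplus>\<^bsub>?M\<^esub> X \<odot>\<^bsub>?M\<^esub> y"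
      using f by (simp add: string_smult_cl S.act_plus)
    assume Y: "Y \<in> carrier (AA :: (('v,'e) qpath \<Rightarrow> 'k) set ring)"
    then obtain g where g: "g \<in> carrier PA" "Y = cl g" by (auto simp: carrier_AA)
    show "(X \<oplus>\<^bsub>AA\<^esub> Y) \<odot>\<^bsub>?M\<^esub> x = X \<odot>\<^bsub>?M\<^esub> x \<oplus>\<^bsub>?M\<^esub> Y \<odot>\<^bsub>?M\<^esub> x"
      using f g ring.ring_simprules(1)[OF ring_PA f(1) g(1)]
      by (simp add: string_smult_cl act_add_left flip: cl_add)
    show "(X \<otimes>\<^bsub>AA\<^esub> Y) \<odot>\<^bsub>?M\<^esub> x = Y \<odot>\<^bsub>?M\<^esub> (X \<odot>\<^bsub>?M\<^esub> x)"
      using f g path_algebra_mult_closed[OF f(1) g(1)]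
      by (simp add: string_smult_cl S.act_mult flip: cl_mult)
  next
    fix x assume "x \<in> carrier ?M"
    moreover have "\<one>\<^bsub>PA\<^esub> \<in> carrier (PA :: (('v,'e) qpath \<Rightarrow> 'k) ring)"
      by (rule path_algebra_one_closed[OF finite_quiver_verts])
    ultimately show "\<one>\<^bsub>AA\<^esub> \<odot>\<^bsub>?M\<^esub> x = x"
      using S.act_one[of x 1] by (simp add: string_smult_cl flip: cl_one)
  qed
qed

lemma string_scalar:
  "x \<in> S.string_space \<Longrightarrow> algebra_scalar G F c \<odot>\<^bsub>string_module u es\<^esub> x = (\<lambda>n. c * x n)"
  by (simp add: algebra_scalar_eq string_smult_cl) (simp add: scal_def S.act_one)

lemma string_vert:
  "v \<in> inner_verts G \<Longrightarrow> vertex_idem G F v \<odot>\<^bsub>string_module u es\<^esub> x =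
     (\<lambda>n. if v \<in> walk_verts u es \<and> n = vnum v then x n else 0)"
  by (simp add: vertex_idem_eq string_smult_cl S.act_vert S.vert_op_def)

lemma string_arc:
  "e \<in> qarcs \<Longrightarrow> cl (path_elem (qtail e, [e])) \<odot>\<^bsub>string_module u es\<^esub> x =
     (\<lambda>n. if e \<in> set es \<and> n = vnum (qhead e) then x (vnum (qtail e)) else 0)"
  using S.act_arc[of e x] by (auto simp: string_smult_cl S.arc_op_def fun_eq_iff)

end

end

section \<open>Classification of indecomposable modules\<close>

definition right_module_hom :: "'r ring \<Rightarrow> ('r,'m) module \<Rightarrow> ('r,'n) module \<Rightarrow> ('m \<Rightarrow> 'n) \<Rightarrow> bool" where
  "right_module_hom R M N f \<longleftrightarrow> (\<forall>x \<in> carrier M. f x \<in> carrier N) \<and>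
     (\<forall>x \<in> carrier M. \<forall>y \<in> carrier M. f (x \<oplus>\<^bsub>M\<^esub> y) = f x \<oplus>\<^bsub>N\<^esub> f y) \<and>
     (\<forall>r \<in> carrier R. \<forall>x \<in> carrier M. f (r \<odot>\<^bsub>M\<^esub> x) = r \<odot>\<^bsub>N\<^esub> f x)"

lemma module_iso_hom:
  "module_iso R M N \<longleftrightarrow> (\<exists>f. bij_betw f (carrier M) (carrier N) \<and> right_module_hom R M N f)"
proof -
  have "\<forall>x \<in> carrier M. f x \<in> carrier N" if "bij_betw f (carrier M) (carrier N)" for f
    using that by (rule bij_betwE)
  then show ?thesis unfolding module_iso_def right_module_hom_def by blast
qed

lemma right_module_hom_zero:
  assumes "right_module R M" "right_module R N" "right_module_hom R M N f"
  shows "f \<zero>\<^bsub>M\<^esub> = \<zero>\<^bsub>N\<^esub>"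
proof -
  interpret M: right_module R M by fact
  interpret N: right_module R N by fact
  have c: "f \<zero>\<^bsub>M\<^esub> \<in> carrier N" using assms(3) by (simp add: right_module_hom_def)
  have "f (\<zero>\<^bsub>M\<^esub> \<oplus>\<^bsub>M\<^esub> \<zero>\<^bsub>M\<^esub>) = f \<zero>\<^bsub>M\<^esub> \<oplus>\<^bsub>N\<^esub> f \<zero>\<^bsub>M\<^esub>"
    using assms(3) M.M.zero_closed unfolding right_module_hom_def by blast
  then have "f \<zero>\<^bsub>M\<^esub> = f \<zero>\<^bsub>M\<^esub> \<oplus>\<^bsub>N\<^esub> f \<zero>\<^bsub>M\<^esub>"
    by simp
  then show ?thesis using c by (metis N.M.add.r_cancel_one')
qed

text \<open>Negation is the action of \<open>\<ominus> \<one>\<close>, so closure under inverses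
  comes from closure under the action.\<close>

lemma (in right_module) submoduleI:
  assumes "H \<subseteq> carrier M" "H \<noteq> {}" "\<And>x y. x \<in> H \<Longrightarrow> y \<in> H \<Longrightarrow> x \<oplus>\<^bsub>M\<^esub> y \<in> H"
    and smult: "\<And>r x. r \<in> carrier R \<Longrightarrow> x \<in> H \<Longrightarrow> r \<odot>\<^bsub>M\<^esub> x \<in> H"
  shows "submodule H R M"
proof -
  have zero: "\<zero>\<^bsub>R\<^esub> \<odot>\<^bsub>M\<^esub> x = \<zero>\<^bsub>M\<^esub>" if "x \<in> carrier M" for x
  proof -
    have "\<zero>\<^bsub>R\<^esub> \<odot>\<^bsub>M\<^esub> x \<oplus>\<^bsub>M\<^esub> \<zero>\<^bsub>R\<^esub> \<odot>\<^bsub>M\<^esub> x = \<zero>\<^bsub>R\<^esub> \<odot>\<^bsub>M\<^esub> x"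
      using smult_l_distr[of "\<zero>\<^bsub>R\<^esub>" "\<zero>\<^bsub>R\<^esub>" x] that by simp
    then show ?thesis
      using smult_closed[OF R.zero_closed that] by (metis M.add.r_cancel_one')
  qed
  have neg: "\<ominus>\<^bsub>M\<^esub> x = (\<ominus>\<^bsub>R\<^esub> \<one>\<^bsub>R\<^esub>) \<odot>\<^bsub>M\<^esub> x" if "x \<in> carrier M" for x
  proof -
    have "(\<ominus>\<^bsub>R\<^esub> \<one>\<^bsub>R\<^esub>) \<odot>\<^bsub>M\<^esub> x \<oplus>\<^bsub>M\<^esub> x = \<zero>\<^bsub>M\<^esub>"
      using smult_l_distr[of "\<ominus>\<^bsub>R\<^esub> \<one>\<^bsub>R\<^esub>" "\<one>\<^bsub>R\<^esub>" x] that zero[OF that] by (simp add: R.l_neg smult_one)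
    then show ?thesis
      using that smult_closed[of "\<ominus>\<^bsub>R\<^esub> \<one>\<^bsub>R\<^esub>" x] by (simp add: M.minus_equality)
  qed
  have "subgroup H (add_monoid M)"
  proof (rule M.add.subgroupI)
    fix x assume x: "x \<in> H"
    then show "\<ominus>\<^bsub>M\<^esub> x \<in> H"
      using neg[of x] smult[of "\<ominus>\<^bsub>R\<^esub> \<one>\<^bsub>R\<^esub>" x] assms(1) by auto
  qed (use assms in auto)
  then show ?thesis
    by (simp add: submodule_def submodule_axioms_def smult)
qed

lemma submoduleD:
  assumes "submodule H R M"
  shows "H \<subseteq> carrier M" "\<zero>\<^bsub>M\<^esub> \<in> H" "x \<in> H \<Longrightarrow> y \<in> H \<Longrightarrow> x \<oplus>\<^bsub>M\<^esub> y \<in> H"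
    "r \<in> carrier R \<Longrightarrow> x \<in> H \<Longrightarrow> r \<odot>\<^bsub>M\<^esub> x \<in> H"
proof -
  interpret submodule H R M by fact
  show "H \<subseteq> carrier M" "\<zero>\<^bsub>M\<^esub> \<in> H" "x \<in> H \<Longrightarrow> y \<in> H \<Longrightarrow> x \<oplus>\<^bsub>M\<^esub> y \<in> H"
    using subset one_closed m_closed by auto
  show "r \<in> carrier R \<Longrightarrow> x \<in> H \<Longrightarrow> r \<odot>\<^bsub>M\<^esub> x \<in> H"
    by (rule smult_closed)
qed

text \<open>Since \<open>f\<close> is a left inverse of \<open>g\<close>, the module
  \<open>M\<close> is the direct sum of the image of \<open>g\<close> and the kernel of
  \<open>f\<close>. The image is nonzero because \<open>N\<close> is, so the kernel must
  vanish.\<close>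

lemma indecomposable_retract_iso:
  assumes M: "right_module R M" and N: "right_module R N" and ind: "indecomposable R M"
    and f: "right_module_hom R M N f" and g: "right_module_hom R N M g"
    and fg: "\<And>y. y \<in> carrier N \<Longrightarrow> f (g y) = y" and N0: "carrier N \<noteq> {\<zero>\<^bsub>N\<^esub>}"
  shows "module_iso R M N"
proof -
  interpret M: right_module R M by fact
  interpret N: right_module R N by fact
  have fc: "x \<in> carrier M \<Longrightarrow> f x \<in> carrier N" and fa: "x \<in> carrier M \<Longrightarrow> y \<in> carrier M \<Longrightarrow> f (x \<oplus>\<^bsub>M\<^esub> y) = f x \<oplus>\<^bsub>N\<^esub> f y"
    and fs: "r \<in> carrier R \<Longrightarrow> x \<in> carrier M \<Longrightarrow> f (r \<odot>\<^bsub>M\<^esub> x) = r \<odot>\<^bsub>N\<^esub> f x" for x y r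
    using f by (auto simp: right_module_hom_def)
  have gc: "x \<in> carrier N \<Longrightarrow> g x \<in> carrier M" and ga: "x \<in> carrier N \<Longrightarrow> y \<in> carrier N \<Longrightarrow> g (x \<oplus>\<^bsub>N\<^esub> y) = g x \<oplus>\<^bsub>M\<^esub> g y"
    and gs: "r \<in> carrier R \<Longrightarrow> x \<in> carrier N \<Longrightarrow> g (r \<odot>\<^bsub>N\<^esub> x) = r \<odot>\<^bsub>M\<^esub> g x" for x y r
    using g by (auto simp: right_module_hom_def)
  have f0: "f \<zero>\<^bsub>M\<^esub> = \<zero>\<^bsub>N\<^esub>" and g0: "g \<zero>\<^bsub>N\<^esub> = \<zero>\<^bsub>M\<^esub>"
    using right_module_hom_zero[OF M N f] right_module_hom_zero[OF N M g] .
  have smult0: "r \<odot>\<^bsub>N\<^esub> \<zero>\<^bsub>N\<^esub> = \<zero>\<^bsub>N\<^esub>" if "r \<in> carrier R" for r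
    using N.smult_r_distr[OF that N.M.zero_closed N.M.zero_closed] N.smult_closed[OF that N.M.zero_closed]
    by (metis N.M.add.r_cancel_one' N.M.l_zero N.M.zero_closed)
  have fm: "f (\<ominus>\<^bsub>M\<^esub> y) = \<ominus>\<^bsub>N\<^esub> f y" if "y \<in> carrier M" for y
  proof -
    have "f (\<ominus>\<^bsub>M\<^esub> y) \<oplus>\<^bsub>N\<^esub> f y = \<zero>\<^bsub>N\<^esub>"
      using fa[of "\<ominus>\<^bsub>M\<^esub> y" y] that f0 by (simp add: M.M.l_neg)
    then show ?thesis
      using that fc by (simp add: N.M.minus_equality)
  qed
  let ?K = "{x \<in> carrier M. f x = \<zero>\<^bsub>N\<^esub>}" and ?I = "g ` carrier N"
  have K: "submodule ?K R M"
    using f0 by (intro M.submoduleI) (auto simp: fa fs smult0 M.smult_closed)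
  have I: "submodule ?I R M"
  proof (rule M.submoduleI)
    show "x \<oplus>\<^bsub>M\<^esub> y \<in> ?I" if "x \<in> ?I" "y \<in> ?I" for x y
      using that by (auto simp flip: ga)
    show "r \<odot>\<^bsub>M\<^esub> x \<in> ?I" if "r \<in> carrier R" "x \<in> ?I" for r x
      using that by (auto simp: N.smult_closed simp flip: gs)
  qed (use gc N.M.zero_closed in auto)
  have "?I \<inter> ?K = {\<zero>\<^bsub>M\<^esub>}"
  proof (intro equalityI subsetI)
    fix x assume "x \<in> ?I \<inter> ?K"
    then show "x \<in> {\<zero>\<^bsub>M\<^esub>}" using fg g0 by auto
  next
    fix x assume "x \<in> {\<zero>\<^bsub>M\<^esub>}"
    then show "x \<in> ?I \<inter> ?K" using submoduleD(2)[OF K] submoduleD(2)[OF I] by blast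
  qed
  moreover have "?I <+>\<^bsub>M\<^esub> ?K = carrier M"
  proof (intro equalityI subsetI)
    fix x assume "x \<in> ?I <+>\<^bsub>M\<^esub> ?K"
    then show "x \<in> carrier M" using gc by (auto simp: set_add_def')
  next
    fix x assume x: "x \<in> carrier M"
    let ?y = "g (f x)"
    have y: "?y \<in> carrier M" "?y \<in> ?I" using x fc gc by auto
    have "f (x \<oplus>\<^bsub>M\<^esub> \<ominus>\<^bsub>M\<^esub> ?y) = f x \<oplus>\<^bsub>N\<^esub> \<ominus>\<^bsub>N\<^esub> f x"
      using x y fa fm fg[OF fc[OF x]] by simp
    then have "x \<oplus>\<^bsub>M\<^esub> \<ominus>\<^bsub>M\<^esub> ?y \<in> ?K" using x y fc by (simp add: N.M.r_neg)
    moreover have "x = ?y \<oplus>\<^bsub>M\<^esub> (x \<oplus>\<^bsub>M\<^esub> \<ominus>\<^bsub>M\<^esub> ?y)"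
      using x y M.M.a_lcomm[of ?y x "\<ominus>\<^bsub>M\<^esub> ?y"] by (simp add: M.M.r_neg)
    ultimately show "x \<in> ?I <+>\<^bsub>M\<^esub> ?K" using y(2) unfolding set_add_def' by blast
  qed
  ultimately have "?I = {\<zero>\<^bsub>M\<^esub>} \<or> ?K = {\<zero>\<^bsub>M\<^esub>}"
    using ind I K unfolding indecomposable_def by blast
  moreover have "?I \<noteq> {\<zero>\<^bsub>M\<^esub>}"
  proof
    assume I0: "?I = {\<zero>\<^bsub>M\<^esub>}"
    have "y = \<zero>\<^bsub>N\<^esub>" if "y \<in> carrier N" for y
    proof -
      have "g y = \<zero>\<^bsub>M\<^esub>" using I0 that by blast
      then show ?thesis using fg[OF that] f0 by simp
    qed
    then show False using N0 N.M.zero_closed by blast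
  qed
  ultimately have K0: "?K = {\<zero>\<^bsub>M\<^esub>}" by blast
  have "inj_on f (carrier M)"
  proof (rule inj_onI)
    fix x y assume xy: "x \<in> carrier M" "y \<in> carrier M" "f x = f y"
    then have "f (x \<oplus>\<^bsub>M\<^esub> \<ominus>\<^bsub>M\<^esub> y) = \<zero>\<^bsub>N\<^esub>"
      using fc by (simp add: fa fm N.M.r_neg)
    then have "x \<oplus>\<^bsub>M\<^esub> \<ominus>\<^bsub>M\<^esub> y = \<zero>\<^bsub>M\<^esub>" using K0 xy by blast
    then show "x = y" using xy by (metis M.M.minus_equality M.M.minus_minus M.M.a_inv_closed)
  qed
  moreover have "f ` carrier M = carrier N"
    using fc gc fg by (metis (no_types, lifting) equalityI image_subsetI image_eqI subsetI)
  ultimately show ?thesis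
    using f by (auto simp: module_iso_hom bij_betw_def)
qed

context ample_full_dag
begin

text \<open>The elements of the algebra with which \<open>f\<close> is compatible are closed under
  sums and products, so generators suffice.\<close>

lemma right_module_hom_from_generators:
  fixes M :: "((('v,'e) qpath \<Rightarrow> 'k::field) set, 'm) module"
  assumes M: "right_module AA M" and N: "right_module AA N"
    and closed: "\<And>x. x \<in> carrier M \<Longrightarrow> f x \<in> carrier N"
    and add: "\<And>x y. x \<in> carrier M \<Longrightarrow> y \<in> carrier M \<Longrightarrow> f (x \<oplus>\<^bsub>M\<^esub> y) = f x \<oplus>\<^bsub>N\<^esub> f y"
    and scalar: "\<And>x c. x \<in> carrier M \<Longrightarrow> f (algebra_scalar G F c \<odot>\<^bsub>M\<^esub> x) = algebra_scalar G F c \<odot>\<^bsub>N\<^esub> f x"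
    and vert: "\<And>x v. x \<in> carrier M \<Longrightarrow> v \<in> inner_verts G \<Longrightarrow>
      f (vertex_idem G F v \<odot>\<^bsub>M\<^esub> x) = vertex_idem G F v \<odot>\<^bsub>N\<^esub> f x"
    and arc: "\<And>x e. x \<in> carrier M \<Longrightarrow> e \<in> qarcs \<Longrightarrow>
      f (cl (path_elem (qtail e, [e])) \<odot>\<^bsub>M\<^esub> x) = cl (path_elem (qtail e, [e])) \<odot>\<^bsub>N\<^esub> f x"
  shows "right_module_hom AA M N f"
proof -
  interpret M: right_module AA M by fact
  interpret N: right_module AA N by fact
  let ?P = "\<lambda>g. \<forall>x \<in> carrier M. f (cl g \<odot>\<^bsub>M\<^esub> x) = cl g \<odot>\<^bsub>N\<^esub> f x"
  have "?P g" if "g \<in> carrier PA" for g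
    using wf_digraph_quiver finite_quiver_verts that
  proof (rule path_algebra_generated)
    fix g h :: "('v,'e) qpath \<Rightarrow> 'k" assume gh: "g \<in> carrier PA" "h \<in> carrier PA" "?P g" "?P h"
    note c = cl_closed[OF gh(1)] cl_closed[OF gh(2)]
    show "?P (g \<oplus>\<^bsub>PA\<^esub> h)"
      using gh c by (auto simp: cl_add M.smult_l_distr N.smult_l_distr add M.smult_closed closed)
    show "?P (g \<otimes>\<^bsub>PA\<^esub> h)"
      using gh c by (auto simp: cl_mult M.smult_assoc N.smult_assoc M.smult_closed closed)
  next
    show "?P (\<lambda>x. c * \<one>\<^bsub>PA\<^esub> x)" for c
      using scalar by (simp add: algebra_scalar_eq scal_def)
    show "?P (path_elem (v, []))" if "v \<in> verts Q" for v
      using vert that by (simp add: vertex_idem_eq)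
    show "?P (path_elem (tail Q e, [e]))" if "e \<in> arcs Q" for e
      using arc that by simp
  qed
  then show ?thesis
    using closed add by (auto simp: right_module_hom_def carrier_AA)
qed

lemma scal_add: "scal (c + d) = (scal c \<oplus>\<^bsub>PA\<^esub> scal d :: ('v,'e) qpath \<Rightarrow> 'k::field)"
  by (auto simp: scal_def path_algebra_add algebra_simps)

lemma scal_mult_left: "f \<in> carrier PA \<Longrightarrow> scal c \<otimes>\<^bsub>PA\<^esub> f = (\<lambda>x. c * f x :: 'k::field)"
  unfolding scal_def by (rule path_algebra_scalar_mult[OF wf_digraph_quiver finite_quiver_verts])

lemma scal_mult_right: "f \<in> carrier PA \<Longrightarrow> f \<otimes>\<^bsub>PA\<^esub> scal c = (\<lambda>x. c * f x :: 'k::field)"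
proof -
  assume f: "f \<in> carrier (PA :: (('v,'e) qpath \<Rightarrow> 'k) ring)"
  interpret ring "PA :: (('v,'e) qpath \<Rightarrow> 'k) ring" by (rule ring_PA)
  have "f \<otimes>\<^bsub>PA\<^esub> scal c = (\<lambda>x. c * (f \<otimes>\<^bsub>PA\<^esub> \<one>\<^bsub>PA\<^esub>) x)"
    by (auto simp: fun_eq_iff path_algebra_mult_apply sum_distrib_left algebra_simps scal_def)
  then show ?thesis using f by simp
qed

text \<open>Each law is an identity in the path algebra, applied to a vector. Products act with the
  left factor first, and scalars commute with everything.\<close>

lemma coloured_rep_module:
  fixes M :: "((('v,'e) qpath \<Rightarrow> 'k::field) set, 'm) module"
  assumes M: "right_module AA M"
  shows "coloured_rep G col M (\<lambda>c x. algebra_scalar G F c \<odot>\<^bsub>M\<^esub> x) (\<lambda>v x. vertex_idem G F v \<odot>\<^bsub>M\<^esub> x)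
    (\<lambda>e x. cl (path_elem (qtail e, [e])) \<odot>\<^bsub>M\<^esub> x)"
proof -
  interpret M: right_module AA M by fact
  interpret A: ring "PA :: (('v,'e) qpath \<Rightarrow> 'k) ring" by (rule ring_PA)
  have comp: "cl g \<odot>\<^bsub>M\<^esub> (cl f \<odot>\<^bsub>M\<^esub> x) = cl (f \<otimes>\<^bsub>PA\<^esub> g) \<odot>\<^bsub>M\<^esub> x"
    if "f \<in> carrier PA" "g \<in> carrier PA" "x \<in> carrier M" for f g x
    using that by (simp add: M.smult_assoc cl_closed cl_mult)
  have sum: "cl (f \<oplus>\<^bsub>PA\<^esub> g) \<odot>\<^bsub>M\<^esub> x = cl f \<odot>\<^bsub>M\<^esub> x \<oplus>\<^bsub>M\<^esub> cl g \<odot>\<^bsub>M\<^esub> x"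
    if "f \<in> carrier PA" "g \<in> carrier PA" "x \<in> carrier M" for f g x
    using that by (simp add: M.smult_l_distr cl_closed cl_add)
  have closed: "cl f \<odot>\<^bsub>M\<^esub> x \<in> carrier M" if "f \<in> carrier PA" "x \<in> carrier M" for f x
    using that by (simp add: M.smult_closed cl_closed)
  have plus: "cl f \<odot>\<^bsub>M\<^esub> (x \<oplus>\<^bsub>M\<^esub> y) = cl f \<odot>\<^bsub>M\<^esub> x \<oplus>\<^bsub>M\<^esub> cl f \<odot>\<^bsub>M\<^esub> y"
    if "f \<in> carrier PA" "x \<in> carrier M" "y \<in> carrier M" for f x y
    using that by (simp add: M.smult_r_distr cl_closed)
  have zero: "cl \<zero>\<^bsub>PA\<^esub> \<odot>\<^bsub>M\<^esub> x = \<zero>\<^bsub>M\<^esub>" if "x \<in> carrier M" for x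
    using sum[OF A.zero_closed A.zero_closed that] closed[OF A.zero_closed that]
    by (metis A.l_zero A.zero_closed M.M.add.r_cancel_one')
  have comm: "cl f \<odot>\<^bsub>M\<^esub> (cl (scal c) \<odot>\<^bsub>M\<^esub> x) = cl (scal c) \<odot>\<^bsub>M\<^esub> (cl f \<odot>\<^bsub>M\<^esub> x)"
    if "f \<in> carrier PA" "x \<in> carrier M" for f c x
    using that by (simp add: comp scal_mult_left scal_mult_right)
  show ?thesis
    unfolding algebra_scalar_eq vertex_idem_eq
  proof unfold_locales
    fix c d x y assume x: "x \<in> carrier M"
    show "cl (scal c) \<odot>\<^bsub>M\<^esub> x \<in> carrier M" using x by (simp add: closed)
    show "cl (scal (c + d)) \<odot>\<^bsub>M\<^esub> x = cl (scal c) \<odot>\<^bsub>M\<^esub> x \<oplus>\<^bsub>M\<^esub> cl (scal d) \<odot>\<^bsub>M\<^esub> x"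
      using x by (simp add: scal_add sum)
    show "cl (scal (c * d)) \<odot>\<^bsub>M\<^esub> x = cl (scal c) \<odot>\<^bsub>M\<^esub> (cl (scal d) \<odot>\<^bsub>M\<^esub> x)"
      using x by (simp add: comp scal_mult_right) (simp add: scal_def mult.assoc)
    have "scal 1 = (\<one>\<^bsub>PA\<^esub> :: ('v,'e) qpath \<Rightarrow> 'k)" by (simp add: scal_def)
    then show "cl (scal 1) \<odot>\<^bsub>M\<^esub> x = x"
      using x by (simp add: cl_one M.smult_one)
    show "cl (scal c) \<odot>\<^bsub>M\<^esub> (x \<oplus>\<^bsub>M\<^esub> y) = cl (scal c) \<odot>\<^bsub>M\<^esub> x \<oplus>\<^bsub>M\<^esub> cl (scal c) \<odot>\<^bsub>M\<^esub> y" if "y \<in> carrier M"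
      using x that by (simp add: plus)
  next
    fix v x y c assume v: "v \<in> inner_verts G" and x: "x \<in> carrier M"
    show "cl (path_elem (v, [])) \<odot>\<^bsub>M\<^esub> x \<in> carrier M" using v x by (simp add: closed)
    show "cl (path_elem (v, [])) \<odot>\<^bsub>M\<^esub> (x \<oplus>\<^bsub>M\<^esub> y) = cl (path_elem (v, [])) \<odot>\<^bsub>M\<^esub> x \<oplus>\<^bsub>M\<^esub> cl (path_elem (v, [])) \<odot>\<^bsub>M\<^esub> y"
      if "y \<in> carrier M" using v x that by (simp add: plus)
    show "cl (path_elem (v, [])) \<odot>\<^bsub>M\<^esub> (cl (scal c) \<odot>\<^bsub>M\<^esub> x) = cl (scal c) \<odot>\<^bsub>M\<^esub> (cl (path_elem (v, [])) \<odot>\<^bsub>M\<^esub> x)"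
      using v x by (simp add: comm)
    show "cl (path_elem (w, [])) \<odot>\<^bsub>M\<^esub> (cl (path_elem (v, [])) \<odot>\<^bsub>M\<^esub> x) =
        (if v = w then cl (path_elem (v, [])) \<odot>\<^bsub>M\<^esub> x else \<zero>\<^bsub>M\<^esub>)" if "w \<in> inner_verts G" for w
      using v x that zero[OF x] by (simp add: comp path_elem_mult pre_digraph.awalk_verts.simps path_algebra_zero)
  next
    fix x assume x: "x \<in> carrier M" and null: "\<And>v. v \<in> inner_verts G \<Longrightarrow> cl (path_elem (v, [])) \<odot>\<^bsub>M\<^esub> x = \<zero>\<^bsub>M\<^esub>"
    \<comment> \<open>Partial sums of the vertex idempotents, added one vertex at a time; the full
      sum is the unit of the algebra.\<close>
    define part :: "'v set \<Rightarrow> ('v,'e) qpath \<Rightarrow> 'k" where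
      "part W = (\<lambda>(u, r). if u \<in> W \<and> r = [] then 1 else 0)" for W
    have "part W \<in> carrier PA \<and> cl (part W) \<odot>\<^bsub>M\<^esub> x = \<zero>\<^bsub>M\<^esub>" if "W \<subseteq> inner_verts G" for W
      using finite_subset[OF that finite_quiver_verts[unfolded quiver_verts]] that
    proof (induction W)
      case empty
      have "part {} = \<zero>\<^bsub>PA\<^esub>" by (auto simp: part_def path_algebra_zero)
      then show ?case using zero[OF x] by simp
    next
      case (insert v W)
      have eq: "part (insert v W) = path_elem (v, []) \<oplus>\<^bsub>PA\<^esub> part W"
        using insert.hyps by (auto simp: part_def path_algebra_add path_elem_def fun_eq_iff)
      show ?case
        unfolding eq using insert x null[of v] by (simp add: sum)
    qed
    from this[of "inner_verts G"] have "cl \<one>\<^bsub>PA\<^esub> \<odot>\<^bsub>M\<^esub> x = \<zero>\<^bsub>M\<^esub>"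
      by (simp add: part_def path_algebra_one)
    then show "x = \<zero>\<^bsub>M\<^esub>" using x by (simp add: cl_one M.smult_one)
  next
    fix e x y c assume e: "e \<in> qarcs" and x: "x \<in> carrier M"
    note ends = qarcs_ends[OF e]
    show "cl (path_elem (qtail e, [e])) \<odot>\<^bsub>M\<^esub> x \<in> carrier M" using e x by (simp add: closed)
    show "cl (path_elem (qtail e, [e])) \<odot>\<^bsub>M\<^esub> (x \<oplus>\<^bsub>M\<^esub> y) =
        cl (path_elem (qtail e, [e])) \<odot>\<^bsub>M\<^esub> x \<oplus>\<^bsub>M\<^esub> cl (path_elem (qtail e, [e])) \<odot>\<^bsub>M\<^esub> y" if "y \<in> carrier M"
      using e x that by (simp add: plus)
    show "cl (path_elem (qtail e, [e])) \<odot>\<^bsub>M\<^esub> (cl (scal c) \<odot>\<^bsub>M\<^esub> x) = cl (scal c) \<odot>\<^bsub>M\<^esub> (cl (path_elem (qtail e, [e])) \<odot>\<^bsub>M\<^esub> x)"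
      using e x by (simp add: comm)
    show "cl (path_elem (qtail e, [e])) \<odot>\<^bsub>M\<^esub> (cl (path_elem (qtail e, [])) \<odot>\<^bsub>M\<^esub> x) = cl (path_elem (qtail e, [e])) \<odot>\<^bsub>M\<^esub> x"
      using e x ends by (simp add: comp path_elem_mult pre_digraph.awalk_verts.simps)
    show "cl (path_elem (qhead e, [])) \<odot>\<^bsub>M\<^esub> (cl (path_elem (qtail e, [e])) \<odot>\<^bsub>M\<^esub> x) = cl (path_elem (qtail e, [e])) \<odot>\<^bsub>M\<^esub> x"
      using e x ends by (simp add: comp path_elem_mult pre_digraph.awalk_verts.simps)
  next
    fix a b x assume ab: "a \<in> qarcs" "b \<in> qarcs" "qhead a = qtail b" "col a \<noteq> col b" and x: "x \<in> carrier M"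
    have "path_elem (qtail a, [a]) \<otimes>\<^bsub>PA\<^esub> path_elem (qtail b, [b]) = (path_elem (qtail a, [a, b]) :: _ \<Rightarrow> 'k)"
      using ab by (simp add: path_elem_mult pre_digraph.awalk_verts.simps)
    moreover have "cl (path_elem (qtail a, [a, b]) :: _ \<Rightarrow> 'k) = cl \<zero>\<^bsub>PA\<^esub>"
      by (rule cl_relation[OF relation_in_ideal[OF ab]])
    ultimately show "cl (path_elem (qtail b, [b])) \<odot>\<^bsub>M\<^esub> (cl (path_elem (qtail a, [a])) \<odot>\<^bsub>M\<^esub> x) = \<zero>\<^bsub>M\<^esub>"
      using ab x zero[OF x] by (simp add: comp)
  qed
qed

text \<open>The functionals of a splitting give a homomorphism \<open>\<psi>\<close> to the string
  module, and its vectors give a homomorphism \<open>\<phi>\<close> back. As \<open>\<psi>\<close>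
  after \<open>\<phi>\<close> is the identity, the string module is a nonzero retract of an
  indecomposable module.\<close>

lemma indecomposable_iso_string:
  fixes M :: "((('v,'e) qpath \<Rightarrow> 'k::field) set, 'm) module"
  assumes M: "right_module AA M" and ind: "indecomposable AA M"
  obtains u es where "iwalk u es" "module_iso AA M (string_module u es)"
proof -
  interpret M: right_module AA M by fact
  let ?sc = "\<lambda>c x. algebra_scalar G F c \<odot>\<^bsub>M\<^esub> x" and ?ev = "\<lambda>v x. vertex_idem G F v \<odot>\<^bsub>M\<^esub> x"
    and ?ar = "\<lambda>e x. cl (path_elem (qtail e, [e])) \<odot>\<^bsub>M\<^esub> x"
  interpret R: coloured_rep G col M ?sc ?ev ?ar
    using M by (rule coloured_rep_module)
  have "carrier M \<noteq> {\<zero>\<^bsub>M\<^esub>}" using ind by (simp add: indecomposable_def)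
  then obtain u es x \<xi> where spl: "R.splitting (\<lambda>_. False) u es x \<xi>"
    by (rule R.splitting_exists)
  let ?U = "walk_verts u es"
  have iw: "iwalk u es" and lin: "\<And>w. R.functional (\<xi> w)"
    and on: "\<And>w. w \<in> ?U \<Longrightarrow> x w \<in> R.vspace w \<and> \<xi> w (x w) = 1 \<and> (\<forall>z \<in> carrier M. \<xi> w (?ev w z) = \<xi> w z)"
    and xarc: "\<And>e. e \<in> qarcs \<Longrightarrow> ?ar e (x (qtail e)) = (if e \<in> set es then x (qhead e) else \<zero>\<^bsub>M\<^esub>)"
    and \<xi>arc: "\<And>e z. e \<in> qarcs \<Longrightarrow> z \<in> carrier M \<Longrightarrow> \<xi> (qhead e) (?ar e z) = (if e \<in> set es then \<xi> (qtail e) z else 0)"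
    and off: "\<And>w. w \<notin> ?U \<Longrightarrow> x w = \<zero>\<^bsub>M\<^esub> \<and> \<xi> w = (\<lambda>_. 0)"
    using spl by (auto simp: R.splitting_def)
  interpret S: string_data Q vnum ?U "set es"
    by (rule string_data_iwalk[OF iw])
  let ?N = "string_module u es :: (_, nat \<Rightarrow> 'k) module"
  note N = right_module_string[OF iw, where ?'k = 'k]
  note simps = string_carrier[OF iw] string_zero[OF iw] string_add[OF iw] string_scalar[OF iw]
    string_vert[OF iw] string_arc[OF iw]
  have N_closed: "X \<odot>\<^bsub>?N\<^esub> y \<in> S.string_space" if "X \<in> carrier AA" "y \<in> S.string_space" for X y
    using right_module.smult_closed[OF N that(1), of y] that(2) by (simp add: simps)
  have inner: "w \<in> inner_verts G" if "w \<in> ?U" for w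
    using iwalk_vert[OF iw that] by simp
  have xc: "x w \<in> carrier M" "w \<in> ?U \<Longrightarrow> ?ev w (x w) = x w" for w
    using on[of w] off[of w] by (cases "w \<in> ?U"; simp add: R.vspace_def)+
  have ends: "qtail e \<in> ?U" "qhead e \<in> ?U" if "e \<in> set es" for e
    using iwalk_arc[OF iw that] by (auto simp: qtail_def qhead_def)

  \<comment> \<open>Written as a sum over the walk, so that \<open>vnum\<close> need not be
    inverted; for each \<open>n\<close> at most one index matches.\<close>
  define \<psi> where "\<psi> z = (\<lambda>n. \<Sum>w\<in>?U. if n = vnum w then \<xi> w z else 0)" for z
  have \<psi>_at: "\<psi> z (vnum w) = \<xi> w z" if "w \<in> inner_verts G" for w z
  proof -
    have "\<psi> z (vnum w) = (\<Sum>w'\<in>?U. if w' = w then \<xi> w z else 0)"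
      unfolding \<psi>_def using inner that by (intro sum.cong) auto
    then show ?thesis using off[of w] by auto
  qed
  have \<psi>_off: "\<psi> z n = 0" if "n \<notin> vnum ` ?U" for z n
    using that by (auto simp: \<psi>_def intro!: sum.neutral)
  have ext: "y = y'" if "y \<in> S.string_space" "y' \<in> S.string_space" "\<And>w. w \<in> ?U \<Longrightarrow> y (vnum w) = y' (vnum w)"
    for y y' :: "nat \<Rightarrow> 'k"
  proof
    fix n show "y n = y' n"
    proof (cases "n \<in> vnum ` ?U")
      case False
      then have "y n = 0" "y' n = 0" using that(1,2) unfolding S.string_space_def by blast+
      then show ?thesis by simp
    qed (use that(3) in auto)
  qed
  have \<psi>_closed: "\<psi> z \<in> S.string_space" for z
    using \<psi>_off by (auto simp: S.string_space_def)
  have \<psi>: "right_module_hom AA M ?N \<psi>"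
  proof (rule right_module_hom_from_generators[OF M N], unfold simps(1-3))
    show "\<psi> z \<in> S.string_space" for z by (rule \<psi>_closed)
    fix z assume z: "z \<in> carrier M"
    show "\<psi> (z \<oplus>\<^bsub>M\<^esub> z') = (\<lambda>n. \<psi> z n + \<psi> z' n)" if "z' \<in> carrier M" for z'
      using z that R.functionalD(1)[OF lin] by (auto simp: \<psi>_def fun_eq_iff intro!: sum.cong simp flip: sum.distrib)
    show "\<psi> (?sc c z) = algebra_scalar G F c \<odot>\<^bsub>?N\<^esub> \<psi> z" for c
      using z R.functionalD(2)[OF lin]
      by (auto simp: simps \<psi>_closed) (auto simp: \<psi>_def fun_eq_iff sum_distrib_left intro!: sum.cong)
    show "\<psi> (?ev v z) = vertex_idem G F v \<odot>\<^bsub>?N\<^esub> \<psi> z" if v: "v \<in> inner_verts G" for v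
    proof (rule ext)
      fix w assume w: "w \<in> ?U"
      have "\<xi> w (?ev v z) = \<xi> w (?ev w (?ev v z))" using on[OF w] z v by simp
      also have "\<dots> = (if v = w then \<xi> w z else 0)"
        using R.ev_ev[OF v inner[OF w] z] on[OF w] z R.functionalD(3)[OF lin] by simp
      finally show "\<psi> (?ev v z) (vnum w) = (vertex_idem G F v \<odot>\<^bsub>?N\<^esub> \<psi> z) (vnum w)"
        using v w inner by (auto simp: simps \<psi>_at)
    qed (use v in \<open>simp_all add: vertex_idem_eq cl_closed \<psi>_closed N_closed\<close>)
    show "\<psi> (?ar e z) = cl (path_elem (qtail e, [e])) \<odot>\<^bsub>?N\<^esub> \<psi> z" if e: "e \<in> qarcs" for e
    proof (rule ext)
      fix w assume w: "w \<in> ?U"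
      have az: "?ar e z \<in> carrier M" using e z by simp
      have "\<xi> w (?ar e z) = \<xi> w (?ev w (?ev (qhead e) (?ar e z)))"
        using on[OF w] az R.ev_ar[OF e z] by simp
      also have "\<dots> = (if qhead e = w then \<xi> w (?ar e z) else 0)"
        by (subst R.ev_ev[OF qarcs_ends(2)[OF e] inner[OF w] az])
          (simp only: R.ev_ar[OF e z] if_distrib[of "\<xi> w"] R.functionalD(3)[OF lin])
      also have "\<dots> = (if qhead e = w \<and> e \<in> set es then \<xi> (qtail e) z else 0)"
        using \<xi>arc[OF e z] by auto
      finally show "\<psi> (?ar e z) (vnum w) = (cl (path_elem (qtail e, [e])) \<odot>\<^bsub>?N\<^esub> \<psi> z) (vnum w)"
        using e w inner qarcs_ends[OF e] by (auto simp: simps \<psi>_at)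
    qed (use e in \<open>simp_all add: cl_closed \<psi>_closed N_closed\<close>)
  qed

  define \<phi> where "\<phi> y = (\<Oplus>\<^bsub>M\<^esub>v\<in>?U. ?sc (y (vnum v)) (x v))" for y :: "nat \<Rightarrow> 'k"
  have term_closed: "?sc c (x v) \<in> carrier M" for c v
    using xc by simp
  \<comment> \<open>Used below for scalars, idempotents and arrows alike.\<close>
  have distr: "h (\<Oplus>\<^bsub>M\<^esub>v\<in>W. g v) = (\<Oplus>\<^bsub>M\<^esub>v\<in>W. h (g v))"
    if "finite W" "\<And>v. g v \<in> carrier M" "\<And>z. z \<in> carrier M \<Longrightarrow> h z \<in> carrier M" "h \<zero>\<^bsub>M\<^esub> = \<zero>\<^bsub>M\<^esub>"
      "\<And>a b. a \<in> carrier M \<Longrightarrow> b \<in> carrier M \<Longrightarrow> h (a \<oplus>\<^bsub>M\<^esub> b) = h a \<oplus>\<^bsub>M\<^esub> h b" for h g and W :: "'v set"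
    using that(1)
  proof (induction W)
    case (insert v W)
    then show ?case using that by (simp add: M.M.finsum_insert Pi_def)
  qed (use that in simp)
  have \<phi>_closed: "\<phi> y \<in> carrier M" for y
    unfolding \<phi>_def using term_closed by (intro M.M.finsum_closed) auto
  have \<phi>: "right_module_hom AA ?N M \<phi>"
  proof (rule right_module_hom_from_generators[OF N M], unfold simps(1-3))
    show "\<phi> y \<in> carrier M" for y by (rule \<phi>_closed)
    fix y :: "nat \<Rightarrow> 'k" assume y: "y \<in> S.string_space"
    show "\<phi> (\<lambda>n. y n + y' n) = \<phi> y \<oplus>\<^bsub>M\<^esub> \<phi> y'" for y'
      unfolding \<phi>_def using xc term_closed
      by (subst M.M.finsum_addf[symmetric]) (auto intro!: M.M.finsum_cong' simp: R.sc_add_left)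
    show "\<phi> (algebra_scalar G F c \<odot>\<^bsub>?N\<^esub> y) = ?sc c (\<phi> y)" for c
      unfolding simps(4)[OF y] \<phi>_def using term_closed xc
      by (subst distr) (auto intro!: M.M.finsum_cong' simp: R.sc_add_right R.sc_mult)
    show "\<phi> (vertex_idem G F v \<odot>\<^bsub>?N\<^esub> y) = ?ev v (\<phi> y)" if v: "v \<in> inner_verts G" for v
    proof -
      have "?ev v (\<phi> y) = (\<Oplus>\<^bsub>M\<^esub>w\<in>?U. ?ev v (?sc (y (vnum w)) (x w)))"
        unfolding \<phi>_def using term_closed v by (intro distr) (auto simp: R.ev_add)
      also have "\<dots> = (\<Oplus>\<^bsub>M\<^esub>w\<in>?U. ?sc (if v = w then y (vnum w) else 0) (x w))"
      proof (intro M.M.finsum_cong' refl)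
        fix w assume w: "w \<in> ?U"
        have "?ev v (x w) = (if v = w then x w else \<zero>\<^bsub>M\<^esub>)"
          using R.ev_ev[OF inner[OF w] v xc(1)[of w]] xc(2)[OF w] by auto
        then show "?ev v (?sc (y (vnum w)) (x w)) = ?sc (if v = w then y (vnum w) else 0) (x w)"
          using R.ev_sc[OF v xc(1)[of w]] xc(1)[of w] by simp
      qed (use term_closed in auto)
      also have "\<dots> = \<phi> (vertex_idem G F v \<odot>\<^bsub>?N\<^esub> y)"
        unfolding \<phi>_def simps(5)[OF v] using term_closed v inner
        by (intro M.M.finsum_cong') auto
      finally show ?thesis by simp
    qed
    show "\<phi> (cl (path_elem (qtail e, [e])) \<odot>\<^bsub>?N\<^esub> y) = ?ar e (\<phi> y)" if e: "e \<in> qarcs" for e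
    proof -
      have "?ar e (\<phi> y) = (\<Oplus>\<^bsub>M\<^esub>w\<in>?U. ?ar e (?sc (y (vnum w)) (x w)))"
        unfolding \<phi>_def using term_closed e by (intro distr) (auto simp: R.ar_add)
      also have "\<dots> = (\<Oplus>\<^bsub>M\<^esub>w\<in>?U. if qtail e = w then ?sc (if e \<in> set es then y (vnum w) else 0) (x (qhead e)) else \<zero>\<^bsub>M\<^esub>)"
      proof (intro M.M.finsum_cong' refl)
        fix w assume w: "w \<in> ?U"
        have "?ar e (x w) = (if qtail e = w \<and> e \<in> set es then x (qhead e) else \<zero>\<^bsub>M\<^esub>)"
        proof (cases "qtail e = w")
          case True
          then show ?thesis using xarc[OF e] by auto
        next
          case False
          have "?ar e (x w) = ?ar e (?ev (qtail e) (?ev w (x w)))"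
            using R.ar_ev[OF e xc(1)[of w]] xc(2)[OF w] by simp
          also have "\<dots> = \<zero>\<^bsub>M\<^esub>"
            using False R.ev_ev[OF inner[OF w] qarcs_ends(1)[OF e] xc(1)[of w]] e by simp
          finally show ?thesis using False by simp
        qed
        then show "?ar e (?sc (y (vnum w)) (x w)) =
            (if qtail e = w then ?sc (if e \<in> set es then y (vnum w) else 0) (x (qhead e)) else \<zero>\<^bsub>M\<^esub>)"
          using R.ar_sc[OF e xc(1)[of w]] xc(1)[of "qhead e"] by simp
      qed (use term_closed in auto)
      \<comment> \<open>Only the summand at \<open>qtail e\<close> survives. If that vertex is off
        the walk, then so is \<open>e\<close>, and both sides are zero.\<close>
      also have "\<dots> = ?sc (if e \<in> set es then y (vnum (qtail e)) else 0) (x (qhead e))"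
      proof (cases "qtail e \<in> ?U")
        case True
        then show ?thesis using term_closed by (subst M.M.finsum_singleton) auto
      next
        case False
        then have "e \<notin> set es" using ends by auto
        moreover have "(\<Oplus>\<^bsub>M\<^esub>w\<in>?U. if qtail e = w then ?sc (if e \<in> set es then y (vnum w) else 0) (x (qhead e)) else \<zero>\<^bsub>M\<^esub>)
            = (\<Oplus>\<^bsub>M\<^esub>w\<in>?U. \<zero>\<^bsub>M\<^esub>)"
          using False by (intro M.M.finsum_cong') auto
        ultimately show ?thesis using xc by simp
      qed
      \<comment> \<open>The single vector is written as a sum again, now concentrated at
        \<open>qhead e\<close>: this is the shape of \<open>\<phi>\<close> on the coordinates moved
        by the arrow.\<close>
      also have "\<dots> = (\<Oplus>\<^bsub>M\<^esub>w\<in>?U. if qhead e = w then ?sc (if e \<in> set es then y (vnum (qtail e)) else 0) (x w) else \<zero>\<^bsub>M\<^esub>)"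
      proof (cases "qhead e \<in> ?U")
        case True
        then show ?thesis using term_closed by (subst M.M.finsum_singleton) auto
      next
        case False
        then have "e \<notin> set es" using ends by auto
        moreover have "(\<Oplus>\<^bsub>M\<^esub>w\<in>?U. if qhead e = w then ?sc (if e \<in> set es then y (vnum (qtail e)) else 0) (x w) else \<zero>\<^bsub>M\<^esub>)
            = (\<Oplus>\<^bsub>M\<^esub>w\<in>?U. \<zero>\<^bsub>M\<^esub>)"
          using False by (intro M.M.finsum_cong') auto
        ultimately show ?thesis using xc by simp
      qed
      also have "\<dots> = \<phi> (cl (path_elem (qtail e, [e])) \<odot>\<^bsub>?N\<^esub> y)"
        unfolding \<phi>_def simps(6)[OF e] using term_closed inner xc qarcs_ends[OF e]
        by (intro M.M.finsum_cong') auto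
      finally show ?thesis by simp
    qed
  qed

  have "\<psi> (\<phi> y) = y" if y: "y \<in> carrier ?N" for y
  proof (rule ext)
    fix w assume w: "w \<in> ?U"
    have sum: "\<xi> w (\<Oplus>\<^bsub>M\<^esub>v\<in>W. g v) = (\<Sum>v\<in>W. \<xi> w (g v))"
      if "finite W" "\<And>v. g v \<in> carrier M" for g and W :: "'v set"
      using that(1)
    proof (induction W)
      case (insert v W)
      then show ?case
        using that R.functionalD(1)[OF lin] by (simp add: M.M.finsum_insert Pi_def M.M.finsum_closed)
    qed (use R.functionalD(3)[OF lin] in simp)
    \<comment> \<open>The projections at distinct vertices are orthogonal, so functionals and
      vectors form dual systems.\<close>
    have cross: "\<xi> w (x v) = (if v = w then 1 else 0)" if v: "v \<in> ?U" for v
    proof -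
      have "\<xi> w (x v) = \<xi> w (?ev w (?ev v (x v)))"
        using on[OF w] xc(1)[of v] xc(2)[OF v] by simp
      then show ?thesis
        using R.ev_ev[OF inner[OF v] inner[OF w] xc(1)[of v]] on[OF w] xc(2)[OF v] R.functionalD(3)[OF lin] by auto
    qed
    have "\<xi> w (\<phi> y) = (\<Sum>v\<in>?U. \<xi> w (?sc (y (vnum v)) (x v)))"
      unfolding \<phi>_def using term_closed by (intro sum) auto
    also have "\<dots> = (\<Sum>v\<in>?U. if v = w then y (vnum w) else 0)"
      using xc R.functionalD(2)[OF lin] cross by (intro sum.cong) auto
    also have "\<dots> = y (vnum w)" using w by simp
    finally show "\<psi> (\<phi> y) (vnum w) = y (vnum w)"
      using w inner by (simp add: \<psi>_at)
  qed (use y in \<open>auto simp: simps \<psi>_closed\<close>)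
  moreover have "carrier ?N \<noteq> {\<zero>\<^bsub>?N\<^esub>}"
  proof -
    have "(\<lambda>n. if n = vnum u then 1 else 0) \<in> carrier ?N"
      by (auto simp: simps S.string_space_def)
    moreover have "(\<lambda>n. if n = vnum u then 1 else 0) \<noteq> (\<lambda>_. 0 :: 'k)"
      by (auto simp: fun_eq_iff)
    ultimately show ?thesis by (auto simp: simps)
  qed
  ultimately have "module_iso AA M ?N"
    using indecomposable_retract_iso[OF M N ind \<psi> \<phi>] by blast
  with iw show ?thesis by (rule that)
qed

end

section \<open>Isomorphism classes and projectives\<close>

lemma right_module_hom_inverse:
  assumes "right_module R M" "right_module_hom R M N f" "bij_betw f (carrier M) (carrier N)"
  shows "right_module_hom R N M (the_inv_into (carrier M) f)"
proof -
  interpret M: right_module R M by fact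
  let ?g = "the_inv_into (carrier M) f"
  have inj: "inj_on f (carrier M)" and im: "f ` carrier M = carrier N"
    using assms(3) by (auto simp: bij_betw_def)
  have g: "?g y \<in> carrier M" "f (?g y) = y" if "y \<in> carrier N" for y
    using that im the_inv_into_into[OF inj, of y] f_the_inv_into_f[OF inj, of y] by auto
  have gf: "?g (f x) = x" if "x \<in> carrier M" for x
    using inj that by (rule the_inv_into_f_f)
  have fa: "f (x \<oplus>\<^bsub>M\<^esub> y) = f x \<oplus>\<^bsub>N\<^esub> f y" if "x \<in> carrier M" "y \<in> carrier M" for x y
    using assms(2) that by (simp add: right_module_hom_def)
  have fs: "f (r \<odot>\<^bsub>M\<^esub> x) = r \<odot>\<^bsub>N\<^esub> f x" if "r \<in> carrier R" "x \<in> carrier M" for r x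
    using assms(2) that by (simp add: right_module_hom_def)
  show ?thesis
    unfolding right_module_hom_def
  proof (intro conjI ballI)
    fix y z assume y: "y \<in> carrier N" and z: "z \<in> carrier N"
    have "y \<oplus>\<^bsub>N\<^esub> z = f (?g y \<oplus>\<^bsub>M\<^esub> ?g z)" using y z by (simp add: fa g)
    then show "?g (y \<oplus>\<^bsub>N\<^esub> z) = ?g y \<oplus>\<^bsub>M\<^esub> ?g z" using y z by (simp add: gf g)
  next
    fix r y assume r: "r \<in> carrier R" and y: "y \<in> carrier N"
    have "r \<odot>\<^bsub>N\<^esub> y = f (r \<odot>\<^bsub>M\<^esub> ?g y)" using r y by (simp add: fs g)
    then show "?g (r \<odot>\<^bsub>N\<^esub> y) = r \<odot>\<^bsub>M\<^esub> ?g y" using r y by (simp add: gf g M.smult_closed)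
  qed (rule g)
qed

lemma module_iso_refl: "module_iso R M M"
  unfolding module_iso_hom right_module_hom_def by (intro exI[of _ id]) auto

lemma module_iso_sym:
  assumes "right_module R M" "module_iso R M N"
  shows "module_iso R N M"
  using assms right_module_hom_inverse bij_betw_the_inv_into unfolding module_iso_hom by blast

lemma module_iso_trans:
  assumes "module_iso R L M" "module_iso R M N"
  shows "module_iso R L N"
proof -
  obtain f g where "bij_betw f (carrier L) (carrier M)" "right_module_hom R L M f"
    "bij_betw g (carrier M) (carrier N)" "right_module_hom R M N g"
    using assms by (auto simp: module_iso_hom)
  then have "bij_betw (g \<circ> f) (carrier L) (carrier N)" "right_module_hom R L N (g \<circ> f)"
    by (auto simp: right_module_hom_def intro: bij_betw_trans)
  then show ?thesis by (auto simp: module_iso_hom)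
qed

lemma iso_class_cong:
  assumes "right_module (R :: 'r ring) M" "module_iso R M N"
  shows "(iso_class R M :: ('r,'k) module_class) = iso_class R N"
proof -
  have "module_iso R M X \<longleftrightarrow> module_iso R N X" for X :: "('r, nat \<Rightarrow> 'k) module"
    using module_iso_trans[OF module_iso_sym[OF assms], of X] module_iso_trans[OF assms(2), of X] by blast
  then show ?thesis by (simp add: iso_class_def)
qed

text \<open>Equal classes yield an isomorphism only through a common member, hence the witness
  \<open>N\<close>: empty classes would be equal for any two modules.\<close>

lemma iso_class_eqD:
  fixes N :: "('r, nat \<Rightarrow> 'k) module"
  assumes "right_module R M'" "N \<in> iso_class R M" "(iso_class R M :: ('r,'k) module_class) = iso_class R M'"
  shows "module_iso R M M'"
proof -
  have "module_iso R M N" "module_iso R M' N"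
    using assms(2) assms(2)[unfolded assms(3)] by (simp_all add: iso_class_def)
  then show ?thesis
    using module_iso_trans module_iso_sym[OF assms(1)] by blast
qed

lemma module_iso_annihilates_imp:
  assumes M: "right_module R M" and N: "right_module R N" and iso: "module_iso R M N" and r: "r \<in> carrier R"
    and null: "\<forall>x \<in> carrier M. r \<odot>\<^bsub>M\<^esub> x = \<zero>\<^bsub>M\<^esub>"
  shows "\<forall>x \<in> carrier N. r \<odot>\<^bsub>N\<^esub> x = \<zero>\<^bsub>N\<^esub>"
proof
  obtain f where f: "bij_betw f (carrier M) (carrier N)" "right_module_hom R M N f"
    using iso by (auto simp: module_iso_hom)
  fix y assume "y \<in> carrier N"
  then obtain x where x: "x \<in> carrier M" "y = f x" using f(1) by (auto simp: bij_betw_def)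
  then have "r \<odot>\<^bsub>N\<^esub> y = f (r \<odot>\<^bsub>M\<^esub> x)" using f(2) r by (simp add: right_module_hom_def)
  then show "r \<odot>\<^bsub>N\<^esub> y = \<zero>\<^bsub>N\<^esub>" using null x right_module_hom_zero[OF M N f(2)] by simp
qed

text \<open>An isomorphism invariant; with vertex idempotents and arrows for \<open>r\<close> it
  reads off the walk of a string module.\<close>

lemma module_iso_annihilates:
  assumes "right_module R M" "right_module R N" "module_iso R M N" "r \<in> carrier R"
  shows "(\<forall>x \<in> carrier M. r \<odot>\<^bsub>M\<^esub> x = \<zero>\<^bsub>M\<^esub>) \<longleftrightarrow> (\<forall>x \<in> carrier N. r \<odot>\<^bsub>N\<^esub> x = \<zero>\<^bsub>N\<^esub>)"
  using module_iso_annihilates_imp[OF assms]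
    module_iso_annihilates_imp[OF assms(2,1) module_iso_sym[OF assms(1,3)] assms(4)] by blast

text \<open>For the projectives, \<open>h\<close> will list the coefficients of an algebra element
  along an enumeration of the paths.\<close>

lemma module_transport:
  fixes M :: "('r,'m) module" and h :: "'m \<Rightarrow> 'n"
  assumes "right_module R M" "inj_on h (carrier M)"
  shows "\<exists>N :: ('r,'n) module. right_module R N \<and> module_iso R M N"
proof -
  interpret M: right_module R M by fact
  define k where "k = the_inv_into (carrier M) h"
  have k: "k (h x) = x" if "x \<in> carrier M" for x
    using assms(2) that by (simp add: k_def the_inv_into_f_f)
  define N :: "('r,'n) module" where
    "N = \<lparr> carrier = h ` carrier M, mult = (\<lambda>_ _. undefined), one = undefined,
      zero = h \<zero>\<^bsub>M\<^esub>, add = (\<lambda>x y. h (k x \<oplus>\<^bsub>M\<^esub> k y)), module.smult = (\<lambda>r x. h (r \<odot>\<^bsub>M\<^esub> k x)) \<rparr>"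
  have "abelian_group N"
  proof (rule abelian_groupI)
    show "\<exists>y\<in>carrier N. y \<oplus>\<^bsub>N\<^esub> x = \<zero>\<^bsub>N\<^esub>" if x: "x \<in> carrier N" for x
    proof -
      obtain m where "m \<in> carrier M" "x = h m" using x by (auto simp: N_def)
      then show ?thesis
        by (intro bexI[of _ "h (\<ominus>\<^bsub>M\<^esub> m)"]) (auto simp: N_def k M.M.l_neg)
    qed
  qed (auto simp: N_def k M.M.a_ac)
  then have "right_module R N"
    unfolding right_module_def right_module_axioms_def
    by (auto simp: N_def k M.R.ring_axioms M.smult_closed M.smult_l_distr M.smult_r_distr
        M.smult_assoc M.smult_one)
  moreover have "module_iso R M N"
    unfolding module_iso_def
    by (rule exI[of _ h]) (auto simp: N_def k M.smult_closed bij_betw_def assms(2))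
  ultimately show ?thesis by blast
qed

lemma right_ideal_module:
  assumes "ring R" "e \<in> carrier R"
  shows "right_module R (right_ideal_module R e)"
proof -
  interpret ring R by fact
  let ?M = "right_ideal_module R e"
  have car: "x \<in> carrier ?M \<longleftrightarrow> (\<exists>y \<in> carrier R. x = e \<otimes>\<^bsub>R\<^esub> y)" for x
    by (auto simp: right_ideal_module_def)
  have sub: "x \<in> carrier ?M \<Longrightarrow> x \<in> carrier R" for x
    using assms(2) by (auto simp: car)
  have ops: "\<zero>\<^bsub>?M\<^esub> = \<zero>\<^bsub>R\<^esub>" "x \<oplus>\<^bsub>?M\<^esub> y = x \<oplus>\<^bsub>R\<^esub> y" "r \<odot>\<^bsub>?M\<^esub> x = x \<otimes>\<^bsub>R\<^esub> r" for x y r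
    by (auto simp: right_ideal_module_def)
  have plus: "x \<oplus>\<^bsub>R\<^esub> y \<in> carrier ?M" if "x \<in> carrier ?M" "y \<in> carrier ?M" for x y
    using that assms(2) unfolding car by (metis r_distr a_closed)
  have "abelian_group ?M"
  proof (rule abelian_groupI)
    show "\<zero>\<^bsub>?M\<^esub> \<in> carrier ?M"
      unfolding ops car using assms(2) by (intro bexI[of _ "\<zero>\<^bsub>R\<^esub>"]) auto
    show "\<exists>y\<in>carrier ?M. y \<oplus>\<^bsub>?M\<^esub> x = \<zero>\<^bsub>?M\<^esub>" if x: "x \<in> carrier ?M" for x
    proof -
      obtain y where y: "y \<in> carrier R" "x = e \<otimes>\<^bsub>R\<^esub> y" using x by (auto simp: car)
      then have "e \<otimes>\<^bsub>R\<^esub> (\<ominus>\<^bsub>R\<^esub> y) \<in> carrier ?M" by (auto simp: car)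
      moreover have "e \<otimes>\<^bsub>R\<^esub> (\<ominus>\<^bsub>R\<^esub> y) \<oplus>\<^bsub>R\<^esub> x = \<zero>\<^bsub>R\<^esub>"
        using y assms(2) by (simp add: l_neg flip: r_distr)
      ultimately show ?thesis unfolding ops by blast
    qed
  qed (auto simp: ops plus a_ac sub)
  moreover have "x \<otimes>\<^bsub>R\<^esub> r \<in> carrier ?M" if "x \<in> carrier ?M" "r \<in> carrier R" for x r
    using that assms(2) unfolding car by (metis m_assoc m_closed)
  ultimately show ?thesis
    unfolding right_module_def right_module_axioms_def
    by (auto simp: ops ring_axioms m_assoc l_distr r_distr sub)
qed

section \<open>Walks recovered from their vertices and edges\<close>

context coloured_dag
begin

lemma iwalk_rank_less: "iwalk u es \<Longrightarrow> w \<in> walk_verts u es \<Longrightarrow> w \<noteq> u \<Longrightarrow> rank u < rank w"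
proof (cases es)
  case (Cons e es')
  assume "iwalk u es" "w \<in> walk_verts u es" "w \<noteq> u"
  then have "iwalk (head G e) es'" "w \<in> walk_verts (head G e) es'" "rank u < rank (head G e)"
    using Cons rank_arc[of e] by auto
  then show ?thesis using iwalk_vert by fastforce
qed auto

lemma iwalk_same_start:
  "iwalk u es \<Longrightarrow> iwalk u fs \<Longrightarrow> set es = set fs \<Longrightarrow> es = fs"
proof (induction es arbitrary: u fs)
  case (Cons e es)
  then obtain f fs' where fs: "fs = f # fs'" by (cases fs) auto
  have tails: "tail G e = u" "tail G f = u"
    using Cons.prems(1,2) fs by auto
  have "e \<in> set (e # es)" "f \<in> set (e # es)"
    using Cons.prems(3) fs by auto
  then have ef: "e = f"
    using iwalk_tail_inj[OF Cons.prems(1)] tails by simp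
  have walks: "iwalk (head G e) es" "iwalk (head G e) fs'"
    using Cons.prems(1,2) fs ef by auto
  have "rank u < rank (head G e)" using Cons.prems(1) rank_arc[of e] by auto
  then have "e \<notin> set es" "e \<notin> set fs'"
    using iwalk_arc[OF walks(1), of e] iwalk_arc[OF walks(2), of e] tails(1) by auto
  then have "set es = set fs'" using Cons.prems(3) fs ef by auto
  then show ?case using Cons.IH[OF walks] fs ef by simp
qed simp

text \<open>The start is the unique vertex of least rank. From there on, the next edge is the only
  one of the set that leaves the current vertex.\<close>

lemma iwalk_determined:
  assumes "iwalk u es" "iwalk v fs" "walk_verts u es = walk_verts v fs" "set es = set fs"
  shows "u = v \<and> es = fs"
proof -
  have "u = v"
  proof (rule ccontr)
    assume "u \<noteq> v"
    then have "rank u < rank v" "rank v < rank u"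
      using iwalk_rank_less[OF assms(1), of v] iwalk_rank_less[OF assms(2), of u] assms(3)
        start_in_walk_verts[of u es] start_in_walk_verts[of v fs] by auto
    then show False by simp
  qed
  then show ?thesis using iwalk_same_start assms by blast
qed

text \<open>Connectedness of a walk, in the form needed for indecomposability.\<close>

lemma iwalk_constant:
  "iwalk u es \<Longrightarrow> (\<And>e. e \<in> set es \<Longrightarrow> P (tail G e) \<longleftrightarrow> P (head G e)) \<Longrightarrow> w \<in> walk_verts u es \<Longrightarrow> P w \<longleftrightarrow> P u"
proof (induction es arbitrary: u)
  case (Cons e es)
  then show ?case by (cases "w = u") auto
qed simp

end

section \<open>String modules: indecomposability, dimension and support\<close>

context ample_full_dag
begin

context
  fixes u :: 'v and es :: "'e list"
  assumes iw: "iwalk u es"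
begin

interpretation S: string_data Q vnum "walk_verts u es" "set es"
  by (rule string_data_iwalk[OF iw])

definition unit_vec :: "'v \<Rightarrow> nat \<Rightarrow> 'k::field" where
  "unit_vec v = (\<lambda>n. if n = vnum v then 1 else 0)"

lemma unit_vec_in: "v \<in> walk_verts u es \<Longrightarrow> unit_vec v \<in> S.string_space"
  by (auto simp: unit_vec_def S.string_space_def)

lemma walk_inner: "v \<in> walk_verts u es \<Longrightarrow> v \<in> inner_verts G"
  using iwalk_vert[OF iw] by simp

text \<open>The space at \<open>v\<close> is a line: the idempotent cuts \<open>x\<close> down to a
  nonzero multiple of the basis vector, and a scalar normalises it.\<close>

lemma unit_vec_mem:
  fixes A :: "(nat \<Rightarrow> 'k::field) set"
  assumes A: "submodule A AA (string_module u es)" and x: "x \<in> A" "x (vnum v) \<noteq> 0" and v: "v \<in> walk_verts u es"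
  shows "unit_vec v \<in> A"
proof -
  let ?N = "string_module u es :: (_, nat \<Rightarrow> 'k) module"
  let ?x = "vertex_idem G F v \<odot>\<^bsub>?N\<^esub> x"
  have "?x \<in> A"
    using x(1) walk_inner[OF v] by (intro submoduleD(4)[OF A]) (simp_all add: vertex_idem_eq cl_closed)
  moreover have "algebra_scalar G F c \<in> carrier AA" for c :: 'k
    by (simp add: algebra_scalar_eq cl_closed)
  ultimately have "algebra_scalar G F (inverse (x (vnum v))) \<odot>\<^bsub>?N\<^esub> ?x \<in> A"
    using submoduleD(4)[OF A] by blast
  moreover have "?x \<in> S.string_space"
    using \<open>?x \<in> A\<close> submoduleD(1)[OF A] by (auto simp: string_carrier[OF iw])
  ultimately show ?thesis
    using x(2) v walk_inner[OF v]
    by (simp add: string_scalar[OF iw] string_vert[OF iw] unit_vec_def if_distrib[of "\<lambda>z. _ * z"] cong: if_cong)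
qed

text \<open>In a decomposition each basis vector lies in exactly one summand. The arrows of the walk
  keep neighbouring basis vectors in the same summand, so one summand contains all of them.\<close>

lemma indecomposable_string: "indecomposable AA (string_module u es :: (_, nat \<Rightarrow> 'k::field) module)"
proof -
  let ?N = "string_module u es :: (_, nat \<Rightarrow> 'k) module"
  have unit0: "unit_vec v \<noteq> (\<lambda>_. 0 :: 'k)" for v
    by (auto simp: unit_vec_def fun_eq_iff)
  \<comment> \<open>Stated for arbitrary \<open>A\<close> and \<open>B\<close>, because it is
    applied again with the two summands exchanged.\<close>
  have start: "B = {\<zero>\<^bsub>?N\<^esub>}"
    if A: "submodule A AA ?N" and B: "submodule B AA ?N" and AB: "A \<inter> B = {\<zero>\<^bsub>?N\<^esub>}"
      and one: "\<And>v. v \<in> walk_verts u es \<Longrightarrow> unit_vec v \<in> A \<or> unit_vec v \<in> B" and uA: "unit_vec u \<in> A" for A B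
  proof -
    have both: False if "unit_vec v \<in> A" "unit_vec v \<in> B" for v
      using that AB unit0[of v] by (auto simp: string_zero[OF iw])
    \<comment> \<open>The arrow transports membership forwards in either summand. The converse
      follows: were the tail vector in \<open>B\<close>, the head vector would lie in both.\<close>
    have step: "unit_vec (qtail e) \<in> A \<longleftrightarrow> unit_vec (qhead e) \<in> A" if e: "e \<in> set es" for e
    proof -
      have eq: "e \<in> qarcs" using iwalk_arc[OF iw e] by simp
      have q: "qtail e \<in> walk_verts u es"
        using iwalk_arc[OF iw e] by (auto simp: qtail_def qhead_def)
      have "cl (path_elem (qtail e, [e])) \<odot>\<^bsub>?N\<^esub> unit_vec (qtail e) = unit_vec (qhead e)"
        using e by (auto simp: string_arc[OF iw eq] unit_vec_def fun_eq_iff)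
      then have "unit_vec (qtail e) \<in> C \<Longrightarrow> unit_vec (qhead e) \<in> C" if "submodule C AA ?N" for C
        using submoduleD(4)[OF that, of "cl (path_elem (qtail e, [e]))" "unit_vec (qtail e)"] eq by (simp add: cl_closed)
      then show ?thesis using A B one[OF q] both by blast
    qed
    have "unit_vec (tail G e) \<in> A \<longleftrightarrow> unit_vec (head G e) \<in> A" if "e \<in> set es" for e
      using step[OF that] by (auto simp: qtail_def qhead_def split: if_splits)
    then have all: "unit_vec w \<in> A" if "w \<in> walk_verts u es" for w
      using iwalk_constant[OF iw, of "\<lambda>w. unit_vec w \<in> A"] that uA by blast
    have "y = (\<lambda>_. 0)" if y: "y \<in> B" for y
    proof (rule ccontr)
      assume "y \<noteq> (\<lambda>_. 0)"
      then obtain n where n: "y n \<noteq> 0" by auto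
      moreover have "y \<in> S.string_space" using y submoduleD(1)[OF B] by (auto simp: string_carrier[OF iw])
      ultimately obtain w where w: "w \<in> walk_verts u es" "n = vnum w" by (auto simp: S.string_space_def)
      then show False using unit_vec_mem[OF B y] n all both by blast
    qed
    then show ?thesis
      using submoduleD(2)[OF B] unfolding string_zero[OF iw] by blast
  qed
  show ?thesis
    unfolding indecomposable_def
  proof (intro conjI allI impI)
    show "carrier ?N \<noteq> {\<zero>\<^bsub>?N\<^esub>}"
      using unit_vec_in[of u] unit0[of u] by (auto simp: string_carrier[OF iw] string_zero[OF iw])
    fix A B assume "submodule A AA ?N \<and> submodule B AA ?N \<and> A \<inter> B = {\<zero>\<^bsub>?N\<^esub>} \<and> A <+>\<^bsub>?N\<^esub> B = carrier ?N"
    then have A: "submodule A AA ?N" and B: "submodule B AA ?N" and AB: "A \<inter> B = {\<zero>\<^bsub>?N\<^esub>}"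
      and sum: "A <+>\<^bsub>?N\<^esub> B = carrier ?N" by blast+
    have one: "unit_vec v \<in> A \<or> unit_vec v \<in> B" if v: "v \<in> walk_verts u es" for v
    proof -
      have "unit_vec v \<in> A <+>\<^bsub>?N\<^esub> B" using sum unit_vec_in[OF v] by (simp add: string_carrier[OF iw])
      then obtain a b where ab: "a \<in> A" "b \<in> B" "unit_vec v = (\<lambda>n. a n + b n)"
        by (auto simp: set_add_def' string_add[OF iw])
      have "a (vnum v) + b (vnum v) = 1" using fun_cong[OF ab(3), of "vnum v"] by (simp add: unit_vec_def)
      then have "a (vnum v) \<noteq> 0 \<or> b (vnum v) \<noteq> 0" by auto
      then show ?thesis using unit_vec_mem[OF A ab(1) _ v] unit_vec_mem[OF B ab(2) _ v] by blast
    qed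
    show "A = {\<zero>\<^bsub>?N\<^esub>} \<or> B = {\<zero>\<^bsub>?N\<^esub>}"
    proof (cases "unit_vec u \<in> A")
      case True
      then show ?thesis using start[OF A B AB one] by blast
    next
      case False
      moreover have "unit_vec v \<in> B \<or> unit_vec v \<in> A" if "v \<in> walk_verts u es" for v
        using one[OF that] by blast
      ultimately show ?thesis
        using start[OF B A] AB one[of u] by (simp add: Int_commute)
    qed
  qed
qed

lemma finite_dim_string:
  "finite_dim_module (algebra_scalar G F :: 'k::field \<Rightarrow> _) (string_module u es :: (_, nat \<Rightarrow> 'k) module)"
proof -
  let ?N = "string_module u es :: (_, nat \<Rightarrow> 'k) module" and ?U = "walk_verts u es"
  interpret N: right_module AA ?N by (rule right_module_string[OF iw])
  have fsum: "(\<Oplus>\<^bsub>?N\<^esub>b\<in>B. g b) = (\<lambda>n. \<Sum>b\<in>B. g b n)"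
    if "finite B" "\<And>b. b \<in> B \<Longrightarrow> g b \<in> S.string_space" for B and g :: "(nat \<Rightarrow> 'k) \<Rightarrow> nat \<Rightarrow> 'k"
    using that
  proof (induction B)
    case (insert b B)
    then show ?case
      by (subst N.M.finsum_insert) (auto simp: string_add[OF iw] string_carrier[OF iw])
  qed (simp add: string_zero[OF iw])
  define B :: "(nat \<Rightarrow> 'k) set" where "B = unit_vec ` ?U"
  have inj: "inj_on (unit_vec :: 'v \<Rightarrow> nat \<Rightarrow> 'k) ?U"
  proof (rule inj_onI)
    fix v w assume vw: "v \<in> ?U" "w \<in> ?U" and eq: "(unit_vec v :: nat \<Rightarrow> 'k) = unit_vec w"
    from fun_cong[OF eq, of "vnum v"] show "v = w"
      using walk_inner[OF vw(1)] walk_inner[OF vw(2)] by (simp add: unit_vec_def split: if_splits)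
  qed
  have "\<exists>c. x = (\<Oplus>\<^bsub>?N\<^esub>b\<in>B. algebra_scalar G F (c b) \<odot>\<^bsub>?N\<^esub> b)" if x: "x \<in> carrier ?N" for x
  proof
    \<comment> \<open>Coefficients are indexed by basis vectors and not by vertices, so the vertex
      must be recovered from \<open>b\<close>; pairing \<open>b\<close> with \<open>x\<close> does
      this.\<close>
    let ?c = "\<lambda>b :: nat \<Rightarrow> 'k. \<Sum>w\<in>?U. x (vnum w) * b (vnum w)"
    have c: "?c (unit_vec v) = x (vnum v)" if "v \<in> ?U" for v
    proof -
      have "?c (unit_vec v) = (\<Sum>w\<in>?U. if w = v then x (vnum v) else 0)"
        using that walk_inner by (intro sum.cong) (auto simp: unit_vec_def)
      then show ?thesis using that by simp
    qed
    have Bs: "b \<in> S.string_space" if "b \<in> B" for b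
      using that unit_vec_in by (auto simp: B_def)
    have "(\<Oplus>\<^bsub>?N\<^esub>b\<in>B. algebra_scalar G F (?c b) \<odot>\<^bsub>?N\<^esub> b) = (\<lambda>n. \<Sum>b\<in>B. (algebra_scalar G F (?c b) \<odot>\<^bsub>?N\<^esub> b) n)"
    proof (rule fsum)
      show "finite B" by (simp add: B_def)
      show "algebra_scalar G F (?c b) \<odot>\<^bsub>?N\<^esub> b \<in> S.string_space" if "b \<in> B" for b
        using N.smult_closed[of "algebra_scalar G F (?c b)" b] Bs[OF that]
        by (simp add: string_carrier[OF iw] algebra_scalar_eq cl_closed)
    qed
    also have "\<dots> = (\<lambda>n. \<Sum>b\<in>B. ?c b * b n)"
      using Bs by (auto simp: string_scalar[OF iw] fun_eq_iff intro!: sum.cong)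
    also have "\<dots> = (\<lambda>n. \<Sum>v\<in>?U. x (vnum v) * unit_vec v n)"
      using inj c by (auto simp: B_def sum.reindex fun_eq_iff intro!: sum.cong)
    also have "\<dots> = x"
    proof
      fix n
      show "(\<Sum>v\<in>?U. x (vnum v) * unit_vec v n) = x n"
      proof (cases "n \<in> vnum ` ?U")
        case True
        then obtain w where w: "w \<in> ?U" "n = vnum w" by blast
        have "(\<Sum>v\<in>?U. x (vnum v) * unit_vec v n) = (\<Sum>v\<in>?U. if v = w then x n else 0)"
          using w walk_inner by (intro sum.cong) (auto simp: unit_vec_def)
        then show ?thesis using w by simp
      next
        case False
        then have "x n = 0" using x by (auto simp: string_carrier[OF iw] S.string_space_def)
        then show ?thesis using False by (auto simp: unit_vec_def intro!: sum.neutral)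
      qed
    qed
    finally show "x = (\<Oplus>\<^bsub>?N\<^esub>b\<in>B. algebra_scalar G F (?c b) \<odot>\<^bsub>?N\<^esub> b)" by simp
  qed
  moreover have "finite B" "B \<subseteq> carrier ?N"
    using unit_vec_in by (auto simp: B_def string_carrier[OF iw])
  ultimately show ?thesis unfolding finite_dim_module_def by blast
qed

lemma vert_acts_iff:
  assumes v: "v \<in> inner_verts G"
  shows "(\<forall>x \<in> carrier (string_module u es :: (_, nat \<Rightarrow> 'k::field) module).
      vertex_idem G F v \<odot>\<^bsub>string_module u es\<^esub> x = \<zero>\<^bsub>string_module u es\<^esub>) \<longleftrightarrow> v \<notin> walk_verts u es"
proof
  assume *: "\<forall>x \<in> carrier (string_module u es :: (_, nat \<Rightarrow> 'k) module).
      vertex_idem G F v \<odot>\<^bsub>string_module u es\<^esub> x = \<zero>\<^bsub>string_module u es\<^esub>"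
  show "v \<notin> walk_verts u es"
  proof
    assume vU: "v \<in> walk_verts u es"
    then have "vertex_idem G F v \<odot>\<^bsub>string_module u es\<^esub> (unit_vec v :: nat \<Rightarrow> 'k) = (\<lambda>_. 0)"
      using *[rule_format, of "unit_vec v"] by (simp add: unit_vec_in string_carrier[OF iw] string_zero[OF iw])
    from fun_cong[OF this, of "vnum v"] show False
      using vU v by (simp add: string_vert[OF iw] unit_vec_def)
  qed
qed (use v in \<open>simp add: string_vert[OF iw] string_zero[OF iw]\<close>)

lemma arc_acts_iff:
  assumes e: "e \<in> qarcs"
  shows "(\<forall>x \<in> carrier (string_module u es :: (_, nat \<Rightarrow> 'k::field) module).
      cl (path_elem (qtail e, [e])) \<odot>\<^bsub>string_module u es\<^esub> x = \<zero>\<^bsub>string_module u es\<^esub>) \<longleftrightarrow> e \<notin> set es"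
proof
  assume *: "\<forall>x \<in> carrier (string_module u es :: (_, nat \<Rightarrow> 'k) module).
      cl (path_elem (qtail e, [e])) \<odot>\<^bsub>string_module u es\<^esub> x = \<zero>\<^bsub>string_module u es\<^esub>"
  show "e \<notin> set es"
  proof
    assume eE: "e \<in> set es"
    then have "qtail e \<in> walk_verts u es"
      using iwalk_arc[OF iw eE] by (auto simp: qtail_def)
    then have "cl (path_elem (qtail e, [e])) \<odot>\<^bsub>string_module u es\<^esub> (unit_vec (qtail e) :: nat \<Rightarrow> 'k) = (\<lambda>_. 0)"
      using *[rule_format, of "unit_vec (qtail e)"] by (simp add: unit_vec_in string_carrier[OF iw] string_zero[OF iw])
    from fun_cong[OF this, of "vnum (qhead e)"] show False
      using eE by (simp add: string_arc[OF iw e] unit_vec_def)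
  qed
qed (use e in \<open>simp add: string_arc[OF iw] string_zero[OF iw]\<close>)

end

lemma string_module_inj:
  assumes "iwalk u es" "iwalk v fs"
    and iso: "module_iso AA (string_module u es :: (_, nat \<Rightarrow> 'k::field) module) (string_module v fs :: (_, nat \<Rightarrow> 'k) module)"
  shows "u = v \<and> es = fs"
proof (rule iwalk_determined[OF assms(1,2)])
  note ann = module_iso_annihilates[OF right_module_string[OF assms(1)] right_module_string[OF assms(2)] iso]
  have "w \<in> walk_verts u es \<longleftrightarrow> w \<in> walk_verts v fs" if w: "w \<in> inner_verts G" for w
    using ann[of "vertex_idem G F w"] vert_acts_iff[OF assms(1) w, where ?'k = 'k]
      vert_acts_iff[OF assms(2) w, where ?'k = 'k] w
    by (simp add: vertex_idem_eq cl_closed)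
  then show "walk_verts u es = walk_verts v fs"
    using iwalk_vert[OF assms(1)] iwalk_vert[OF assms(2)] by blast
  have "e \<in> set es \<longleftrightarrow> e \<in> set fs" if e: "e \<in> qarcs" for e
    using ann[of "cl (path_elem (qtail e, [e]))"] arc_acts_iff[OF assms(1) e, where ?'k = 'k]
      arc_acts_iff[OF assms(2) e, where ?'k = 'k] e
    by (simp add: cl_closed)
  then show "set es = set fs"
    using iwalk_arc[OF assms(1)] iwalk_arc[OF assms(2)] by blast
qed

lemma bij_string_classes:
  "bij_betw (\<lambda>(u, es). iso_class AA (string_module u es :: (_, nat \<Rightarrow> 'k::field) module))
     {(u, es). iwalk u es}
     (indec_classes G F :: ((('v,'e) qpath \<Rightarrow> 'k) set, 'k) module_class set)"
proof (rule bij_betw_imageI)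
  show "inj_on (\<lambda>(u, es). iso_class AA (string_module u es :: (_, nat \<Rightarrow> 'k) module) :: (_, 'k) module_class) {(u, es). iwalk u es}"
  proof (rule inj_onI, clarify)
    fix u es v fs
    assume w: "iwalk u es" "iwalk v fs"
      and eq: "(iso_class AA (string_module u es :: (_, nat \<Rightarrow> 'k) module) :: (_, 'k) module_class) =
        iso_class AA (string_module v fs :: (_, nat \<Rightarrow> 'k) module)"
    have "string_module u es \<in> (iso_class AA (string_module u es :: (_, nat \<Rightarrow> 'k) module) :: (_, 'k) module_class)"
      using right_module_string[OF w(1)] by (simp add: iso_class_def module_iso_refl)
    from string_module_inj[OF w iso_class_eqD[OF right_module_string[OF w(2)] this eq]]
    show "u = v \<and> es = fs" .
  qed
  show "(\<lambda>(u, es). iso_class AA (string_module u es :: (_, nat \<Rightarrow> 'k) module)) ` {(u, es). iwalk u es} =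
      (indec_classes G F :: (_, 'k) module_class set)"
  proof (intro equalityI subsetI)
    fix X :: "((('v,'e) qpath \<Rightarrow> 'k) set, 'k) module_class"
    assume "X \<in> (\<lambda>(u, es). iso_class AA (string_module u es :: (_, nat \<Rightarrow> 'k) module)) ` {(u, es). iwalk u es}"
    then obtain u es where "iwalk u es" "X = iso_class AA (string_module u es :: (_, nat \<Rightarrow> 'k) module)"
      by auto
    then show "X \<in> indec_classes G F"
      unfolding indec_classes_def
      using right_module_string finite_dim_string indecomposable_string by blast
  next
    fix X :: "((('v,'e) qpath \<Rightarrow> 'k) set, 'k) module_class"
    assume "X \<in> indec_classes G F"
    then obtain M :: "(_, nat \<Rightarrow> 'k) module" where M: "X = iso_class AA M" "right_module AA M" "indecomposable AA M"
      unfolding indec_classes_def by blast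
    obtain u es where w: "iwalk u es" "module_iso AA M (string_module u es :: (_, nat \<Rightarrow> 'k) module)"
      using M(2,3) by (rule indecomposable_iso_string)
    then have "X = iso_class AA (string_module u es :: (_, nat \<Rightarrow> 'k) module)"
      using iso_class_cong[OF M(2) w(2)] M(1) by simp
    then show "X \<in> (\<lambda>(u, es). iso_class AA (string_module u es :: (_, nat \<Rightarrow> 'k) module)) ` {(u, es). iwalk u es}"
      using w(1) by blast
  qed
qed

section \<open>Classes of indecomposable projectives\<close>

lemma cl_self: "f \<in> carrier (PA :: (('v,'e) qpath \<Rightarrow> 'k::field) ring) \<Longrightarrow> f \<in> cl f"
proof -
  interpret ideal "relation_ideal G F" "PA :: (('v,'e) qpath \<Rightarrow> 'k) ring"
    by (rule ideal_relations)
  assume "f \<in> carrier (PA :: (('v,'e) qpath \<Rightarrow> 'k) ring)"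
  then show ?thesis
    unfolding cl_def a_r_coset_def'
    using additive_subgroup.zero_closed[OF additive_subgroup_axioms] by (force intro: bexI[of _ "\<zero>\<^bsub>PA\<^esub>"])
qed

lemma cl_memD:
  assumes "f \<in> carrier (PA :: (('v,'e) qpath \<Rightarrow> 'k::field) ring)" "g \<in> cl f"
  obtains h where "h \<in> relation_ideal G F" "h \<in> carrier PA" "g = h \<oplus>\<^bsub>PA\<^esub> f"
proof -
  interpret ideal "relation_ideal G F" "PA :: (('v,'e) qpath \<Rightarrow> 'k) ring"
    by (rule ideal_relations)
  from assms(2) obtain h where "h \<in> relation_ideal G F" "g = h \<oplus>\<^bsub>PA\<^esub> f"
    unfolding cl_def a_r_coset_def' by blast
  then show ?thesis using that Icarr by blast
qed

lemma cl_eq_of_mem: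
  assumes f: "f \<in> carrier (PA :: (('v,'e) qpath \<Rightarrow> 'k::field) ring)" and g: "g \<in> cl f"
  shows "g \<in> carrier PA" "cl g = cl f"
proof -
  interpret A: ring "PA :: (('v,'e) qpath \<Rightarrow> 'k) ring" by (rule ring_PA)
  interpret B: ring "AA :: (('v,'e) qpath \<Rightarrow> 'k) set ring" by (rule ring_AA)
  obtain h where h: "h \<in> relation_ideal G F" "h \<in> carrier PA" "g = h \<oplus>\<^bsub>PA\<^esub> f"
    using assms by (rule cl_memD)
  show "g \<in> carrier PA" using h f by simp
  show "cl g = cl f"
    using h f cl_relation[OF h(1)] cl_closed[OF f] by (simp add: cl_add cl_zero)
qed

lemma trivial_path_mult:
  "(f \<otimes>\<^bsub>PA\<^esub> g) (v, []) = f (v, []) * (g (v, []) :: 'k::field)"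
  by (simp add: path_algebra_mult_apply pre_digraph.awalk_verts.simps)

text \<open>The coefficient at a trivial path is multiplicative and vanishes on the relations, which
  are paths of length two; so it descends to the quotient.\<close>

lemma cl_eq_trivial_path:
  assumes f: "f \<in> carrier (PA :: (('v,'e) qpath \<Rightarrow> 'k::field) ring)" and g: "g \<in> carrier PA" and eq: "cl f = cl g"
  shows "f (v, []) = g (v, [])"
proof -
  interpret A: ring "PA :: (('v,'e) qpath \<Rightarrow> 'k) ring" by (rule ring_PA)
  let ?J = "{f \<in> carrier PA. f (v, []) = 0} :: (('v,'e) qpath \<Rightarrow> 'k) set"
  have "ideal ?J PA"
  proof (rule idealI)
    show "subgroup ?J (add_monoid PA)"
    proof (rule A.add.subgroupI)
      show "?J \<noteq> {}" using A.zero_closed by (fastforce simp: path_algebra_zero)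
      show "\<ominus>\<^bsub>PA\<^esub> f \<in> ?J" if "f \<in> ?J" for f
      proof -
        have f: "f \<in> carrier PA" "f (v, []) = 0" using that by auto
        have "(f \<oplus>\<^bsub>PA\<^esub> \<ominus>\<^bsub>PA\<^esub> f) (v, []) = (\<ominus>\<^bsub>PA\<^esub> f) (v, [])"
          using f by (simp add: path_algebra_add)
        then show ?thesis using f by (simp add: A.r_neg path_algebra_zero)
      qed
      show "f \<oplus>\<^bsub>PA\<^esub> g \<in> ?J" if "f \<in> ?J" "g \<in> ?J" for f g
        using that A.a_closed[of f g] by (simp add: path_algebra_add)
    qed auto
  qed (auto simp: trivial_path_mult ring_PA)
  moreover have "path_elem (qtail a, [a, b]) \<in> ?J" if "a \<in> qarcs" "b \<in> qarcs" "qhead a = qtail b" for a b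
    using that
    by (auto intro!: path_elem_closed simp: qpaths_Cons_iff qpaths_Nil_iff wf_digraph_quiver qarcs_ends)
      (simp add: path_elem_def)
  ultimately have sub: "relation_ideal G F \<subseteq> ?J"
    by (intro relation_ideal_subset)
  have "f \<in> cl g" using cl_self[OF f] eq by simp
  with g obtain h where "h \<in> relation_ideal G F" "f = h \<oplus>\<^bsub>PA\<^esub> g" by (rule cl_memD)
  then show ?thesis using sub by (auto simp: path_algebra_add)
qed

text \<open>An isomorphism would factor the idempotent at \<open>j\<close> through the one at \<open>i\<close>, which the character
  \<open>f \<mapsto> f (j, [])\<close> detects.\<close>

lemma projective_iso_imp_eq:
  assumes i: "i \<in> inner_verts G" and j: "j \<in> inner_verts G"
    and iso: "module_iso AA (right_ideal_module AA (vertex_idem G F i :: (('v,'e) qpath \<Rightarrow> 'k::field) set))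
      (right_ideal_module AA (vertex_idem G F j))"
  shows "i = j"
proof (rule ccontr)
  assume ne: "i \<noteq> j"
  interpret A: ring "PA :: (('v,'e) qpath \<Rightarrow> 'k) ring" by (rule ring_PA)
  interpret B: ring "AA :: (('v,'e) qpath \<Rightarrow> 'k) set ring" by (rule ring_AA)
  let ?i = "path_elem (i, []) :: ('v,'e) qpath \<Rightarrow> 'k" and ?j = "path_elem (j, []) :: ('v,'e) qpath \<Rightarrow> 'k"
  let ?P = "right_ideal_module AA (cl ?i)" and ?P' = "right_ideal_module AA (cl ?j)"
  have c: "?i \<in> carrier PA" "?j \<in> carrier PA" using i j by simp_all
  have ii: "?i \<otimes>\<^bsub>PA\<^esub> ?i = ?i" by (simp add: path_elem_mult pre_digraph.awalk_verts.simps)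
  have car: "carrier ?P = {cl ?i \<otimes>\<^bsub>AA\<^esub> x | x. x \<in> carrier AA}" "carrier ?P' = {cl ?j \<otimes>\<^bsub>AA\<^esub> x | x. x \<in> carrier AA}"
    by (simp_all add: right_ideal_module_def)
  obtain f where f: "bij_betw f (carrier ?P) (carrier ?P')" "right_module_hom AA ?P ?P' f"
    using iso unfolding vertex_idem_eq module_iso_hom by blast
  have iP: "cl ?i \<in> carrier ?P"
    unfolding car mem_Collect_eq using cl_closed[OF c(1)] by (intro exI[of _ "\<one>\<^bsub>AA\<^esub>"]) simp
  have jP: "cl ?j \<in> carrier ?P'"
    unfolding car mem_Collect_eq using cl_closed[OF c(2)] by (intro exI[of _ "\<one>\<^bsub>AA\<^esub>"]) simp
  have fs: "f (x \<otimes>\<^bsub>AA\<^esub> r) = f x \<otimes>\<^bsub>AA\<^esub> r" if "r \<in> carrier AA" "x \<in> carrier ?P" for r x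
    using f(2) that by (simp add: right_module_hom_def right_ideal_module_def)
  have "f (cl ?i) \<in> carrier ?P'" using f(2) iP by (simp add: right_module_hom_def)
  then obtain X where X: "X \<in> carrier AA" "f (cl ?i) = cl ?j \<otimes>\<^bsub>AA\<^esub> X" unfolding car by blast
  have "cl ?j \<in> f ` carrier ?P"
    unfolding bij_betw_imp_surj_on[OF f(1)] by (rule jP)
  then obtain y where y: "cl ?j = f y" "y \<in> carrier ?P" by (rule imageE)
  from y(2) obtain Y where Y: "Y \<in> carrier AA" "y = cl ?i \<otimes>\<^bsub>AA\<^esub> Y" unfolding car by blast
  obtain x y where xy: "x \<in> carrier PA" "X = cl x" "y \<in> carrier PA" "Y = cl y"
    using X(1) Y(1) by (auto simp: carrier_AA)
  \<comment> \<open>The idempotent law for \<open>?i\<close> places the image of the generator in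
    the corner between \<open>j\<close> and \<open>i\<close>, which brings the factor
    \<open>?i\<close> into \<open>eq\<close> below.\<close>
  have fi: "f (cl ?i) \<otimes>\<^bsub>AA\<^esub> cl ?i = f (cl ?i)"
    using fs[OF cl_closed[OF c(1)] iP] c ii by (simp flip: cl_mult)
  have "cl ?j = f (cl ?i) \<otimes>\<^bsub>AA\<^esub> Y"
    unfolding y(1) Y(2) by (rule fs[OF Y(1) iP])
  also have "f (cl ?i) = (cl ?j \<otimes>\<^bsub>AA\<^esub> X) \<otimes>\<^bsub>AA\<^esub> cl ?i"
    by (simp only: X(2)[symmetric] fi)
  also have "\<dots> \<otimes>\<^bsub>AA\<^esub> Y = cl (((?j \<otimes>\<^bsub>PA\<^esub> x) \<otimes>\<^bsub>PA\<^esub> ?i) \<otimes>\<^bsub>PA\<^esub> y)"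
    using xy c by (simp add: cl_mult)
  finally have eq: "cl ?j = cl (((?j \<otimes>\<^bsub>PA\<^esub> x) \<otimes>\<^bsub>PA\<^esub> ?i) \<otimes>\<^bsub>PA\<^esub> y)" .
  have "((?j \<otimes>\<^bsub>PA\<^esub> x) \<otimes>\<^bsub>PA\<^esub> ?i) \<otimes>\<^bsub>PA\<^esub> y \<in> carrier PA"
    using xy c by simp
  \<comment> \<open>At the trivial path at \<open>j\<close> the left side of \<open>eq\<close> has
    coefficient 1, while the factor \<open>?i\<close> makes the right side 0.\<close>
  from cl_eq_trivial_path[OF c(2) this eq, of j] show False
    using ne by (simp add: trivial_path_mult) (simp add: path_elem_def)
qed

text \<open>A member of the class needs sequences as elements. There are only countably many paths,
  so an algebra element can be encoded by the coefficients of a chosen representative.\<close>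

lemma projective_class_nonempty:
  assumes i: "i \<in> inner_verts G"
  shows "(projective_class G F i :: ((('v,'e) qpath \<Rightarrow> 'k::field) set, 'k) module_class) \<noteq> {}"
proof -
  let ?A = "AA :: (('v,'e) qpath \<Rightarrow> 'k) set ring"
  let ?e = "vertex_idem G F i :: (('v,'e) qpath \<Rightarrow> 'k) set"
  interpret B: ring ?A by (rule ring_AA)
  have e: "?e \<in> carrier ?A" using i by (simp add: vertex_idem_eq cl_closed)
  have "qpaths Q \<subseteq> verts Q \<times> UNIV"
    by (auto simp: qpaths_def simp del: quiver_verts dest: wf_digraph.awalk_hd_in_verts[OF wf_digraph_quiver])
  moreover have "countable (verts Q \<times> (UNIV :: 'e list set))"
    by (rule countable_SIGMA[OF countable_finite[OF finite_quiver_verts] countableI_type])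
  ultimately have count: "countable (qpaths Q)" by (rule countable_subset)
  define rep :: "(('v,'e) qpath \<Rightarrow> 'k) set \<Rightarrow> ('v,'e) qpath \<Rightarrow> 'k" where "rep X = (SOME f. f \<in> X)" for X
  have rep: "rep X \<in> carrier PA \<and> cl (rep X) = X" if X: "X \<in> carrier ?A" for X
  proof -
    obtain f where f: "f \<in> carrier PA" "X = cl f" using X by (auto simp: carrier_AA)
    have "rep X \<in> cl f" unfolding rep_def f(2) by (rule someI[of "\<lambda>g. g \<in> cl f", OF cl_self[OF f(1)]])
    then show ?thesis using cl_eq_of_mem[OF f(1)] f(2) by auto
  qed
  have "inj_on (\<lambda>X n. rep X (from_nat_into (qpaths Q) n)) (carrier ?A)"
  proof (rule inj_onI)
    fix X Y assume X: "X \<in> carrier ?A" and Y: "Y \<in> carrier ?A"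
      and eq: "(\<lambda>n. rep X (from_nat_into (qpaths Q) n)) = (\<lambda>n. rep Y (from_nat_into (qpaths Q) n))"
    have "rep X p = rep Y p" for p
    proof (cases "p \<in> qpaths Q")
      case True
      then show ?thesis using from_nat_into_surj[OF count True] fun_cong[OF eq] by metis
    next
      case False
      then have "rep X p = 0" "rep Y p = 0"
        using rep[OF X] rep[OF Y] unfolding path_algebra_carrier by blast+
      then show ?thesis by simp
    qed
    then have "rep X = rep Y" by blast
    then show "X = Y" using rep[OF X] rep[OF Y] by metis
  qed
  moreover have "carrier (right_ideal_module ?A ?e) \<subseteq> carrier ?A"
    using e by (auto simp: right_ideal_module_def)
  ultimately have "inj_on (\<lambda>X n. rep X (from_nat_into (qpaths Q) n)) (carrier (right_ideal_module ?A ?e))"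
    by (rule inj_on_subset)
  from module_transport[OF right_ideal_module[OF ring_AA e] this] show ?thesis
    by (auto simp: projective_class_def iso_class_def)
qed

lemma inj_on_projective_class:
  "inj_on (projective_class G F :: 'v \<Rightarrow> ((('v,'e) qpath \<Rightarrow> 'k::field) set, 'k) module_class) (inner_verts G)"
proof (rule inj_onI)
  fix i j assume i: "i \<in> inner_verts G" and j: "j \<in> inner_verts G"
    and eq: "(projective_class G F i :: ((('v,'e) qpath \<Rightarrow> 'k) set, 'k) module_class) = projective_class G F j"
  obtain N where N: "N \<in> (projective_class G F i :: ((('v,'e) qpath \<Rightarrow> 'k) set, 'k) module_class)"
    using projective_class_nonempty[OF i] by blast
  have "right_module AA (right_ideal_module AA (vertex_idem G F v :: (('v,'e) qpath \<Rightarrow> 'k) set))" if "v \<in> inner_verts G" for v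
    using that by (intro right_ideal_module ring_AA) (simp add: vertex_idem_eq cl_closed)
  from iso_class_eqD[OF this[OF j]] show "i = j"
    using N eq projective_iso_imp_eq[OF i j] unfolding projective_class_def by blast
qed

text \<open>The constructors keep the two sorts apart, so a projective and its shift count
  separately even though they carry the same class.\<close>

lemma bij_tau_objects:
  "\<exists>\<beta>. bij_betw \<beta> ({(u, es). iwalk u es} <+> inner_verts G)
     (tau_objects G F :: ((('v,'e) qpath \<Rightarrow> 'k::field) set, 'k) module_class shifted_or_not set)"
proof -
  let ?s = "\<lambda>(u, es). iso_class AA (string_module u es :: (_, nat \<Rightarrow> 'k) module) :: ((('v,'e) qpath \<Rightarrow> 'k) set, 'k) module_class"
  let ?p = "projective_class G F :: 'v \<Rightarrow> ((('v,'e) qpath \<Rightarrow> 'k) set, 'k) module_class"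
  let ?\<beta> = "case_sum (Unshifted \<circ> ?s) (Shifted \<circ> ?p)"
  have s: "inj_on ?s {(u, es). iwalk u es}" "?s ` {(u, es). iwalk u es} = indec_classes G F"
    using bij_string_classes[where ?'k = 'k] unfolding bij_betw_def by blast+
  have "inj_on ?\<beta> ({(u, es). iwalk u es} <+> inner_verts G)"
  proof (rule inj_onI)
    fix x y assume xy: "x \<in> {(u, es). iwalk u es} <+> inner_verts G" "y \<in> {(u, es). iwalk u es} <+> inner_verts G"
      and eq: "?\<beta> x = ?\<beta> y"
    show "x = y"
    proof (cases x)
      case (Inl a)
      then obtain b where "y = Inl b" using eq by (cases y) auto
      then show ?thesis using Inl eq xy inj_onD[OF s(1), of a b] by auto
    next
      case (Inr a)
      then obtain b where "y = Inr b" using eq by (cases y) auto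
      then show ?thesis using Inr eq xy inj_onD[OF inj_on_projective_class[where ?'k = 'k], of a b] by auto
    qed
  qed
  moreover have "?\<beta> ` ({(u, es). iwalk u es} <+> inner_verts G) = tau_objects G F"
    unfolding tau_objects_def Plus_def image_Un image_image sum.case comp_def quiver_verts
    using s(2) by (simp add: image_image[symmetric])
  ultimately show ?thesis
    unfolding bij_betw_def by blast
qed

end

theorem theorem5p7:
  fixes G :: "('v, 'e::finite) pre_digraph" and F :: "('v, 'e) framing"
  assumes "full_dag G" and "is_framing G F" and "ample G F"
  shows "\<exists>\<phi>. bij_betw \<phi> (nonexceptional_routes G F)
    (tau_objects G F ::
      ((('v, 'e) qpath \<Rightarrow> 'k::alg_closed_field) set, 'k) module_class shifted_or_not set)"
proof -
  interpret full_dag G by fact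
  interpret ample_full_dag G F
    by unfold_locales (fact assms)+
  have "bij_betw (the_inv_into walk_data extend_walk) (nonexceptional_routes G F) walk_data"
    unfolding nonexceptional_eq by (rule bij_betw_the_inv_into[OF bij_extend_walk])
  from bij_betw_trans[OF this bij_walk_data] bij_tau_objects show ?thesis
    by (blast intro: bij_betw_trans)
qed


end
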